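(* Let $K,P\geqslant1/2$ be real numbers, let $h(\kappa,p)=\exp\left(-(\kappa/K)^2-(p/P)^2\right)$ for $(\kappa,p)\in\mathbb{R}\times\mathbb{Z}$, and for $z\in\mathbb{C}\smallsetminus\{0\}$ let $$\mathcal{H}(z)=\iint_{\mathcal{A}}h(\kappa,p)\,\boldsymbol{J}_{i\kappa,p}(z)\,(\kappa^2+p^2)\,\mathrm{d}\mu(\kappa,p).$$ Then for all $z\in\mathbb{C}\smallsetminus\{0\}$ $$\mathcal{H}(z)=-\iint_{\widehat{\mathcal{A}}}\cos\big(2\,\mathrm{Re}(z\,\mathrm{trh}(r,\omega))\big)\,\big(k''(r)\theta(\omega)+k(r)\theta''(\omega)\big)\,\mathrm{d}\widehat{\mu}(r,\omega),$$ where $$\mathrm{trh}(r,\omega)=\cosh r\cos\omega+i\sinh r\sin\omega,$$ $$k(r)=\sqrt{\pi}\,K\exp\big(-(Kr)^2\big),\qquad\theta(\omega)=\sqrt{\pi}\,P\sum_{q\in\mathbb{Z}}\exp\big(-(P(\omega+\pi q))^2\big).$$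
   Context: $\mathcal{A}=\mathbb{R}\times\mathbb{Z}$ with $\mathrm{d}\mu(\kappa,p)$ equal to Lebesgue measure on $\mathbb{R}$ times counting measure on $\mathbb{Z}$; $\widehat{\mathcal{A}}=\mathbb{R}\times\mathbb{R}/\pi\mathbb{Z}$ with $\mathrm{d}\widehat{\mu}(r,\omega)$ the usual Lebesgue measure $\mathrm{d}r\,\mathrm{d}\omega$ (total mass $\pi$ in $\omega$). With $J_\nu(z)=\sum_{n=0}^\infty\frac{(-1)^n(z/2)^{\nu+2n}}{n!\,\Gamma(\nu+n+1)}$ the classical Bessel function, for $\nu\in\mathbb{C}$, $p\in\mathbb{Z}$ and $z\in\mathbb{C}\smallsetminus\{0\}$ define $$J_{\nu,p}(z)=J_{\nu+p}(z)\,J_{\nu-p}(\overline{z}),\qquad\boldsymbol{J}_{\nu,p}(z)=\frac{2\pi^2}{\sin(\pi\nu)}\big(J_{-\nu,-p}(z)-J_{\nu,p}(z)\big),$$ where $J_{\nu,p}(z)$ is single-valued (taking conjugate branches for $z$ and $\overline z$, so that $z^{\nu+p}\overline z^{\,\nu-p}=|z|^{2\nu}(z/|z|)^{2p}$), and $\boldsymbol{J}_{\nu,p}(z)$ is defined by its limit in $\nu$ when $\sin(\pi\nu)=0$; it is complex analytic in $\nu$. *)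

theory Defs
  imports "HOL-Analysis.Analysis"
begin

text \<open>
  The Bessel function is multivalued in its argument, so it is written as a function of a
  logarithm \<open>l\<close> of the argument: \<open>bessel_J_log \<nu> l\<close> is $J_\nu(e^l)$ with
  \<open>(e^l / 2)^s\<close> read as \<open>exp (s * (l - ln 2))\<close>. The function \<^const>\<open>rGamma\<close> is the entire
  function $1/\Gamma$.
\<close>

definition bessel_J_log :: "complex \<Rightarrow> complex \<Rightarrow> complex" where
  "bessel_J_log \<nu> l =
     (\<Sum>n. (-1) ^ n * exp ((\<nu> + 2 * of_nat n) * (l - of_real (ln 2)))
            / fact n * rGamma (\<nu> + of_nat n + 1))"

lemma bessel_J_log_Ln:
  assumes "z \<noteq> 0"
  shows "bessel_J_log \<nu> (Ln z) =
     (\<Sum>n. (-1) ^ n * (z / 2) powr (\<nu> + 2 * of_nat n) / (fact n * Gamma (\<nu> + of_nat n + 1)))"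
proof -
  have "Ln (z / 2) = Ln z - of_real (ln 2)"
    using Ln_divide_of_real[of 2 z] assms by simp
  then show ?thesis
    using assms by (simp add: bessel_J_log_def powr_def rGamma_inverse_Gamma divide_simps)
qed

text \<open>
  Conjugate branches are taken for \<open>z\<close> and \<open>cnj z\<close>; on the negative real axis
  \<open>cnj (Ln z)\<close> is not \<open>Ln (cnj z)\<close>.
\<close>

definition bessel_J2 :: "complex \<Rightarrow> int \<Rightarrow> complex \<Rightarrow> complex" where
  "bessel_J2 \<nu> p z =
     bessel_J_log (\<nu> + of_int p) (Ln z) * bessel_J_log (\<nu> - of_int p) (cnj (Ln z))"

lemma bessel_J_log_summable:
  fixes \<nu> l :: complex
  shows "summable (\<lambda>n. (-1) ^ n * exp ((\<nu> + 2 * of_nat n) * (l - of_real (ln 2)))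
            / fact n * rGamma (\<nu> + of_nat n + 1))" (is "summable ?t")
proof -
  define w where "w = exp (2 * (l - of_real (ln 2)))"
  obtain N :: nat where N: "real N \<ge> norm \<nu> + 2 * norm w + 1"
    using real_arch_simple by blast
  show ?thesis
  proof (rule summable_ratio_test[where c = "1/2" and N = N])
    fix n assume n: "N \<le> n"
    define d where "d = \<nu> + of_nat n + 1"
    have "real n + 1 - norm \<nu> \<le> norm d"
    proof -
      have "norm (of_nat n + 1 :: complex) = real n + 1"
        by (metis norm_of_nat of_nat_1 of_nat_add)
      moreover have "norm (of_nat n + 1 :: complex) \<le> norm d + norm \<nu>"
        using norm_triangle_ineq4[of d \<nu>] by (simp add: d_def algebra_simps)
      ultimately show ?thesis by linarith
    qed
    moreover have nN: "real n \<ge> norm \<nu> + 2 * norm w + 1" using N n by linarith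
    moreover have "0 \<le> norm w" "0 \<le> norm \<nu>" by simp_all
    ultimately have d1: "norm d \<ge> 1" and n2: "2 * norm w \<le> real n + 1"
      by linarith+
    have e: "exp ((\<nu> + 2 * of_nat (Suc n)) * (l - of_real (ln 2))) =
        exp ((\<nu> + 2 * of_nat n) * (l - of_real (ln 2))) * w"
      by (simp add: w_def exp_add[symmetric] algebra_simps)
    have g: "rGamma (\<nu> + of_nat n + 1) = d * rGamma (\<nu> + of_nat (Suc n) + 1)"
      using rGamma_plus1[of d] by (simp add: d_def algebra_simps)
    have s: "?t n * w = - (of_nat (Suc n) * d * ?t (Suc n))"
    proof -
      have "a * b / fact n * (d * c) * w = - (of_nat (Suc n) * d * (- a * (b * w) / fact (Suc n) * c))"
        for a b c :: complex
      proof -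
        have "fact (Suc n) = (of_nat (Suc n) * fact n :: complex)" by (simp only: fact_Suc of_nat_mult of_nat_fact)
        moreover have "(of_nat (Suc n) :: complex) \<noteq> 0" by (rule of_nat_neq_0)
        ultimately show ?thesis by simp
      qed
      then show ?thesis unfolding e g power_Suc mult_minus1 .
    qed
    have "real (Suc n) * 1 * norm (?t (Suc n)) \<le> real (Suc n) * norm d * norm (?t (Suc n))"
      by (intro mult_right_mono mult_left_mono d1) auto
    also have "\<dots> = norm (?t n * w)"
      unfolding s norm_minus_cancel norm_mult[of _ "?t (Suc n)"] norm_mult[of _ d] norm_of_nat ..
    also have "\<dots> = norm w * norm (?t n)" by (simp only: norm_mult mult.commute)
    also have "\<dots> \<le> (1/2 * real (Suc n)) * norm (?t n)"
      using n2 by (intro mult_right_mono) auto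
    finally have "real (Suc n) * norm (?t (Suc n)) \<le> real (Suc n) * (1/2 * norm (?t n))"
      by (simp only: mult_1_right mult_1_left mult.assoc mult.left_commute)
    then show "norm (?t (Suc n)) \<le> 1/2 * norm (?t n)"
      by (rule mult_left_le_imp_le) simp
  qed simp
qed

lemma bessel_J_log_shift:
  "bessel_J_log \<nu> (l + of_int k * (2 * of_real pi * \<i>)) =
     exp (\<nu> * of_int k * (2 * of_real pi * \<i>)) * bessel_J_log \<nu> l"
proof -
  let ?t = "\<lambda>l n. (-1) ^ n * exp ((\<nu> + 2 * of_nat n) * (l - of_real (ln 2)))
            / fact n * rGamma (\<nu> + of_nat n + 1)"
  let ?c = "exp (\<nu> * of_int k * (2 * of_real pi * \<i>))"
  have eq: "?t (l + of_int k * (2 * of_real pi * \<i>)) = (\<lambda>n. ?c * ?t l n)"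
  proof
    fix n
    have "exp ((\<nu> + 2 * of_nat n) * (l + of_int k * (2 * of_real pi * \<i>) - of_real (ln 2))) =
      exp ((\<nu> + 2 * of_nat n) * (l - of_real (ln 2))) * ?c
        * exp (\<i> * (of_int (2 * int n * k) * (of_real pi * 2)))"
      by (simp add: exp_add[symmetric] algebra_simps)
    also have "exp (\<i> * (of_int (2 * int n * k) * (of_real pi * 2))) = 1"
      by (rule exp_2pi_1_int)
    finally show "?t (l + of_int k * (2 * of_real pi * \<i>)) n = ?c * ?t l n"
      by simp
  qed
  have "suminf (\<lambda>n. ?c * ?t l n) = ?c * suminf (?t l)"
    by (rule suminf_mult) (rule bessel_J_log_summable)
  then show ?thesis using eq unfolding bessel_J_log_def by simp
qed

lemma bessel_J2_branch:
  assumes "exp l = z"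
  shows "bessel_J2 \<nu> p z = bessel_J_log (\<nu> + of_int p) l * bessel_J_log (\<nu> - of_int p) (cnj l)"
proof -
  have "exp (Ln z) = exp l" using assms by auto
  then obtain k where "Ln z = l + of_int (2 * k) * of_real pi * \<i>"
    unfolding exp_eq by (auto simp: algebra_simps)
  then have k: "Ln z = l + of_int k * (2 * of_real pi * \<i>)" by (simp add: algebra_simps)
  then have k': "cnj (Ln z) = cnj l + of_int (- k) * (2 * of_real pi * \<i>)"
    by simp
  have "exp ((\<nu> + of_int p) * of_int k * (2 * of_real pi * \<i>)) *
        exp ((\<nu> - of_int p) * of_int (- k) * (2 * of_real pi * \<i>)) =
        exp (\<i> * (of_int (2 * p * k) * (of_real pi * 2)))"
    by (simp add: exp_add[symmetric] algebra_simps)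
  also have "\<dots> = 1" by (rule exp_2pi_1_int)
  finally have e: "exp ((\<nu> + of_int p) * of_int k * (2 * of_real pi * \<i>)) *
        exp ((\<nu> - of_int p) * of_int (- k) * (2 * of_real pi * \<i>)) = 1" .
  show ?thesis
    unfolding bessel_J2_def k' unfolding k bessel_J_log_shift
      mult.assoc[of "exp _"] mult.left_commute[of "bessel_J_log _ _" "exp _"]
    unfolding mult.assoc[of "exp _" "exp _", symmetric] e mult_1_left ..
qed

definition bold_J_quot :: "complex \<Rightarrow> int \<Rightarrow> complex \<Rightarrow> complex" where
  "bold_J_quot \<nu> p z =
     2 * of_real pi ^ 2 / sin (of_real pi * \<nu>) * (bessel_J2 (- \<nu>) (- p) z - bessel_J2 \<nu> p z)"

definition bold_J :: "complex \<Rightarrow> int \<Rightarrow> complex \<Rightarrow> complex" where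
  "bold_J \<nu> p z =
     (if sin (of_real pi * \<nu>) \<noteq> 0 then bold_J_quot \<nu> p z
      else Lim (at \<nu>) (\<lambda>\<mu>. bold_J_quot \<mu> p z))"

definition mu_A :: "(real \<times> int) measure" where
  "mu_A = lborel \<Otimes>\<^sub>M count_space UNIV"

text \<open>
  The circle \<open>\<real>/\<pi>\<int>\<close> is represented by its fundamental domain \<open>[0, \<pi>)\<close>; functions on it are
  \<open>\<pi>\<close>-periodic functions on the reals.
\<close>

definition mu_A_hat :: "(real \<times> real) measure" where
  "mu_A_hat = lborel \<Otimes>\<^sub>M restrict_space lborel {0..<pi}"

definition weight_h :: "real \<Rightarrow> real \<Rightarrow> real \<Rightarrow> int \<Rightarrow> real" where
  "weight_h K P \<kappa> p = exp (- (\<kappa> / K)\<^sup>2 - (of_int p / P)\<^sup>2)"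

definition H_integrand :: "real \<Rightarrow> real \<Rightarrow> complex \<Rightarrow> real \<times> int \<Rightarrow> complex" where
  "H_integrand K P z = (\<lambda>(\<kappa>, p).
     of_real (weight_h K P \<kappa> p) * bold_J (\<i> * of_real \<kappa>) p z * of_real (\<kappa>\<^sup>2 + (of_int p)\<^sup>2))"

definition trh :: "real \<Rightarrow> real \<Rightarrow> complex" where
  "trh r \<omega> = of_real (cosh r * cos \<omega>) + \<i> * of_real (sinh r * sin \<omega>)"

definition k_fun :: "real \<Rightarrow> real \<Rightarrow> real" where
  "k_fun K r = sqrt pi * K * exp (- (K * r)\<^sup>2)"

definition theta_fun :: "real \<Rightarrow> real \<Rightarrow> real" where
  "theta_fun P \<omega> = sqrt pi * P * (\<Sum>\<^sub>\<infinity>q\<in>(UNIV :: int set). exp (- (P * (\<omega> + pi * of_int q))\<^sup>2))"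

definition dual_integrand :: "real \<Rightarrow> real \<Rightarrow> complex \<Rightarrow> real \<times> real \<Rightarrow> real" where
  "dual_integrand K P z = (\<lambda>(r, \<omega>).
     cos (2 * Re (z * trh r \<omega>)) *
       (deriv (deriv (k_fun K)) r * theta_fun P \<omega> + k_fun K r * deriv (deriv (theta_fun P)) \<omega>))"

definition H_transform :: "real \<Rightarrow> real \<Rightarrow> complex \<Rightarrow> complex" where
  "H_transform K P z = integral\<^sup>L mu_A (H_integrand K P z)"

end

theory Submission
  imports Defs "HOL-Complex_Analysis.Complex_Analysis" "HOL-Probability.Probability"
begin

text \<open>
  The kernel \<open>bold_J\<close> on the imaginary axis is a double Fourier transform. For \<open>\<kappa> \<noteq> 0\<close> and \<open>z \<noteq> 0\<close>,

    \<open>bold_J (\<i> \<kappa>) p z = 4 \<integral>r\<in>\<real>. exp (- 2 \<i> \<kappa> r) (\<integral>\<omega>\<in>[0, \<pi>). cos (2 Re (z trh r \<omega>)) exp (- 2 \<i> p \<omega>))\<close>,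

  which is \<open>bold_J_integral\<close>. Granted this, the formula for the transform comes from integrating
  the spectral weight \<open>exp (- (\<kappa> / K)\<^sup>2 - (p / P)\<^sup>2) (\<kappa>\<^sup>2 + p\<^sup>2)\<close> against \<open>exp (- 2 \<i> \<kappa> r) exp (- 2 \<i> p \<omega>)\<close>:
  the Gaussian in \<open>\<kappa>\<close> turns into \<open>k_fun\<close>, the Gaussian in \<open>p\<close> turns into \<open>theta_fun\<close> by Poisson
  summation (\<open>theta_fun_poisson\<close>), and the factors \<open>- 4 \<kappa>\<^sup>2\<close> and \<open>- 4 p\<^sup>2\<close> are second derivatives in
  \<open>r\<close> and \<open>\<omega>\<close>. The result is \<open>spectral_integral\<close>.

  The triple integral over \<open>(\<kappa>, p)\<close>, \<open>r\<close> and \<open>\<omega>\<close> does not converge absolutely, so the order of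
  integration is changed in two steps. The inner integral over \<open>\<omega>\<close>, called \<open>angular_coeff\<close> below, is
  up to a phase \<open>\<plusminus> \<pi> J_2p (2 \<bar>z\<bar> \<bar>\<zeta>\<bar>)\<close> with \<open>\<bar>\<zeta>\<bar>\<close> of size \<open>exp \<bar>r\<bar>\<close>; a van der Corput estimate
  (\<open>oscillatory_bound\<close>) shows that it is \<open>O ((1 + \<bar>p\<bar>) exp (- \<bar>r\<bar> / 2))\<close>. With the integral over \<open>\<omega>\<close>
  carried out first, \<open>(\<kappa>, p)\<close> and \<open>r\<close> may be exchanged. Then \<open>r\<close> is fixed, and \<open>(\<kappa>, p)\<close> and
  \<open>\<omega>\<close> may be exchanged because \<open>\<omega>\<close> runs over a bounded interval.

  The integral representation of the kernel is a product formula for the Macdonald function,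
  read on the boundary of its domain. In the right half plane \<open>2 K_\<mu> (X)\<close> is the integral of
  \<open>exp (- X cosh t - \<mu> t)\<close> (\<open>macdonald_int\<close>) and also \<open>\<pi> / sin (\<pi> \<mu>) (I_{-\<mu>} (X) - I_\<mu> (X))\<close>
  (\<open>macdonald_log\<close>). Both satisfy the same first-order differential-difference system with
  the same limit at \<open>0\<close>, and a Gronwall argument identifies them. Multiplying two such integrals, at
  \<open>X = exp (L + \<i> \<theta>)\<close> and \<open>exp (L - \<i> \<theta>)\<close> and at the orders \<open>\<nu> + p\<close> and \<open>\<nu> - p\<close>, and substituting
  \<open>(s, t) = (r + \<sigma>, r - \<sigma>)\<close>, leaves an integral over \<open>\<sigma>\<close> that is again a Macdonald function
  (\<open>product_formula_real\<close>):

    \<open>K_{\<nu>+p} (e\<^sup>L e\<^sup>i\<^sup>\<theta>) K_{\<nu>-p} (e\<^sup>L e\<^sup>-\<^sup>i\<^sup>\<theta>) = \<integral>r. exp (- 2 \<nu> r) exp (2 \<i> p arg \<zeta>) K_2p (2 e\<^sup>L \<bar>\<zeta>\<bar>)\<close>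

  with \<open>\<zeta> = cosh (r + \<i> \<theta>)\<close>. Both sides are holomorphic in \<open>L\<close> for \<open>\<bar>Im L\<bar> < \<pi> / 2\<close>. The left side,
  written with Bessel series, is entire in \<open>L\<close>, and the difference of its values at
  \<open>Im L = - \<pi> / 2\<close> and \<open>Im L = \<pi> / 2\<close> is a multiple of \<open>bold_J (\<i> \<kappa>) p\<close> (\<open>bold_J_product\<close>). On the right
  side the difference of the boundary values of \<open>K_2p\<close> is a multiple of \<open>J_2p\<close>
  (\<open>macdonald_int_jump\<close>), that is, of the integral over \<open>\<omega>\<close>. The passage to the boundary is
  dominated thanks to the van der Corput estimate again. This covers \<open>\<bar>arg z\<bar> < \<pi> / 2\<close>; the rest follows
  by continuity and from the invariance of both sides under \<open>z \<mapsto> - z\<close>.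
\<close>

section \<open>Parameter integrals and exponential bounds\<close>

text \<open>
  Cauchy's inequality on a disc inside \<open>S\<close> turns the bound on the integrand into a bound on its
  difference quotients, so no separate majorant for the derivative is required.
\<close>

lemma parametric_integral_has_field_derivative:
  fixes f :: "complex \<Rightarrow> 'a \<Rightarrow> complex"
  assumes S: "open S" "z \<in> S"
    and hol: "\<And>x. x \<in> space M \<Longrightarrow> (\<lambda>w. f w x) holomorphic_on S"
    and meas: "\<And>w. w \<in> S \<Longrightarrow> f w \<in> borel_measurable M"
    and g: "integrable M g"
    and le: "\<And>w x. w \<in> S \<Longrightarrow> x \<in> space M \<Longrightarrow> norm (f w x) \<le> g x"
  shows "integrable M (\<lambda>x. deriv (\<lambda>w. f w x) z)"
    and "((\<lambda>w. \<integral>x. f w x \<partial>M) has_field_derivative (\<integral>x. deriv (\<lambda>w. f w x) z \<partial>M)) (at z)"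
proof -
  obtain e where e: "e > 0" "ball z e \<subseteq> S"
    using S openE by blast
  define r where "r = e / 3"
  have r: "r > 0" using e by (simp add: r_def)
  have sub: "cball u r \<subseteq> S" if "u \<in> ball z r" for u
  proof
    fix v assume "v \<in> cball u r"
    then have "dist z v \<le> dist z u + dist u v" "dist u v \<le> r" by (auto simp: dist_triangle)
    with that e r show "v \<in> S" by (auto simp: r_def subset_iff)
  qed
  have dbound: "norm (deriv (\<lambda>w. f w x) u) \<le> g x / r" if "u \<in> ball z r" "x \<in> space M" for u x
  proof -
    have "norm ((deriv ^^ 1) (\<lambda>w. f w x) u) \<le> fact 1 * g x / r ^ 1"
    proof (rule Cauchy_inequality)
      show "(\<lambda>w. f w x) holomorphic_on ball u r"
        using hol[OF that(2)] sub[OF that(1)] holomorphic_on_subset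
        by (meson ball_subset_cball subset_trans)
      show "continuous_on (cball u r) (\<lambda>w. f w x)"
        using hol[OF that(2)] sub[OF that(1)] holomorphic_on_subset holomorphic_on_imp_continuous_on
        by blast
    next
      fix v assume "cmod (u - v) = r"
      then have "v \<in> S" using sub[OF that(1)] by (auto simp: dist_norm)
      then show "cmod (f v x) \<le> g x" using le that by blast
    qed (use r in auto)
    then show ?thesis by simp
  qed
  have quot: "norm ((f w x - f z x) / (w - z)) \<le> g x / r" if "w \<in> ball z r" "x \<in> space M" for w x
  proof (cases "w = z")
    case True
    then show ?thesis using le[OF S(2) that(2)] r norm_ge_zero[of "f z x"]
      by (auto simp del: norm_ge_zero)
  next
    case False
    have "norm (f w x - f z x) \<le> g x / r * norm (w - z)"
    proof (rule field_differentiable_bound[where S = "ball z r" and f' = "deriv (\<lambda>w. f w x)"])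
      fix v assume v: "v \<in> ball z r"
      then have "v \<in> S" using sub[OF v] r by auto
      then have "((\<lambda>w. f w x) has_field_derivative deriv (\<lambda>w. f w x) v) (at v)"
        using hol[OF that(2)] S(1) holomorphic_derivI by blast
      then show "((\<lambda>w. f w x) has_field_derivative deriv (\<lambda>w. f w x) v) (at v within ball z r)"
        using has_field_derivative_at_within by blast
      show "cmod (deriv (\<lambda>w. f w x) v) \<le> g x / r" using dbound[OF v that(2)] .
    qed (use that r in auto)
    then show ?thesis using False r by (simp add: norm_divide pos_divide_le_eq)
  qed
  have lim: "(\<lambda>i. (f (X i) x - f z x) / (X i - z)) \<longlonglongrightarrow> deriv (\<lambda>w. f w x) z"
    if "\<And>i. X i \<in> ball z r - {z}" "X \<longlonglongrightarrow> z" "x \<in> space M" for X :: "nat \<Rightarrow> complex" and x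
  proof -
    have "((\<lambda>w. f w x) has_field_derivative deriv (\<lambda>w. f w x) z) (at z)"
      using hol[OF that(3)] S holomorphic_derivI by blast
    then have "((\<lambda>w. (f w x - f z x) / (w - z)) \<longlongrightarrow> deriv (\<lambda>w. f w x) z) (at z)"
      by (simp add: has_field_derivative_iff)
    then show ?thesis
      using that unfolding tendsto_at_iff_sequentially comp_def by auto
  qed
  \<comment> \<open>any sequence tending to \<open>z\<close> exhibits the derivative as a limit of measurable functions\<close>
  define X0 where "X0 = (\<lambda>i::nat. z + of_real (r / (real i + 2)))"
  have X0: "X0 i \<in> ball z r - {z}" for i
  proof -
    have "norm (X0 i - z) = r / (real i + 2)" using r by (simp add: X0_def norm_divide norm_mult del: of_real_divide of_real_add)
    moreover have "r / (real i + 2) < r" using r by (simp add: divide_simps)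
    moreover have "r / (real i + 2) > 0" using r by simp
    ultimately show ?thesis by (auto simp: dist_norm norm_minus_commute)
  qed
  have X0_lim: "X0 \<longlonglongrightarrow> z"
  proof -
    have "(\<lambda>i::nat. r / (real i + 2)) \<longlonglongrightarrow> 0" by real_asymp
    then have "(\<lambda>i::nat. z + of_real (r / (real i + 2))) \<longlonglongrightarrow> z + of_real 0"
      by (intro tendsto_intros)
    then show ?thesis by (simp add: X0_def)
  qed
  have S': "w \<in> S" if "w \<in> ball z r" for w using sub[OF that] r by auto
  have quot_meas: "(\<lambda>x. (f w x - f z x) / (w - z)) \<in> borel_measurable M" if "w \<in> ball z r" for w
    using meas[OF S'[OF that]] meas[OF S(2)] by measurable
  have dmeas: "(\<lambda>x. deriv (\<lambda>w. f w x) z) \<in> borel_measurable M"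
    by (rule borel_measurable_LIMSEQ_metric[OF quot_meas lim[OF X0 X0_lim]]) (use X0 in auto)
  have gr: "integrable M (\<lambda>x. g x / r)" using g by simp
  show int: "integrable M (\<lambda>x. deriv (\<lambda>w. f w x) z)"
  proof (rule Bochner_Integration.integrable_bound[OF gr dmeas], rule AE_I2)
    fix x assume "x \<in> space M"
    then show "norm (deriv (\<lambda>w. f w x) z) \<le> norm (g x / r)"
      using dbound[of z x] r abs_ge_self[of "g x / r"] unfolding real_norm_def
      by (meson centre_in_ball order_trans)
  qed
  have fint: "integrable M (f w)" if "w \<in> S" for w
    by (rule Bochner_Integration.integrable_bound[OF g meas[OF that]])
      (use le[OF that] order_trans[OF _ abs_ge_self] in \<open>auto intro!: AE_I2\<close>)
  have "((\<lambda>w. ((\<integral>x. f w x \<partial>M) - (\<integral>x. f z x \<partial>M)) / (w - z)) \<longlongrightarrow> (\<integral>x. deriv (\<lambda>w. f w x) z \<partial>M)) (at z within ball z r)"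
    unfolding tendsto_at_iff_sequentially comp_def
  proof (intro allI impI)
    fix X assume X: "\<forall>i. X i \<in> ball z r - {z}" "X \<longlonglongrightarrow> z"
    have "(\<lambda>i. \<integral>x. (f (X i) x - f z x) / (X i - z) \<partial>M) \<longlonglongrightarrow> (\<integral>x. deriv (\<lambda>w. f w x) z \<partial>M)"
      by (rule integral_dominated_convergence[OF dmeas quot_meas gr])
        (use X quot lim in \<open>auto intro!: AE_I2\<close>)
    moreover have "(\<integral>x. (f (X i) x - f z x) / (X i - z) \<partial>M)
       = ((\<integral>x. f (X i) x \<partial>M) - (\<integral>x. f z x \<partial>M)) / (X i - z)" for i
      using fint[OF S'] fint[OF S(2)] X by (subst Bochner_Integration.integral_divide_zero, subst Bochner_Integration.integral_diff) auto
    ultimately show "(\<lambda>i. ((\<integral>x. f (X i) x \<partial>M) - (\<integral>x. f z x \<partial>M)) / (X i - z)) \<longlonglongrightarrow> (\<integral>x. deriv (\<lambda>w. f w x) z \<partial>M)"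
      by (simp only:)
  qed
  then show "((\<lambda>w. \<integral>x. f w x \<partial>M) has_field_derivative (\<integral>x. deriv (\<lambda>w. f w x) z \<partial>M)) (at z)"
    using r by (simp add: has_field_derivative_iff at_within_open[of z "ball z r"])
qed

lemma integrable_exp_neg_abs:
  assumes "a > 0"
  shows "integrable lborel (\<lambda>t::real. exp (- (a * \<bar>t\<bar>)))"
proof -
  have "(\<lambda>t. exp (- a * t)) absolutely_integrable_on {0..}"
    by (intro nonnegative_absolutely_integrable_1 integrable_on_exp_minus_to_infinity assms) auto
  then have "integrable lebesgue (\<lambda>t. indicator {0..} t *\<^sub>R exp (- a * t))"
    by (simp add: set_integrable_def)
  then have 1: "integrable lborel (\<lambda>t. indicator {0..} t *\<^sub>R exp (- a * t))"
    by (subst (asm) integrable_completion) auto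
  then have 2: "integrable lborel (\<lambda>t. indicator {0..} (0 + (-1) * t) *\<^sub>R exp (- a * (0 + (-1) * t)))"
    by (subst lborel_integrable_real_affine_iff) auto
  have "integrable lborel (\<lambda>t. indicator {0..} t *\<^sub>R exp (- a * t) + indicator {0..} (0 + (-1) * t) *\<^sub>R exp (- a * (0 + (-1) * t)))"
    using 1 2 by (rule Bochner_Integration.integrable_add)
  then show ?thesis
    by (rule Bochner_Integration.integrable_bound) (auto simp: indicator_def)
qed

text \<open>
  Since \<open>cosh t \<ge> t\<^sup>2 / 4\<close>, the exponent on the left is at most a concave quadratic in \<open>\<bar>t\<bar>\<close>; completing
  the square gives the constant. All integrals of Macdonald type are dominated in this way.
\<close>

lemma exp_neg_cosh_bound:
  fixes c m t :: real
  assumes "c > 0"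
  shows "exp (- (c * cosh t) + m * \<bar>t\<bar>) \<le> exp ((m + 1)\<^sup>2 / c) * exp (- \<bar>t\<bar>)"
proof -
  have "1 + \<bar>t\<bar> + \<bar>t\<bar>\<^sup>2 / 2 \<le> exp \<bar>t\<bar>" by (rule exp_lower_Taylor_quadratic) simp
  moreover have "exp \<bar>t\<bar> \<le> 2 * cosh t" by (cases "t \<ge> 0") (auto simp: cosh_def)
  ultimately have "t\<^sup>2 / 4 \<le> cosh t" by simp
  then have "c * (t\<^sup>2 / 4) \<le> c * cosh t" using assms by simp
  moreover have "0 \<le> (c * \<bar>t\<bar> / 2 - (m + 1))\<^sup>2 / c" using assms by simp
  then have "(m + 1) * \<bar>t\<bar> - c * (t\<^sup>2 / 4) \<le> (m + 1)\<^sup>2 / c"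
    using assms by (simp add: power2_diff power2_eq_square field_simps)
  ultimately have "- (c * cosh t) + m * \<bar>t\<bar> \<le> (m + 1)\<^sup>2 / c + (- \<bar>t\<bar>)"
    by (simp add: algebra_simps)
  then show ?thesis unfolding exp_add[symmetric] by simp
qed

lemma tendsto_integral_scaled_exhaustion:
  fixes f :: "real \<Rightarrow> complex"
  assumes f: "integrable lborel f" and c: "c \<ge> 1"
  shows "(\<lambda>n. LINT x:{- (c * real n)..c * real n}|lborel. f x) \<longlonglongrightarrow> integral\<^sup>L lborel f"
  unfolding set_lebesgue_integral_def
proof (rule integral_dominated_convergence[where w = "\<lambda>x. norm (f x)"])
  show "AE x in lborel. (\<lambda>n. indicator {- (c * real n)..c * real n} x *\<^sub>R f x) \<longlonglongrightarrow> f x"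
  proof (intro AE_I2 tendsto_eventually)
    fix x show "\<forall>\<^sub>F n in sequentially. indicator {- (c * real n)..c * real n} x *\<^sub>R f x = f x"
      using eventually_ge_at_top[of "nat \<lceil>\<bar>x\<bar>\<rceil>"]
    proof eventually_elim
      case (elim n)
      have "1 * real n \<le> c * real n" using c by (intro mult_right_mono) auto
      then have "\<bar>x\<bar> \<le> c * real n" using elim by linarith
      then show ?case by (auto simp: indicator_def abs_le_iff)
    qed
  qed
qed (use f in \<open>auto intro!: AE_I2 simp: indicator_def\<close>)

lemma tendsto_integral_exhaustion:
  fixes f :: "real \<Rightarrow> complex"
  assumes "integrable lborel f"
  shows "(\<lambda>n. LINT x:{- real n..real n}|lborel. f x) \<longlonglongrightarrow> integral\<^sup>L lborel f"
  using tendsto_integral_scaled_exhaustion[OF assms, of 1] by simp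

section \<open>A van der Corput estimate\<close>

text \<open>
  The phase \<open>cos t\<close> is stationary only at \<open>t = 0\<close>. On \<open>[d, a]\<close> one integration by parts against
  \<open>d (exp (- X cos t)) = X sin t exp (- X cos t) dt\<close> costs at most a multiple of \<open>1 / (\<bar>X\<bar> sin d)\<close>, while
  \<open>[0, d]\<close> contributes at most \<open>d\<close>. The bound is uniform in \<open>a\<close> and in the argument of \<open>X\<close>, up to and
  including purely imaginary \<open>X\<close>.
\<close>

lemma oscillatory_bound:
  fixes X :: complex and a n :: real
  assumes a: "0 \<le> a" "a \<le> pi / 2" and X: "Re X \<ge> 0" "X \<noteq> 0"
  shows "norm (integral {0..a} (\<lambda>t. exp (- (X * of_real (cos t))) * of_real (cos (n * t)))) \<le> 7 * (1 + \<bar>n\<bar>) / sqrt (norm X)"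
proof -
  define f where "f = (\<lambda>t::real. exp (- (X * of_real (cos t))) * of_real (cos (n * t)))"
  \<comment> \<open>this cut-off balances \<open>d\<close> against \<open>1 / (\<bar>X\<bar> d)\<close>\<close>
  define d where "d = 1 / sqrt (norm X)"
  have d0: "d > 0" using X by (simp add: d_def)
  have cont: "continuous_on A f" for A unfolding f_def by (intro continuous_intros)
  have cosn: "\<bar>cos (n * t)\<bar> \<le> 1" for t by simp
  have nexp: "norm (exp (- (X * of_real (cos t)))) \<le> 1" if "0 \<le> t" "t \<le> a" for t
  proof -
    have "cos t \<ge> 0" using that a by (intro cos_ge_zero) auto
    then show ?thesis using X by simp
  qed
  have fle: "norm (f t) \<le> 1" if "0 \<le> t" "t \<le> a" for t
    using nexp[OF that] cosn[of t] mult_mono[of "norm (exp (- (X * of_real (cos t))))" 1 "\<bar>cos (n * t)\<bar>" 1]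
    by (simp add: f_def norm_mult)
  have triv: "norm (integral {0..b} f) \<le> b" if "0 \<le> b" "b \<le> a" for b
  proof -
    have "norm (integral {0..b} f) \<le> 1 * (b - 0)"
      by (rule integral_bound) (use that cont fle in auto)
    then show ?thesis by simp
  qed
  have *: "norm (integral {0..a} f) \<le> 7 * (1 + \<bar>n\<bar>) * d"
  proof (cases "d \<le> a \<and> d \<le> 1")
    \<comment> \<open>here \<open>a \<le> 2 d\<close>, and the length of the interval is a sufficient bound\<close>
    case False
    then have "a \<le> 2 * d" using a pi_less_4 d0 by (cases "d \<le> a") auto
    then have "norm (integral {0..a} f) \<le> 2 * d" using triv[of a] a by simp
    also have "\<dots> \<le> 7 * (1 + \<bar>n\<bar>) * d" using d0 by (intro mult_right_mono) auto
    finally show ?thesis .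
  next
    case True
    have sd: "sin d \<ge> d / 2"
    proof -
      obtain \<xi> where xi: "0 < \<xi>" "\<xi> < d" "sin d - sin 0 = (d - 0) * cos \<xi>"
        using MVT2[of 0 d sin cos] d0 DERIV_sin by blast
      have "cos (pi / 3) \<le> cos \<xi>"
        using xi True pi_gt3 by (subst cos_mono_le_eq) auto
      then have "d * (1 / 2) \<le> d * cos \<xi>" using d0 by (intro mult_left_mono) (auto simp: cos_60)
      then show ?thesis using xi by simp
    qed
    \<comment> \<open>the derivative of the boundary term \<open>G\<close> of the integration by parts is \<open>f + q\<close>\<close>
    define G where "G = (\<lambda>t::real. exp (- (X * of_real (cos t))) * of_real (cos (n * t) / sin t) / X)"
    define q where "q = (\<lambda>t::real. exp (- (X * of_real (cos t))) * of_real ((- n * sin (n * t) * sin t - cos (n * t) * cos t) / (sin t)\<^sup>2) / X)"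
    have sin_pos: "sin t > 0" if "d \<le> t" "t \<le> a" for t
      using that d0 a pi_gt_zero by (intro sin_gt_zero) linarith+
    have G': "(G has_vector_derivative f t + q t) (at t within {d..a})" if "t \<in> {d..a}" for t
    proof -
      have s: "sin t \<noteq> 0" using sin_pos[of t] that by auto
      have dr: "((\<lambda>t. cos (n * t) / sin t) has_real_derivative (- n * sin (n * t) * sin t - cos (n * t) * cos t) / (sin t)\<^sup>2) (at t within {d..a})"
        using s by (auto intro!: derivative_eq_intros simp: power2_eq_square field_simps)
      have dc: "((\<lambda>t. complex_of_real (cos (n * t) / sin t)) has_vector_derivative of_real ((- n * sin (n * t) * sin t - cos (n * t) * cos t) / (sin t)\<^sup>2)) (at t within {d..a})"
        using dr has_vector_derivative_of_real by (metis has_real_derivative_iff_has_vector_derivative)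
      have de: "((\<lambda>t. exp (- (X * of_real (cos t)))) has_vector_derivative (X * of_real (sin t)) * exp (- (X * of_real (cos t)))) (at t within {d..a})"
      proof -
        have c: "((\<lambda>t. complex_of_real (cos t)) has_vector_derivative of_real (- sin t)) (at t within {d..a})"
        proof -
          have "(cos has_real_derivative - sin t) (at t within {d..a})" by (auto intro!: derivative_eq_intros)
          then show ?thesis using has_vector_derivative_of_real by (metis has_real_derivative_iff_has_vector_derivative)
        qed
        have e: "((\<lambda>z. exp (- (X * z))) has_field_derivative - X * exp (- (X * complex_of_real (cos t)))) (at (complex_of_real (cos t)))"
          by (auto intro!: derivative_eq_intros)
        show ?thesis
          using field_vector_diff_chain_within[OF c has_field_derivative_at_within[OF e]] by (simp add: o_def mult_ac)
      qed
      have "(G has_vector_derivative (exp (- (X * of_real (cos t))) * of_real ((- n * sin (n * t) * sin t - cos (n * t) * cos t) / (sin t)\<^sup>2) + (X * of_real (sin t)) * exp (- (X * of_real (cos t))) * of_real (cos (n * t) / sin t)) / X) (at t within {d..a})"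
        unfolding G_def by (intro has_vector_derivative_divide has_vector_derivative_mult dc de)
      also have "(exp (- (X * of_real (cos t))) * of_real ((- n * sin (n * t) * sin t - cos (n * t) * cos t) / (sin t)\<^sup>2) + (X * of_real (sin t)) * exp (- (X * of_real (cos t))) * of_real (cos (n * t) / sin t)) / X = f t + q t"
        using X s unfolding f_def q_def by (simp add: add_divide_distrib)
      finally show ?thesis .
    qed
    have qcont: "continuous_on {d..a} q"
      unfolding q_def using sin_pos X by (intro continuous_intros) force+
    have fi: "f integrable_on {d..a}" and qi: "q integrable_on {d..a}"
      using cont qcont by (auto intro: integrable_continuous_real)
    have "((\<lambda>t. f t + q t) has_integral (G a - G d)) {d..a}"
      by (rule fundamental_theorem_of_calculus) (use True G' in auto)
    then have "integral {d..a} f + integral {d..a} q = G a - G d"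
      using fi qi Henstock_Kurzweil_Integration.integral_add by (metis integral_unique)
    then have eq: "integral {d..a} f = G a - G d - integral {d..a} q" by (simp add: algebra_simps)
    have sd0: "sin d > 0" using sin_pos[of d] True by auto
    have sda: "sin d \<le> sin a" using True a d0 by (intro sin_monotone_2pi_le) auto
    have Gb: "norm (G t) \<le> 1 / (norm X * sin d)" if "t \<in> {d..a}" for t
    proof -
      have st: "sin d \<le> sin t" using that a d0 by (intro sin_monotone_2pi_le) auto
      have "norm (G t) = norm (exp (- (X * of_real (cos t)))) * \<bar>cos (n * t)\<bar> / (sin t * norm X)"
        unfolding G_def norm_mult norm_divide using sin_pos[of t] that by (simp add: norm_divide del: norm_exp_eq_Re)
      also have "\<dots> \<le> 1 * 1 / (sin d * norm X)"
        using nexp[of t] that d0 st sd0 X by (intro frac_le mult_mono mult_pos_pos) (auto simp del: norm_exp_eq_Re)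
      finally show ?thesis by (simp add: mult.commute)
    qed
    have qb: "norm (q t) \<le> (1 + \<bar>n\<bar>) / norm X * (inverse ((sin t)\<^sup>2))" if "t \<in> {d..a}" for t
    proof -
      have "\<bar>- n * sin (n * t) * sin t - cos (n * t) * cos t\<bar> \<le> \<bar>n * sin (n * t) * sin t\<bar> + \<bar>cos (n * t) * cos t\<bar>"
        by linarith
      also have "\<bar>n * sin (n * t) * sin t\<bar> \<le> \<bar>n\<bar> * 1 * 1"
        unfolding abs_mult by (intro mult_mono) auto
      also have "\<bar>cos (n * t) * cos t\<bar> \<le> 1 * 1"
        unfolding abs_mult by (intro mult_mono) auto
      finally have num: "\<bar>- n * sin (n * t) * sin t - cos (n * t) * cos t\<bar> \<le> 1 + \<bar>n\<bar>" by simp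
      have "norm (q t) = norm (exp (- (X * of_real (cos t)))) * (\<bar>- n * sin (n * t) * sin t - cos (n * t) * cos t\<bar> / (sin t)\<^sup>2) / norm X"
        unfolding q_def norm_mult norm_divide norm_of_real abs_divide by simp
      also have "\<dots> \<le> 1 * ((1 + \<bar>n\<bar>) / (sin t)\<^sup>2) / norm X"
        using nexp[of t] that d0 num by (intro divide_right_mono mult_mono) (auto simp del: norm_exp_eq_Re)
      finally show ?thesis by (simp add: field_simps)
    qed
    have cot': "((\<lambda>t. - cot t) has_vector_derivative inverse ((sin t)\<^sup>2)) (at t within {d..a})" if "t \<in> {d..a}" for t
    proof -
      have "((\<lambda>t. - cot t) has_real_derivative - (- inverse ((sin t)\<^sup>2))) (at t within {d..a})"
        using sin_pos[of t] that by (intro DERIV_minus has_field_derivative_at_within[OF DERIV_cot]) auto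
      then show ?thesis by (simp add: has_real_derivative_iff_has_vector_derivative)
    qed
    have coti: "((\<lambda>t. inverse ((sin t)\<^sup>2)) has_integral (- cot a - - cot d)) {d..a}"
      by (rule fundamental_theorem_of_calculus) (use True cot' in auto)
    have "norm (integral {d..a} q) \<le> integral {d..a} (\<lambda>t. (1 + \<bar>n\<bar>) / norm X * (inverse ((sin t)\<^sup>2)))"
      by (rule Henstock_Kurzweil_Integration.integral_norm_bound_integral[OF qi has_integral_integrable[OF has_integral_mult_right[OF coti]] qb])
    also have "\<dots> = (1 + \<bar>n\<bar>) / norm X * (cot d - cot a)"
      using integral_unique[OF coti] by simp
    also have "\<dots> \<le> (1 + \<bar>n\<bar>) / norm X * (1 / sin d)"
    proof (rule mult_left_mono)
      have "cot a \<ge> 0" using sin_pos[of a] True a cos_ge_zero[of a] by (auto simp: cot_def)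
      moreover have "cot d \<le> 1 / sin d" using sd0 by (auto simp: cot_def divide_simps)
      ultimately show "cot d - cot a \<le> 1 / sin d" by simp
    qed auto
    finally have qint: "norm (integral {d..a} q) \<le> (1 + \<bar>n\<bar>) / (norm X * sin d)" by simp
    have "norm (integral {d..a} f) \<le> norm (G a) + norm (G d) + norm (integral {d..a} q)"
      unfolding eq by (meson add_mono norm_triangle_ineq4 order_refl order_trans)
    also have "\<dots> \<le> 1 / (norm X * sin d) + 1 / (norm X * sin d) + (1 + \<bar>n\<bar>) / (norm X * sin d)"
      using Gb[of a] Gb[of d] qint True by (intro add_mono) auto
    also have "\<dots> = (3 + \<bar>n\<bar>) / (norm X * sin d)" by (simp add: add_divide_distrib)
    also have "\<dots> \<le> (3 + \<bar>n\<bar>) / (norm X * (d / 2))"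
      using sd X d0 sd0 by (intro divide_left_mono mult_left_mono mult_pos_pos) auto
    also have "norm X * (d / 2) = 1 / (2 * d)"
    proof -
      have "norm X = 1 / (d * d)" using X by (simp add: d_def)
      then show ?thesis using d0 by simp
    qed
    finally have "norm (integral {d..a} f) \<le> 2 * (3 + \<bar>n\<bar>) * d" by (simp add: algebra_simps)
    moreover have "integral {0..a} f = integral {0..d} f + integral {d..a} f"
      using True d0 cont by (intro Henstock_Kurzweil_Integration.integral_combine[symmetric] integrable_continuous_real) auto
    moreover have "norm (integral {0..d} f) \<le> d" using triv[of d] True d0 by simp
    ultimately have "norm (integral {0..a} f) \<le> d + 2 * (3 + \<bar>n\<bar>) * d"
      by (smt (verit) norm_triangle_ineq)
    also have "\<dots> \<le> 7 * (1 + \<bar>n\<bar>) * d" using d0 by (simp add: algebra_simps)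
    finally show ?thesis .
  qed
  then show ?thesis by (simp add: f_def d_def)
qed

section \<open>The Macdonald function as a Laplace-type integral\<close>

lemma integral_derivative_eq_0:
  fixes f f' :: "real \<Rightarrow> complex"
  assumes d: "\<And>x. (f has_vector_derivative f' x) (at x)" and c: "continuous_on UNIV f'"
    and i: "integrable lborel f'" and le: "\<And>x. norm (f x) \<le> C * exp (- \<bar>x\<bar>)"
  shows "integral\<^sup>L lborel f' = 0"
proof -
  have "(\<lambda>n. LINT x:{- real n..real n}|lborel. f' x) = (\<lambda>n. f (real n) - f (- real n))"
    unfolding set_lebesgue_integral_def
    by (intro ext integral_FTC_Icc has_vector_derivative_at_within[OF d] continuous_on_subset[OF c]) auto
  moreover have "(\<lambda>n. f (real n) - f (- real n)) \<longlonglongrightarrow> 0"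
  proof (rule tendsto_norm_zero_cancel, rule tendsto_sandwich[OF _ _ tendsto_const])
    have "norm (f (real n) - f (- real n)) \<le> 2 * C * exp (- real n)" for n
      using norm_triangle_ineq4[of "f (real n)" "f (- real n)"] le[of "real n"] le[of "- real n"] by simp
    then show "\<forall>\<^sub>F n in sequentially. norm (f (real n) - f (- real n)) \<le> 2 * C * exp (- real n)" by simp
    show "(\<lambda>n. 2 * C * exp (- real n)) \<longlonglongrightarrow> 0" by real_asymp
  qed auto
  ultimately show ?thesis
    using tendsto_integral_exhaustion[OF i] LIMSEQ_unique by metis
qed

definition laplace_kernel :: "complex \<Rightarrow> complex \<Rightarrow> real \<Rightarrow> complex" where
  "laplace_kernel s y t = exp (- exp (of_real t) - y * exp (- of_real t) + s * of_real t)"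

text \<open>
  This is \<open>2 y\<^sup>s\<^sup>/\<^sup>2 K_s (2 \<surd>y)\<close>. The normalization makes the derivative in \<open>y\<close> and the recurrence in \<open>s\<close>
  free of fractional powers.
\<close>

definition laplace_int :: "complex \<Rightarrow> complex \<Rightarrow> complex" where
  "laplace_int s y = (\<integral>t. laplace_kernel s y t \<partial>lborel)"

lemma laplace_kernel_bound:
  assumes "0 < c" "c \<le> 1" "c \<le> Re y"
  shows "norm (laplace_kernel s y t) \<le> exp ((\<bar>Re s\<bar> + 1)\<^sup>2 / (2 * c)) * exp (- \<bar>t\<bar>)"
proof -
  have "norm (laplace_kernel s y t) = exp (- exp t - Re y * exp (- t) + Re s * t)"
    by (simp add: laplace_kernel_def exp_of_real flip: of_real_minus)
  also have "\<dots> \<le> exp (- (2 * c * cosh t) + \<bar>Re s\<bar> * \<bar>t\<bar>)"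
  proof -
    have "c * exp t \<le> 1 * exp t" "c * exp (-t) \<le> Re y * exp (- t)"
      using assms by (intro mult_right_mono; simp)+
    moreover have "2 * c * cosh t = c * exp t + c * exp (- t)" by (simp add: cosh_def algebra_simps)
    ultimately have "- exp t - Re y * exp (- t) \<le> - (2 * c * cosh t)" by linarith
    moreover have "Re s * t \<le> \<bar>Re s\<bar> * \<bar>t\<bar>" using abs_ge_self[of "Re s * t"] by (simp add: abs_mult)
    ultimately show ?thesis
      by (intro exp_le_cancel_iff[THEN iffD2] add_mono) simp_all
  qed
  also have "\<dots> \<le> exp ((\<bar>Re s\<bar> + 1)\<^sup>2 / (2 * c)) * exp (- \<bar>t\<bar>)"
    using assms by (intro exp_neg_cosh_bound) auto
  finally show ?thesis .
qed

lemma laplace_kernel_shift: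
  "laplace_kernel (s + 1) y t = exp (of_real t) * laplace_kernel s y t"
  "laplace_kernel (s - 1) y t = exp (- of_real t) * laplace_kernel s y t"
proof -
  have *: "exp (of_real t) * exp w = exp (of_real t + w)" "exp (- of_real t) * exp w = exp (- of_real t + w)" for w :: complex
    by (rule exp_add[symmetric])+
  have eq: "- a - b + (s + 1) * r = r + (- a - b + s * r)" "- a - b + (s - 1) * r = - r + (- a - b + s * r)" for a b r :: complex
    by (simp_all add: algebra_simps)
  show "laplace_kernel (s + 1) y t = exp (of_real t) * laplace_kernel s y t"
    unfolding laplace_kernel_def * by (rule arg_cong[where f = exp]) (rule eq(1))
  show "laplace_kernel (s - 1) y t = exp (- of_real t) * laplace_kernel s y t"
    unfolding laplace_kernel_def * by (rule arg_cong[where f = exp]) (rule eq(2))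
qed

lemma laplace_kernel_continuous: "continuous_on A (laplace_kernel s y)"
  unfolding laplace_kernel_def by (intro continuous_intros)

lemma laplace_kernel_measurable [measurable]: "laplace_kernel s y \<in> borel_measurable borel"
  by (rule borel_measurable_continuous_onI) (rule laplace_kernel_continuous)

lemma laplace_kernel_decay:
  assumes "Re y > 0"
  obtains C where "\<And>t. norm (laplace_kernel s y t) \<le> C * exp (- \<bar>t\<bar>)"
proof -
  have "norm (laplace_kernel s y t) \<le> exp ((\<bar>Re s\<bar> + 1)\<^sup>2 / (2 * min 1 (Re y))) * exp (- \<bar>t\<bar>)" for t
    by (rule laplace_kernel_bound) (use assms in auto)
  then show ?thesis by (rule that)
qed

lemma integrable_of_exp_bound:
  fixes f :: "real \<Rightarrow> complex"
  assumes "f \<in> borel_measurable borel" "\<And>t. norm (f t) \<le> C * exp (- \<bar>t\<bar>)"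
  shows "integrable lborel f"
proof (rule Bochner_Integration.integrable_bound)
  show "integrable lborel (\<lambda>t::real. C * exp (- (1 * \<bar>t\<bar>)))"
    by (intro integrable_mult_right integrable_exp_neg_abs) auto
  show "AE t in lborel. norm (f t) \<le> norm (C * exp (- (1 * \<bar>t\<bar>)))"
    using order_trans[OF assms(2) abs_ge_self] by simp
qed (use assms(1) in simp)

lemma laplace_kernel_integrable:
  assumes "Re y > 0"
  shows "integrable lborel (laplace_kernel s y)"
proof -
  obtain C where "\<And>t. norm (laplace_kernel s y t) \<le> C * exp (- \<bar>t\<bar>)"
    using laplace_kernel_decay[OF assms] by blast
  then show ?thesis by (rule integrable_of_exp_bound[OF laplace_kernel_measurable])
qed

lemma laplace_int_deriv:
  assumes "Re y > 0"
  shows "(laplace_int s has_field_derivative - laplace_int (s - 1) y) (at y)"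
proof -
  define c where "c = min 1 (Re y / 2)"
  have c: "0 < c" "c \<le> 1" "c < Re y" using assms by (auto simp: c_def min_def)
  define S where "S = {w. c < Re w}"
  have S: "open S" "y \<in> S" using c by (auto simp: S_def open_halfspace_Re_gt)
  have hol: "(\<lambda>w. laplace_kernel s w t) holomorphic_on S" for t
    unfolding laplace_kernel_def by (intro holomorphic_intros)
  have dv: "deriv (\<lambda>w. laplace_kernel s w t) y = - laplace_kernel (s - 1) y t" for t
  proof (rule DERIV_imp_deriv)
    have "((\<lambda>w. laplace_kernel s w t) has_field_derivative - exp (- of_real t) * laplace_kernel s y t) (at y)"
      unfolding laplace_kernel_def by (auto intro!: derivative_eq_intros)
    also have "- exp (- of_real t) * laplace_kernel s y t = - laplace_kernel (s - 1) y t"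
      by (simp only: laplace_kernel_shift mult_minus_left)
    finally show "((\<lambda>w. laplace_kernel s w t) has_field_derivative - laplace_kernel (s - 1) y t) (at y)" .
  qed
  have "((\<lambda>w. \<integral>t. laplace_kernel s w t \<partial>lborel) has_field_derivative (\<integral>t. deriv (\<lambda>w. laplace_kernel s w t) y \<partial>lborel)) (at y)"
  proof (rule parametric_integral_has_field_derivative(2)[OF S])
    show "integrable lborel (\<lambda>t::real. exp ((\<bar>Re s\<bar> + 1)\<^sup>2 / (2 * c)) * exp (- (1 * \<bar>t\<bar>)))"
      by (intro integrable_mult_right integrable_exp_neg_abs) auto
  qed (use hol c laplace_kernel_bound[of c _ s] in \<open>auto simp: S_def\<close>)
  then show ?thesis by (simp add: dv laplace_int_def[abs_def])
qed

text \<open>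
  The integral over the line of the \<open>t\<close>-derivative of the kernel vanishes.
\<close>

lemma laplace_int_recurrence:
  assumes "Re y > 0"
  shows "s * laplace_int s y = laplace_int (s + 1) y - y * laplace_int (s - 1) y"
proof -
  have i: "integrable lborel (laplace_kernel s' y)" for s'
    by (rule laplace_kernel_integrable[OF assms])
  let ?f' = "\<lambda>t. - laplace_kernel (s + 1) y t + y * laplace_kernel (s - 1) y t + s * laplace_kernel s y t"
  obtain C where C: "\<And>t. norm (laplace_kernel s y t) \<le> C * exp (- \<bar>t\<bar>)"
    using laplace_kernel_decay[OF assms] by blast
  have "integral\<^sup>L lborel ?f' = 0"
  proof (rule integral_derivative_eq_0[OF _ _ _ C])
    fix t :: real
    have "((\<lambda>t. laplace_kernel s y t) has_vector_derivative
       (- exp (of_real t) + y * exp (- of_real t) + s) * laplace_kernel s y t) (at t)"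
    proof -
      have "((\<lambda>w. exp (- exp w - y * exp (- w) + s * w)) has_field_derivative
       (- exp (of_real t) + y * exp (- of_real t) + s) * laplace_kernel s y t) (at (of_real t))"
        unfolding laplace_kernel_def by (auto intro!: derivative_eq_intros simp: algebra_simps)
      then show ?thesis
        unfolding laplace_kernel_def by (rule has_vector_derivative_real_field)
    qed
    also have "(- exp (of_real t) + y * exp (- of_real t) + s) * laplace_kernel s y t = ?f' t"
      unfolding laplace_kernel_shift by (simp add: algebra_simps)
    finally show "(laplace_kernel s y has_vector_derivative ?f' t) (at t)" .
  qed (use i laplace_kernel_continuous in \<open>auto intro!: continuous_intros\<close>)
  moreover have "integral\<^sup>L lborel ?f' = - laplace_int (s + 1) y + y * laplace_int (s - 1) y + s * laplace_int s y"
    using i by (simp add: laplace_int_def)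
  ultimately show ?thesis by (simp add: algebra_simps add_eq_0_iff2)
qed

text \<open>
  The substitution \<open>t \<mapsto> ln y - t\<close> exchanges \<open>exp t\<close> and \<open>y exp (- t)\<close>.
\<close>

lemma laplace_int_inversion:
  assumes "y > 0"
  shows "laplace_int s (of_real y) = of_real y powr s * laplace_int (- s) (of_real y)"
proof -
  have "laplace_int s (of_real y) = (\<integral>t. laplace_kernel s (of_real y) (ln y + (-1) * t) \<partial>lborel)"
    unfolding laplace_int_def by (subst lborel_integral_real_affine[where c = "-1" and t = "ln y"]) auto
  also have "\<dots> = (\<integral>t. of_real y powr s * laplace_kernel (- s) (of_real y) t \<partial>lborel)"
  proof (rule Bochner_Integration.integral_cong)
    fix t :: real
    have "exp (complex_of_real (ln y)) = of_real y" using assms by (simp add: exp_of_real)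
    then have y: "of_real y = exp (complex_of_real (ln y))" by simp
    have "exp (of_real (ln y + (-1) * t)) = of_real y * exp (- complex_of_real t)"
      "of_real y * exp (- complex_of_real (ln y + (-1) * t)) = exp (complex_of_real t)"
      unfolding y exp_add[symmetric] by simp_all
    moreover have "of_real y powr s = exp (s * of_real (ln y))"
      using assms by (simp add: powr_def Ln_of_real)
    ultimately show "laplace_kernel s (of_real y) (ln y + (-1) * t) = of_real y powr s * laplace_kernel (- s) (of_real y) t"
      unfolding laplace_kernel_def by (simp only: exp_add[symmetric]) (simp add: algebra_simps)
  qed auto
  also have "\<dots> = of_real y powr s * laplace_int (- s) (of_real y)" by (simp add: laplace_int_def)
  finally show ?thesis .
qed

text \<open>
  In contrast to \<open>laplace_kernel_bound\<close> this is uniform for \<open>y\<close> near \<open>0\<close>: the decay as \<open>t \<rightarrow> - \<infinity>\<close> now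
  comes from \<open>exp (s t)\<close> alone, which is why \<open>Re s > 0\<close> is required.
\<close>

lemma laplace_kernel_0_bound:
  assumes "Re s > 0" "Re y \<ge> 0"
  shows "norm (laplace_kernel s y t) \<le> exp ((Re s + 1)\<^sup>2) * exp (- (min 1 (Re s) * \<bar>t\<bar>))"
proof -
  have "norm (laplace_kernel s y t) = exp (- exp t - Re y * exp (- t) + Re s * t)"
    by (simp add: laplace_kernel_def exp_of_real flip: of_real_minus)
  also have "\<dots> \<le> exp (- exp t + Re s * t)" using assms by simp
  also have "\<dots> \<le> exp ((Re s + 1)\<^sup>2 - min 1 (Re s) * \<bar>t\<bar>)"
  proof (cases "t \<ge> 0")
    case True
    have 1: "1 + t + t\<^sup>2 / 2 \<le> exp t" by (rule exp_lower_Taylor_quadratic) (rule True)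
    have 2: "a * t \<le> a\<^sup>2 + t\<^sup>2 / 2" for a :: real
    proof -
      have "a * t \<le> a\<^sup>2 + t\<^sup>2 / 4"
        using zero_le_power2[of "t / 2 - a"] by (simp add: power2_diff power_divide mult.commute)
      also have "\<dots> \<le> a\<^sup>2 + t\<^sup>2 / 2" by simp
      finally show ?thesis .
    qed
    from 2[of "Re s + 1"] have "(Re s + 1) * t \<le> (Re s + 1)\<^sup>2 + t\<^sup>2 / 2" .
    moreover have "min 1 (Re s) * t \<le> 1 * t" using True by (intro mult_right_mono) auto
    moreover have "(Re s + 1) * t = Re s * t + t" by (simp add: distrib_right)
    moreover have "\<bar>t\<bar> = t" using True by simp
    ultimately show ?thesis using 1 True unfolding exp_le_cancel_iff by simp
  next
    case False
    have "min 1 (Re s) * \<bar>t\<bar> \<le> Re s * \<bar>t\<bar>" by (intro mult_right_mono) auto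
    moreover have "Re s * \<bar>t\<bar> = - (Re s * t)" using False by simp
    moreover have "0 \<le> exp t" "0 \<le> (Re s + 1)\<^sup>2" by auto
    ultimately show ?thesis unfolding exp_le_cancel_iff by linarith
  qed
  finally show ?thesis unfolding exp_add[symmetric] by simp
qed

text \<open>
  With \<open>u = exp t\<close> this is Euler's integral.
\<close>

lemma laplace_int_0:
  assumes "Re s > 0"
  shows "laplace_int s 0 = Gamma s"
proof -
  let ?f = "\<lambda>u. complex_of_real u powr (s - 1) / of_real (exp u)"
  have ai: "?f absolutely_integrable_on {0<..}" by (rule absolutely_integrable_Gamma_integral'[OF assms])
  have meas: "(\<lambda>u. indicator {0<..} u *\<^sub>R ?f u) \<in> borel_measurable borel"
    by measurable
  have si: "set_integrable lborel {0<..} ?f"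
    using ai meas unfolding set_integrable_def by (subst (asm) integrable_completion) auto
  have eq: "exp t *\<^sub>R ?f (exp t) = laplace_kernel s 0 t" for t
  proof -
    have "exp t *\<^sub>R ?f (exp t) = exp (of_real t) * exp ((s - 1) * of_real t) * exp (- exp (of_real t))"
      by (simp add: scaleR_conv_of_real powr_def Ln_of_real exp_minus divide_simps flip: exp_of_real)
    also have "\<dots> = laplace_kernel s 0 t"
      unfolding laplace_kernel_def by (simp flip: exp_add) (simp add: algebra_simps)
    finally show ?thesis .
  qed
  have int: "integrable lborel (laplace_kernel s 0)"
  proof (rule Bochner_Integration.integrable_bound)
    show "integrable lborel (\<lambda>t. exp ((Re s + 1)\<^sup>2) * exp (- (min 1 (Re s) * \<bar>t\<bar>)))"
      using assms by (intro integrable_mult_right integrable_exp_neg_abs) auto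
  qed (use laplace_kernel_0_bound[OF assms, of 0] in auto)
  have "interval_lebesgue_integral lborel 0 \<infinity> ?f = (LBINT t=-\<infinity>..\<infinity>. exp t *\<^sub>R ?f (exp t))"
  proof (rule interval_integral_substitution_integrable)
    fix t :: real
    have "isCont ?f u" if "u > 0" for u
    proof -
      have "continuous_on {0<..} ?f" by (intro continuous_intros) auto
      then show ?thesis using that continuous_on_eq_continuous_at[OF open_greaterThan] by blast
    qed
    then show "isCont ?f (exp t)" by simp
  next
    have "((\<lambda>x. ereal (exp x)) \<longlongrightarrow> ereal 0) at_bot" by (intro tendsto_ereal exp_at_bot)
    then show "((ereal \<circ> exp \<circ> real_of_ereal) \<longlongrightarrow> 0) (at_right (- \<infinity>))"
      unfolding at_right_MInf filterlim_filtermap comp_def zero_ereal_def by (simp only: real_of_ereal.simps)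
    show "((ereal \<circ> exp \<circ> real_of_ereal) \<longlongrightarrow> \<infinity>) (at_left \<infinity>)"
      by (auto simp: ereal_tendsto_simps exp_at_top)
    show "set_integrable lborel (einterval (- \<infinity>) \<infinity>) (\<lambda>t. exp t *\<^sub>R ?f (exp t))"
      unfolding eq using int by (simp add: set_integrable_def)
    show "set_integrable lborel (einterval 0 \<infinity>) ?f"
      using si by (simp add: zero_ereal_def einterval_eq)
  qed (auto intro!: derivative_eq_intros)
  also have "\<dots> = laplace_int s 0"
    unfolding eq laplace_int_def by (simp add: interval_lebesgue_integral_def set_lebesgue_integral_def)
  also have "interval_lebesgue_integral lborel 0 \<infinity> ?f = (LINT u:{0<..}|lborel. ?f u)"
    by (simp add: interval_lebesgue_integral_def zero_ereal_def einterval_eq)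
  also have "\<dots> = integral {0<..} ?f"
    by (rule set_borel_integral_eq_integral(2)[OF si])
  also have "\<dots> = Gamma s" using Gamma_integral_complex'[OF assms] by (rule integral_unique)
  finally show ?thesis by simp
qed

lemma laplace_int_tendsto_0:
  assumes "Re s > 0"
  shows "((\<lambda>y. laplace_int s (of_real y)) \<longlongrightarrow> Gamma s) (at_right 0)"
  unfolding laplace_int_0[OF assms, symmetric] tendsto_at_iff_sequentially comp_def
proof (intro allI impI)
  fix X :: "nat \<Rightarrow> real" assume X: "\<forall>i. X i \<in> {0<..} - {0}" "X \<longlonglongrightarrow> 0"
  show "(\<lambda>i. laplace_int s (of_real (X i))) \<longlonglongrightarrow> laplace_int s 0"
    unfolding laplace_int_def
  proof (rule integral_dominated_convergence)
    show "integrable lborel (\<lambda>t. exp ((Re s + 1)\<^sup>2) * exp (- (min 1 (Re s) * \<bar>t\<bar>)))"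
      using assms by (intro integrable_mult_right integrable_exp_neg_abs) auto
    have "(\<lambda>i. laplace_kernel s (of_real (X i)) t) \<longlonglongrightarrow> laplace_kernel s (of_real 0) t" for t
      unfolding laplace_kernel_def by (intro tendsto_intros X)
    then show "AE t in lborel. (\<lambda>i. laplace_kernel s (of_real (X i)) t) \<longlonglongrightarrow> laplace_kernel s 0 t" by simp
  qed (use X laplace_kernel_0_bound[OF assms] in \<open>auto intro!: AE_I2 simp: less_imp_le\<close>)
qed

section \<open>The Macdonald function as a combination of power series\<close>

text \<open>
  This is \<open>y\<^sup>-\<^sup>\<mu>\<^sup>/\<^sup>2 I_\<mu> (2 \<surd>y)\<close>, and \<open>(- y)\<^sup>-\<^sup>\<mu>\<^sup>/\<^sup>2 J_\<mu> (2 \<surd>(- y))\<close>: an entire function of \<open>y\<close> which covers both kinds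
  of Bessel functions.
\<close>

definition bessel_ser :: "complex \<Rightarrow> complex \<Rightarrow> complex" where
  "bessel_ser \<mu> y = (\<Sum>n. rGamma (\<mu> + of_nat n + 1) / fact n * y ^ n)"

lemma bessel_ser_term:
  "exp (\<mu> * (l - of_real (ln 2))) * (rGamma (\<mu> + of_nat n + 1) / fact n * (- exp (2 * (l - of_real (ln 2)))) ^ n) =
   (-1) ^ n * exp ((\<mu> + 2 * of_nat n) * (l - of_real (ln 2))) / fact n * rGamma (\<mu> + of_nat n + 1)"
proof -
  have "exp ((\<mu> + 2 * of_nat n) * (l - of_real (ln 2))) = exp (\<mu> * (l - of_real (ln 2))) * exp (2 * (l - of_real (ln 2))) ^ n"
    by (simp only: exp_of_nat_mult[symmetric] exp_add[symmetric]) (simp add: algebra_simps)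
  then show ?thesis by (simp add: power_minus[of "exp _"] mult_ac)
qed

lemma bessel_ser_summable:
  fixes \<mu> y :: complex
  shows "summable (\<lambda>n. rGamma (\<mu> + of_nat n + 1) / fact n * y ^ n)"
proof (cases "y = 0")
  case True
  show ?thesis unfolding True by (rule sums_summable[OF powser_sums_zero])
next
  case False
  define l where "l = Ln (- y) / 2 + of_real (ln 2)"
  have y: "- exp (2 * (l - of_real (ln 2))) = y" using False by (simp add: l_def)
  have "summable (\<lambda>n. exp (\<mu> * (l - of_real (ln 2))) * (rGamma (\<mu> + of_nat n + 1) / fact n * y ^ n))"
    using bessel_J_log_summable[of \<mu> l] unfolding bessel_ser_term[symmetric] y .
  then show ?thesis by (simp only: summable_cmult_iff exp_not_eq_zero simp_thms)
qed

lemma bessel_J_log_eq_ser: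
  "bessel_J_log \<mu> l = exp (\<mu> * (l - of_real (ln 2))) * bessel_ser \<mu> (- exp (2 * (l - of_real (ln 2))))"
  unfolding bessel_J_log_def bessel_ser_def bessel_ser_term[symmetric]
  by (rule suminf_mult) (rule bessel_ser_summable)

lemma bessel_ser_deriv: "(bessel_ser \<mu> has_field_derivative bessel_ser (\<mu> + 1) y) (at y)"
proof -
  have "(\<Sum>n. diffs (\<lambda>n. rGamma (\<mu> + of_nat n + 1) / fact n) n * y ^ n) = bessel_ser (\<mu> + 1) y"
    unfolding bessel_ser_def diffs_def
  proof (rule suminf_cong)
    fix n :: nat
    have e: "\<mu> + of_nat (Suc n) + 1 = \<mu> + 1 + of_nat n + 1" by simp
    have "(of_nat (Suc n) :: complex) \<noteq> 0" by (rule of_nat_neq_0)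
    then show "of_nat (Suc n) * (rGamma (\<mu> + of_nat (Suc n) + 1) / fact (Suc n)) * y ^ n = rGamma (\<mu> + 1 + of_nat n + 1) / fact n * y ^ n"
      unfolding e by (simp add: fact_Suc del: of_nat_Suc)
  qed
  then show ?thesis
    using termdiffs_strong_converges_everywhere[OF bessel_ser_summable[of \<mu>], of y]
    by (simp add: bessel_ser_def[abs_def])
qed

lemma bessel_ser_holomorphic: "bessel_ser \<mu> holomorphic_on A"
  unfolding holomorphic_on_def field_differentiable_def
  using bessel_ser_deriv has_field_derivative_at_within by blast

lemma bessel_ser_recurrence: "bessel_ser (\<mu> - 1) y = \<mu> * bessel_ser \<mu> y + y * bessel_ser (\<mu> + 1) y"
proof -
  let ?c = "\<lambda>n. rGamma (\<mu> + of_nat n + 1) / fact n"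
  have s0: "(\<lambda>n. ?c n * y ^ n) sums bessel_ser \<mu> y"
    unfolding bessel_ser_def by (rule summable_sums[OF bessel_ser_summable])
  have s1: "(\<lambda>n. rGamma (\<mu> + 1 + of_nat n + 1) / fact n * y ^ n) sums bessel_ser (\<mu> + 1) y"
    unfolding bessel_ser_def by (rule summable_sums[OF bessel_ser_summable])
  have "(\<lambda>n. of_nat (Suc n) * ?c (Suc n) * y ^ Suc n) sums (y * bessel_ser (\<mu> + 1) y)"
  proof -
    have "of_nat (Suc n) * ?c (Suc n) * y ^ Suc n = y * (rGamma (\<mu> + 1 + of_nat n + 1) / fact n * y ^ n)" for n
    proof -
      have e: "\<mu> + of_nat (Suc n) + 1 = \<mu> + 1 + of_nat n + 1" by simp
      have "(of_nat (Suc n) :: complex) \<noteq> 0" by (rule of_nat_neq_0)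
      then show ?thesis unfolding e by (simp add: fact_Suc del: of_nat_Suc)
    qed
    then show ?thesis using sums_mult[OF s1, of y] by presburger
  qed
  then have "(\<lambda>n. of_nat n * ?c n * y ^ n) sums (y * bessel_ser (\<mu> + 1) y)"
    by (subst (asm) sums_Suc_iff) simp
  then have "(\<lambda>n. \<mu> * (?c n * y ^ n) + of_nat n * ?c n * y ^ n) sums (\<mu> * bessel_ser \<mu> y + y * bessel_ser (\<mu> + 1) y)"
    by (intro sums_add sums_mult s0)
  moreover have "\<mu> * (?c n * y ^ n) + of_nat n * ?c n * y ^ n = rGamma (\<mu> - 1 + of_nat n + 1) / fact n * y ^ n" for n
  proof -
    have "rGamma (\<mu> - 1 + of_nat n + 1) = (\<mu> + of_nat n) * rGamma (\<mu> + of_nat n + 1)"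
      using rGamma_plus1[of "\<mu> + of_nat n"] by (simp add: add_ac)
    then show ?thesis by (simp add: field_simps)
  qed
  ultimately show ?thesis unfolding bessel_ser_def[of "\<mu> - 1"] by (simp add: sums_iff)
qed

text \<open>
  The classical definition of \<open>K_s\<close> through \<open>I_{-s}\<close> and \<open>I_s\<close>, in the normalization of \<open>laplace_int\<close>.
\<close>

definition macdonald_ser :: "complex \<Rightarrow> complex \<Rightarrow> complex" where
  "macdonald_ser s y = of_real pi / sin (of_real pi * s) * (bessel_ser (- s) y - y powr s * bessel_ser s y)"

lemma sin_pi_shift:
  "sin (of_real pi * (s + 1)) = - sin (of_real pi * s :: complex)"
  "sin (of_real pi * (s - 1)) = - sin (of_real pi * s :: complex)"
  by (simp_all add: ring_distribs sin_add sin_diff flip: cos_of_real sin_of_real)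

lemma macdonald_ser_recurrence:
  assumes "Re y > 0"
  shows "s * macdonald_ser s y = macdonald_ser (s + 1) y - y * macdonald_ser (s - 1) y"
proof -
  have y0: "y \<noteq> 0" using assms by auto
  define q where "q = of_real pi / sin (of_real pi * s)"
  have p1: "y powr (s + 1) = y powr s * y" using y0 by (simp add: powr_add)
  have p2: "y * y powr (s - 1) = y powr s" using y0 by (simp add: powr_diff)
  have r1: "bessel_ser (- s - 1) y = - s * bessel_ser (- s) y + y * bessel_ser (- s + 1) y"
    by (rule bessel_ser_recurrence)
  have r2: "bessel_ser (s - 1) y = s * bessel_ser s y + y * bessel_ser (s + 1) y"
    by (rule bessel_ser_recurrence)
  have m1: "macdonald_ser (s + 1) y = - q * (bessel_ser (- s - 1) y - y powr s * y * bessel_ser (s + 1) y)"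
    unfolding macdonald_ser_def q_def sin_pi_shift p1 by simp
  have m2: "y * macdonald_ser (s - 1) y = - q * (y * bessel_ser (- s + 1) y - y powr s * bessel_ser (s - 1) y)"
    unfolding macdonald_ser_def q_def sin_pi_shift p2[symmetric] by (simp add: algebra_simps)
  have m0: "macdonald_ser s y = q * (bessel_ser (- s) y - y powr s * bessel_ser s y)"
    by (simp add: macdonald_ser_def q_def)
  show ?thesis unfolding m0 m1 m2 r1 r2 by (simp add: algebra_simps)
qed

lemma macdonald_ser_deriv:
  assumes "Re y > 0"
  shows "(macdonald_ser s has_field_derivative - macdonald_ser (s - 1) y) (at y)"
proof -
  have y0: "y \<noteq> 0" "y \<notin> \<real>\<^sub>\<le>\<^sub>0" using assms by (auto simp: complex_nonpos_Reals_iff)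
  define q where "q = of_real pi / sin (of_real pi * s)"
  have "((\<lambda>y. q * (bessel_ser (- s) y - y powr s * bessel_ser s y)) has_field_derivative
     q * (bessel_ser (- s + 1) y - (s * y powr (s - 1) * bessel_ser s y + bessel_ser (s + 1) y * y powr s))) (at y)"
    by (intro DERIV_cmult DERIV_diff DERIV_mult bessel_ser_deriv has_field_derivative_powr y0)
  moreover have "q * (bessel_ser (- s + 1) y - (s * y powr (s - 1) * bessel_ser s y + bessel_ser (s + 1) y * y powr s))
     = - macdonald_ser (s - 1) y"
  proof -
    have p2: "y powr s = y * y powr (s - 1)" using y0 by (simp add: powr_diff)
    have r2: "bessel_ser (s - 1) y = s * bessel_ser s y + y * bessel_ser (s + 1) y"
      by (rule bessel_ser_recurrence)
    show ?thesis unfolding macdonald_ser_def sin_pi_shift r2 p2 q_def by (simp add: algebra_simps)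
  qed
  ultimately show ?thesis by (simp add: macdonald_ser_def[abs_def] q_def)
qed

lemma macdonald_ser_inversion:
  assumes "Re y > 0"
  shows "macdonald_ser s y = y powr s * macdonald_ser (- s) y"
proof -
  have "y \<noteq> 0" using assms by auto
  then have "y powr s * y powr (- s) = 1" by (simp flip: powr_add)
  then have "y powr s * (q * (bessel_ser s y - y powr (- s) * bessel_ser (- s) y)) = q * (y powr s * bessel_ser s y - bessel_ser (- s) y)" for q
    by (simp add: right_diff_distrib mult.assoc[symmetric] mult.commute[of _ q])
  then show ?thesis unfolding macdonald_ser_def
    by (simp add: algebra_simps)
qed

text \<open>
  Only the series of \<open>I_{-s}\<close> survives at \<open>0\<close>, and the reflection formula turns its value into \<open>\<Gamma> s\<close>.
\<close>

lemma macdonald_ser_tendsto_0: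
  assumes s: "Re s > 0" and ns: "sin (of_real pi * s) \<noteq> 0"
  shows "((\<lambda>y. macdonald_ser s (of_real y)) \<longlongrightarrow> Gamma s) (at_right 0)"
proof -
  have c: "((\<lambda>y. bessel_ser \<mu> (of_real y)) \<longlongrightarrow> bessel_ser \<mu> (of_real 0)) (at_right (0::real))" for \<mu>
  proof (rule isCont_tendsto_compose[where g = "bessel_ser \<mu>"])
    show "isCont (bessel_ser \<mu>) (of_real 0)" using bessel_ser_deriv DERIV_isCont by blast
  qed (intro tendsto_intros)
  have p: "((\<lambda>y. complex_of_real y powr s) \<longlongrightarrow> 0) (at_right 0)"
  proof (rule tendsto_norm_zero_cancel)
    have "((\<lambda>y::real. y powr Re s) \<longlongrightarrow> 0) (at_right 0)" using s by real_asymp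
    moreover have "eventually (\<lambda>y::real. y powr Re s = norm (complex_of_real y powr s)) (at_right 0)"
      by (rule eventually_at_rightI[of 0 1]) (auto simp: norm_powr_real_powr)
    ultimately show "((\<lambda>y. norm (complex_of_real y powr s)) \<longlongrightarrow> 0) (at_right 0)"
      by (rule Lim_transform_eventually)
  qed
  have "((\<lambda>y. macdonald_ser s (of_real y)) \<longlongrightarrow> of_real pi / sin (of_real pi * s) * (bessel_ser (- s) (of_real 0) - 0 * bessel_ser s (of_real 0))) (at_right 0)"
    unfolding macdonald_ser_def by (intro tendsto_intros c p)
  moreover have "bessel_ser (- s) (of_real 0) = rGamma (1 - s)"
    using sums_unique[OF powser_sums_zero[of "\<lambda>n. rGamma (- s + of_nat n + 1) / fact n"]]
    unfolding bessel_ser_def by simp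
  moreover have "of_real pi / sin (of_real pi * s) * rGamma (1 - s) = Gamma s"
  proof -
    have "rGamma s * rGamma (1 - s) = sin (of_real pi * s) / of_real pi" by (rule rGamma_reflection_complex)
    then have "rGamma s \<noteq> 0" "of_real pi / sin (of_real pi * s) * rGamma (1 - s) * rGamma s = 1" using ns by (auto simp: field_simps)
    then show ?thesis by (simp add: Gamma_def field_simps)
  qed
  ultimately show ?thesis by simp
qed

section \<open>Equality of the integral and the series\<close>

lemma gronwall_zero:
  fixes \<phi> \<phi>' :: "real \<Rightarrow> real"
  assumes d: "\<And>y. y > 0 \<Longrightarrow> (\<phi> has_real_derivative \<phi>' y) (at y)"
    and le: "\<And>y. y > 0 \<Longrightarrow> \<phi>' y \<le> M * \<phi> y"
    and lim: "(\<phi> \<longlongrightarrow> 0) (at_right 0)" and y: "y > 0"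
  shows "\<phi> y \<le> 0"
proof -
  define \<psi> where "\<psi> = (\<lambda>y. exp (- M * y) * \<phi> y)"
  have mono: "\<psi> y \<le> \<psi> x" if "0 < x" "x \<le> y" for x
  proof (rule DERIV_nonpos_imp_nonincreasing[OF that(2)])
    fix u assume u: "x \<le> u" "u \<le> y"
    have "(\<psi> has_real_derivative exp (- M * u) * (\<phi>' u - M * \<phi> u)) (at u)"
      unfolding \<psi>_def using u that by (auto intro!: derivative_eq_intros d simp: algebra_simps)
    moreover have "exp (- M * u) * (\<phi>' u - M * \<phi> u) \<le> 0"
      using le[of u] u that by (simp add: mult_le_0_iff)
    ultimately show "\<exists>D. (\<psi> has_real_derivative D) (at u) \<and> D \<le> 0" by blast
  qed
  have "(\<psi> \<longlongrightarrow> exp (- M * 0) * 0) (at_right 0)"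
    unfolding \<psi>_def by (intro tendsto_intros lim)
  moreover have "\<forall>\<^sub>F x in at_right 0. \<psi> y \<le> \<psi> x"
    by (rule eventually_at_rightI[of 0 y]) (use mono y in auto)
  ultimately have "\<psi> y \<le> 0"
    using tendsto_lowerbound[of \<psi> _ "at_right 0" "\<psi> y"] by simp
  then show ?thesis by (simp add: \<psi>_def mult_le_0_iff)
qed

lemma sin_pi_imaginary_nonzero:
  assumes "\<kappa> \<noteq> 0"
  shows "sin (of_real pi * (\<i> * of_real \<kappa> + of_int n)) \<noteq> 0"
proof
  assume "sin (of_real pi * (\<i> * of_real \<kappa> + of_int n) :: complex) = 0"
  then obtain m :: int where "of_real pi * (\<i> * of_real \<kappa> + of_int n) = complex_of_real (m * pi)" by (auto simp: sin_eq_0)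
  then have "Im (of_real pi * (\<i> * of_real \<kappa> + of_int n)) = 0" by (metis Im_complex_of_real)
  then show False using assms by simp
qed

text \<open>
  For any order, let \<open>D\<close> be the difference of the two functions. At the orders \<open>s + 1\<close> and \<open>1 - s\<close>
  it tends to \<open>0\<close> as \<open>y \<rightarrow> 0\<close>, since both functions tend to the same value of \<open>\<Gamma>\<close>; at the orders \<open>\<plusminus> s\<close>
  both functions oscillate near \<open>0\<close>, because \<open>s\<close> is imaginary, and have no limit to
  compare. The derivatives of \<open>D\<close> at \<open>s + 1\<close> and \<open>1 - s\<close> are \<open>- D\<close> at \<open>s\<close> and \<open>- s\<close>, and the recurrence together with the inversion expresses these through
  the first two with bounded coefficients. So the two differences solve a closed linear system with
  zero initial values.
\<close>

lemma laplace_int_eq_macdonald_ser_plus_1: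
  fixes \<kappa> :: real
  assumes k: "\<kappa> \<noteq> 0" and y: "y > 0"
  defines "s \<equiv> \<i> * of_real \<kappa>"
  shows "laplace_int (s + 1) (of_real y) = macdonald_ser (s + 1) (of_real y)"
    and "laplace_int (- s + 1) (of_real y) = macdonald_ser (- s + 1) (of_real y)"
proof -
  have s0: "s \<noteq> 0" using k by (simp add: s_def)
  have sin0: "sin (of_real pi * (s + 1)) \<noteq> 0" "sin (of_real pi * (- s + 1)) \<noteq> 0"
  proof -
    have "sin (of_real pi * s) \<noteq> 0" using sin_pi_imaginary_nonzero[OF k, of 0] by (simp add: s_def)
    then show "sin (of_real pi * (s + 1)) \<noteq> 0" "sin (of_real pi * (- s + 1)) \<noteq> 0"
      unfolding sin_pi_shift by auto
  qed
  define D where "D = (\<lambda>\<sigma> w. laplace_int \<sigma> w - macdonald_ser \<sigma> w)"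
  have D': "((\<lambda>y. D \<sigma> (of_real y)) has_vector_derivative - D (\<sigma> - 1) (of_real y)) (at y)" if "y > 0" for \<sigma> y
  proof (rule has_vector_derivative_real_field)
    have "((\<lambda>w. laplace_int \<sigma> w - macdonald_ser \<sigma> w) has_field_derivative - laplace_int (\<sigma> - 1) (of_real y) - - macdonald_ser (\<sigma> - 1) (of_real y)) (at (of_real y))"
      using that by (intro DERIV_diff laplace_int_deriv macdonald_ser_deriv) auto
    then show "(D \<sigma> has_field_derivative - D (\<sigma> - 1) (of_real y)) (at (of_real y))"
      by (simp add: D_def)
  qed
  have Drec: "\<sigma> * D \<sigma> (of_real y) = D (\<sigma> + 1) (of_real y) - of_real y * D (\<sigma> - 1) (of_real y)" if "y > 0" for \<sigma> y
    using laplace_int_recurrence[of "of_real y" \<sigma>] macdonald_ser_recurrence[of "of_real y" \<sigma>] that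
    by (simp add: D_def algebra_simps)
  have Dinv: "D \<sigma> (of_real y) = of_real y powr \<sigma> * D (- \<sigma>) (of_real y)" if "y > 0" for \<sigma> y
    using laplace_int_inversion[of y \<sigma>] macdonald_ser_inversion[of "of_real y" \<sigma>] that
    by (simp add: D_def algebra_simps)
  have Dlim: "((\<lambda>y. D \<sigma> (of_real y)) \<longlongrightarrow> 0) (at_right 0)" if "\<sigma> = s + 1 \<or> \<sigma> = - s + 1" for \<sigma>
  proof -
    have "Re \<sigma> > 0" "sin (of_real pi * \<sigma>) \<noteq> 0" using that sin0 by (auto simp: s_def)
    then show ?thesis
      using tendsto_diff[OF laplace_int_tendsto_0[of \<sigma>] macdonald_ser_tendsto_0[of \<sigma>]] by (simp add: D_def)
  qed
  define a where "a = (\<lambda>y. D (s + 1) (of_real y))"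
  define c where "c = (\<lambda>y. D (- s + 1) (of_real y))"
  \<comment> \<open>inversion replaces the order \<open>s' - 1\<close> in the recurrence by \<open>1 - s'\<close>, and \<open>y powr s'\<close> has modulus \<open>1\<close>\<close>
  have bound: "norm (D s' (of_real y)) \<le> (norm (a y) + norm (c y)) / norm s"
    if "y > 0" "s' = s \<or> s' = - s" for s' y
  proof -
    have "D (s' - 1) (of_real y) = of_real y powr (s' - 1) * D (- s' + 1) (of_real y)"
      using Dinv[OF that(1), of "s' - 1"] by simp
    then have "s' * D s' (of_real y) = D (s' + 1) (of_real y) - of_real y * of_real y powr (s' - 1) * D (- s' + 1) (of_real y)"
      using Drec[OF that(1), of s'] by simp
    also have "of_real y * of_real y powr (s' - 1) = complex_of_real y powr s'"
      using that by (simp add: powr_diff)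
    finally have "norm s * norm (D s' (of_real y)) = norm (D (s' + 1) (of_real y) - of_real y powr s' * D (- s' + 1) (of_real y))"
      using that by (metis norm_minus_cancel norm_mult)
    also have "\<dots> \<le> norm (D (s' + 1) (of_real y)) + norm (complex_of_real y powr s') * norm (D (- s' + 1) (of_real y))"
      by (metis norm_mult norm_triangle_ineq4)
    also have "norm (complex_of_real y powr s') = 1"
      using that by (auto simp: norm_powr_real_powr s_def)
    finally show ?thesis using that s0 by (auto simp: a_def c_def field_simps)
  qed
  define \<phi> where "\<phi> = (\<lambda>y. a y \<bullet> a y + c y \<bullet> c y)"
  have "\<phi> y \<le> 0"
  proof (rule gronwall_zero[OF _ _ _ y])
    fix y :: real assume y: "y > 0"
    have da: "(a has_vector_derivative - D s (of_real y)) (at y)"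
      and dc: "(c has_vector_derivative - D (- s) (of_real y)) (at y)"
      using D'[OF y, of "s + 1"] D'[OF y, of "- s + 1"] by (simp_all add: a_def c_def)
    show "(\<phi> has_real_derivative 2 * (a y \<bullet> (- D s (of_real y))) + 2 * (c y \<bullet> (- D (- s) (of_real y)))) (at y)"
      unfolding \<phi>_def has_real_derivative_iff_has_vector_derivative
      using has_vector_derivative_add[OF bounded_bilinear.has_vector_derivative[OF bounded_bilinear_inner da da]
          bounded_bilinear.has_vector_derivative[OF bounded_bilinear_inner dc dc]]
      by (simp add: inner_commute)
    have ineq: "2 * (u \<bullet> (- v)) \<le> 2 * norm u * ((norm (a y) + norm (c y)) / norm s)"
      if "norm v \<le> (norm (a y) + norm (c y)) / norm s" for u v :: complex
    proof -
      have "u \<bullet> (- v) \<le> norm u * norm (- v)" by (rule norm_cauchy_schwarz)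
      also have "\<dots> \<le> norm u * ((norm (a y) + norm (c y)) / norm s)"
        using that by (intro mult_left_mono) auto
      finally show ?thesis by simp
    qed
    have "2 * (a y \<bullet> (- D s (of_real y))) + 2 * (c y \<bullet> (- D (- s) (of_real y)))
      \<le> 2 * norm (a y) * ((norm (a y) + norm (c y)) / norm s) + 2 * norm (c y) * ((norm (a y) + norm (c y)) / norm s)"
      using bound[OF y] by (intro add_mono ineq) auto
    also have "\<dots> = 2 / norm s * (norm (a y) + norm (c y))\<^sup>2"
      by (simp add: power2_eq_square add_divide_distrib distrib_left distrib_right)
    also have "\<dots> \<le> 2 / norm s * (2 * \<phi> y)"
    proof (rule mult_left_mono)
      have "\<phi> y = (norm (a y))\<^sup>2 + (norm (c y))\<^sup>2" by (simp add: \<phi>_def power2_norm_eq_inner)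
      then show "(norm (a y) + norm (c y))\<^sup>2 \<le> 2 * \<phi> y"
        using sum_squares_bound[of "norm (a y)" "norm (c y)"] by (simp add: power2_sum)
    qed auto
    finally show "2 * (a y \<bullet> (- D s (of_real y))) + 2 * (c y \<bullet> (- D (- s) (of_real y))) \<le> 4 / norm s * \<phi> y" by simp
  next
    have "(\<phi> \<longlongrightarrow> (0::complex) \<bullet> 0 + (0::complex) \<bullet> 0) (at_right 0)"
      unfolding \<phi>_def a_def c_def by (intro tendsto_add tendsto_inner Dlim) auto
    then show "(\<phi> \<longlongrightarrow> 0) (at_right 0)" by simp
  qed
  then have "a y \<bullet> a y = 0 \<and> c y \<bullet> c y = 0"
    using inner_ge_zero[of "a y"] inner_ge_zero[of "c y"] unfolding \<phi>_def by linarith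
  then have "a y = 0 \<and> c y = 0" by simp
  then show "laplace_int (s + 1) (of_real y) = macdonald_ser (s + 1) (of_real y)"
    "laplace_int (- s + 1) (of_real y) = macdonald_ser (- s + 1) (of_real y)"
    by (simp_all add: a_def c_def D_def)
qed

text \<open>
  The recurrence carries the equality from the orders \<open>\<i> \<kappa> \<plusminus> 1\<close> to \<open>\<i> \<kappa>\<close> and then upwards; inversion
  gives the negative integers.
\<close>

lemma laplace_int_eq_macdonald_ser:
  fixes \<kappa> :: real and n :: int
  assumes k: "\<kappa> \<noteq> 0" and y: "y > 0"
  shows "laplace_int (\<i> * of_real \<kappa> + of_int n) (of_real y) = macdonald_ser (\<i> * of_real \<kappa> + of_int n) (of_real y)"
proof -
  define Q where "Q = (\<lambda>\<sigma>. laplace_int \<sigma> (of_real y) = macdonald_ser \<sigma> (of_real y))"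
  have rec: "\<sigma> * laplace_int \<sigma> (of_real y) = laplace_int (\<sigma> + 1) (of_real y) - of_real y * laplace_int (\<sigma> - 1) (of_real y)"
    "\<sigma> * macdonald_ser \<sigma> (of_real y) = macdonald_ser (\<sigma> + 1) (of_real y) - of_real y * macdonald_ser (\<sigma> - 1) (of_real y)" for \<sigma>
    using y by (simp_all add: laplace_int_recurrence macdonald_ser_recurrence)
  have up: "Q (\<sigma> + 1)" if "Q \<sigma>" "Q (\<sigma> - 1)" for \<sigma>
    using rec[of \<sigma>] that unfolding Q_def by (metis add_diff_cancel diff_add_cancel)
  have mid: "Q \<sigma>" if "Q (\<sigma> + 1)" "Q (\<sigma> - 1)" "\<sigma> \<noteq> 0" for \<sigma>
    using rec[of \<sigma>] that unfolding Q_def by (metis mult_left_cancel)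
  have inv: "Q (- \<sigma>)" if "Q \<sigma>" for \<sigma>
    using laplace_int_inversion[OF y, of "- \<sigma>"] macdonald_ser_inversion[of "of_real y" "- \<sigma>"] y that
    by (simp add: Q_def)
  have nat: "Q (\<i> * of_real x + of_nat m) \<and> Q (\<i> * of_real x + of_nat m + 1)" if "x \<noteq> 0" for x m
  proof (induction m)
    case 0
    have a: "Q (\<i> * of_real x + 1)" "Q (- (\<i> * of_real x) + 1)"
      using laplace_int_eq_macdonald_ser_plus_1[OF that y] by (simp_all add: Q_def)
    from inv[OF a(2)] have "Q (\<i> * of_real x - 1)" by simp
    with a that show ?case by (auto intro!: mid)
  next
    case (Suc m)
    then show ?case using up[of "\<i> * of_real x + of_nat m + 1"] by (simp add: add_ac)
  qed
  have "Q (\<i> * of_real \<kappa> + of_int n)"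
  proof (cases "n \<ge> 0")
    case True
    then show ?thesis using nat[OF k, of "nat n"] by (simp add: of_nat_nat)
  next
    case False
    have "Q (\<i> * of_real (- \<kappa>) + of_nat (nat (- n)))" using nat[of "- \<kappa>" "nat (- n)"] k by simp
    from inv[OF this] show ?thesis using False by (simp add: of_nat_nat add.commute)
  qed
  then show ?thesis by (simp add: Q_def)
qed

section \<open>The Macdonald function of a logarithmic variable\<close>

text \<open>
  The argument is \<open>X = exp l\<close>. Working with the logarithm avoids branch cuts when the argument is
  rotated to the imaginary axis.
\<close>

definition macdonald_kernel :: "complex \<Rightarrow> complex \<Rightarrow> real \<Rightarrow> complex" where
  "macdonald_kernel \<mu> l t = exp (- (exp l * of_real (cosh t)) - \<mu> * of_real t)"

text \<open>
  Both \<open>macdonald_int \<mu> l\<close> and \<open>macdonald_log \<mu> l\<close> represent \<open>2 K_\<mu> (exp l)\<close> when \<open>\<mu>\<close> is not an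
  integer: the first for \<open>exp l\<close> in the right half plane, the second as an entire function of \<open>l\<close>.
\<close>

definition macdonald_int :: "complex \<Rightarrow> complex \<Rightarrow> complex" where
  "macdonald_int \<mu> l = (\<integral>t. macdonald_kernel \<mu> l t \<partial>lborel)"

definition macdonald_log :: "complex \<Rightarrow> complex \<Rightarrow> complex" where
  "macdonald_log \<mu> l = of_real pi / sin (of_real pi * \<mu>) *
     (exp (- \<mu> * (l - of_real (ln 2))) * bessel_ser (- \<mu>) (exp (2 * (l - of_real (ln 2))))
      - exp (\<mu> * (l - of_real (ln 2))) * bessel_ser \<mu> (exp (2 * (l - of_real (ln 2)))))"

lemma norm_macdonald_kernel:
  "norm (macdonald_kernel \<mu> l t) = exp (- (Re (exp l) * cosh t) - Re \<mu> * t)"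
  by (simp add: macdonald_kernel_def del: Re_exp)

lemma macdonald_kernel_bound:
  assumes "0 < c" "c \<le> Re (exp l)"
  shows "norm (macdonald_kernel \<mu> l t) \<le> exp ((\<bar>Re \<mu>\<bar> + 1)\<^sup>2 / c) * exp (- \<bar>t\<bar>)"
proof -
  have "norm (macdonald_kernel \<mu> l t) \<le> exp (- (c * cosh t) + \<bar>Re \<mu>\<bar> * \<bar>t\<bar>)"
  proof -
    have "c * cosh t \<le> Re (exp l) * cosh t" using assms by (intro mult_right_mono) auto
    moreover have "- (Re \<mu> * t) \<le> \<bar>Re \<mu>\<bar> * \<bar>t\<bar>"
      using abs_ge_minus_self[of "Re \<mu> * t"] by (simp add: abs_mult)
    ultimately have "- (Re (exp l) * cosh t) - Re \<mu> * t \<le> - (c * cosh t) + \<bar>Re \<mu>\<bar> * \<bar>t\<bar>" by linarith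
    then show ?thesis unfolding norm_macdonald_kernel by simp
  qed
  also have "\<dots> \<le> exp ((\<bar>Re \<mu>\<bar> + 1)\<^sup>2 / c) * exp (- \<bar>t\<bar>)"
    by (rule exp_neg_cosh_bound) fact
  finally show ?thesis .
qed

lemma macdonald_kernel_continuous: "continuous_on A (macdonald_kernel \<mu> l)"
  unfolding macdonald_kernel_def by (intro continuous_intros)

lemma macdonald_kernel_measurable [measurable]: "macdonald_kernel \<mu> l \<in> borel_measurable borel"
  by (rule borel_measurable_continuous_onI) (rule macdonald_kernel_continuous)

lemma macdonald_kernel_integrable:
  assumes "0 < Re (exp l)"
  shows "integrable lborel (macdonald_kernel \<mu> l)"
  by (rule integrable_of_exp_bound[OF macdonald_kernel_measurable macdonald_kernel_bound[OF assms order_refl]])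

definition right_strip :: "complex set" where
  "right_strip = {l. \<bar>Im l\<bar> < pi / 2}"

lemma right_strip_open: "open right_strip"
  unfolding right_strip_def by (intro open_Collect_less continuous_intros)

lemma right_strip_connected: "connected right_strip"
proof -
  have eq: "right_strip = {l. Im l < pi / 2} \<inter> {l. Im l > - pi / 2}"
    by (auto simp: right_strip_def)
  show ?thesis
    unfolding eq by (intro convex_connected convex_Int convex_halfspace_Im_lt convex_halfspace_Im_gt)
qed

lemma Re_exp_pos: "l \<in> right_strip \<Longrightarrow> 0 < Re (exp l)"
  unfolding right_strip_def Re_exp by (intro mult_pos_pos cos_gt_zero_pi) auto

lemma macdonald_int_holomorphic: "macdonald_int \<mu> holomorphic_on right_strip"
proof (rule holomorphic_onI)
  fix l assume "l \<in> right_strip"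
  then have l: "0 < Re (exp l)" by (rule Re_exp_pos)
  define c where "c = Re (exp l) / 2"
  have c: "0 < c" "c < Re (exp l)" using l unfolding c_def by linarith+
  define S where "S = {w. c < Re (exp w)}"
  have S: "open S" "l \<in> S"
    using c unfolding S_def by (auto intro!: open_Collect_less continuous_intros)
  have "((\<lambda>w. \<integral>t. macdonald_kernel \<mu> w t \<partial>lborel) has_field_derivative (\<integral>t. deriv (\<lambda>w. macdonald_kernel \<mu> w t) l \<partial>lborel)) (at l)"
  proof (rule parametric_integral_has_field_derivative(2)[OF S])
    show "integrable lborel (\<lambda>t::real. exp ((\<bar>Re \<mu>\<bar> + 1)\<^sup>2 / c) * exp (- (1 * \<bar>t\<bar>)))"
      by (intro integrable_mult_right integrable_exp_neg_abs) auto
    show "(\<lambda>w. macdonald_kernel \<mu> w t) holomorphic_on S" for t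
      unfolding macdonald_kernel_def by (intro holomorphic_intros)
    show "norm (macdonald_kernel \<mu> w t) \<le> exp ((\<bar>Re \<mu>\<bar> + 1)\<^sup>2 / c) * exp (- (1 * \<bar>t\<bar>))" if "w \<in> S" for w t
      using macdonald_kernel_bound[of c w \<mu> t] that c by (simp add: S_def)
  qed auto
  then show "macdonald_int \<mu> field_differentiable at l within right_strip"
    unfolding field_differentiable_def macdonald_int_def[abs_def]
    using has_field_derivative_at_within by blast
qed

lemma macdonald_log_holomorphic: "macdonald_log \<mu> holomorphic_on A"
proof -
  have "(\<lambda>l. bessel_ser \<nu> (exp (2 * (l - of_real (ln 2))))) holomorphic_on A" for \<nu>
    by (rule holomorphic_on_compose_gen[OF _ bessel_ser_holomorphic[of \<nu> UNIV], unfolded o_def])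
      (auto intro!: holomorphic_intros)
  then show ?thesis unfolding macdonald_log_def by (intro holomorphic_intros)
qed

text \<open>
  Translating the variable by \<open>d = x - ln 2\<close> turns \<open>exp x cosh t\<close> into \<open>exp t + y exp (- t)\<close> with
  \<open>y = exp (2 d)\<close>, the exponent of \<open>laplace_int\<close>.
\<close>

lemma macdonald_int_real:
  fixes \<kappa> x :: real and n :: int
  assumes "\<kappa> \<noteq> 0"
  defines "\<mu> \<equiv> \<i> * of_real \<kappa> + of_int n"
  shows "macdonald_int \<mu> (of_real x) = macdonald_log \<mu> (of_real x)"
proof -
  define d where "d = x - ln 2"
  define y where "y = exp (2 * d)"
  have y: "y > 0" by (simp add: y_def)
  have "y = exp d * exp d" by (simp add: y_def flip: exp_add)
  moreover have "exp x = 2 * exp d" by (simp add: d_def exp_diff)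
  ultimately have ey: "complex_of_real y = exp (of_real d) * exp (of_real d)" "exp (of_real x) = 2 * exp (complex_of_real d)"
    by (simp_all only: exp_of_real of_real_mult of_real_numeral)
  have "macdonald_int \<mu> (of_real x) = (\<integral>t. macdonald_kernel \<mu> (of_real x) (- d + 1 * t) \<partial>lborel)"
    unfolding macdonald_int_def by (subst lborel_integral_real_affine[where c = 1 and t = "- d"]) auto
  also have "\<dots> = (\<integral>t. exp (\<mu> * of_real d) * laplace_kernel (- \<mu>) (of_real y) t \<partial>lborel)"
  proof (rule Bochner_Integration.integral_cong[OF refl])
    fix t :: real
    define E where "E = exp (complex_of_real d)"
    have E: "E \<noteq> 0" by (simp add: E_def)
    have "complex_of_real (cosh (- d + 1 * t)) = (exp (of_real t) / E + E * exp (- of_real t)) / 2"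
      unfolding cosh_field_def E_def exp_of_real[symmetric] of_real_divide of_real_add
      by (simp add: exp_diff exp_add exp_minus divide_simps flip: exp_of_real)
    then have "exp (of_real x) * complex_of_real (cosh (- d + 1 * t)) = exp (of_real t) + complex_of_real y * exp (- of_real t)"
      unfolding ey E_def[symmetric] using E by (simp add: field_simps)
    then have "macdonald_kernel \<mu> (of_real x) (- d + 1 * t) = exp (- (exp (of_real t) + complex_of_real y * exp (- of_real t)) - \<mu> * of_real (- d + 1 * t))"
      unfolding macdonald_kernel_def by simp
    also have "\<dots> = exp (\<mu> * of_real d + (- exp (of_real t) - complex_of_real y * exp (- of_real t) + - \<mu> * of_real t))"
    proof -
      have "- (a + b) - \<mu> * complex_of_real (- d + 1 * t) = \<mu> * of_real d + (- a - b + - \<mu> * of_real t)" for a b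
        by (simp add: algebra_simps)
      then show ?thesis by (simp only:)
    qed
    also have "\<dots> = exp (\<mu> * of_real d) * laplace_kernel (- \<mu>) (of_real y) t"
      unfolding laplace_kernel_def by (rule exp_add)
    finally show "macdonald_kernel \<mu> (of_real x) (- d + 1 * t) = exp (\<mu> * of_real d) * laplace_kernel (- \<mu>) (of_real y) t" .
  qed
  also have "\<dots> = exp (\<mu> * of_real d) * laplace_int (- \<mu>) (of_real y)"
    by (simp add: laplace_int_def)
  also have "laplace_int (- \<mu>) (of_real y) = macdonald_ser (- \<mu>) (of_real y)"
    using laplace_int_eq_macdonald_ser[of "- \<kappa>" y "- n"] assms y by simp
  also have "exp (\<mu> * of_real d) * macdonald_ser (- \<mu>) (of_real y) = macdonald_log \<mu> (of_real x)"
  proof -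
    have "complex_of_real y powr (- \<mu>) = exp (- \<mu> * of_real d) * exp (- \<mu> * of_real d)"
      using y by (simp add: powr_def Ln_of_real y_def algebra_simps flip: exp_add)
    then have 1: "exp (\<mu> * of_real d) * complex_of_real y powr (- \<mu>) = exp (- \<mu> * of_real d)"
      by (simp flip: exp_add)
    have "exp (\<mu> * of_real d) * macdonald_ser (- \<mu>) (of_real y) =
      - (of_real pi / sin (of_real pi * \<mu>) * (exp (\<mu> * of_real d) * bessel_ser \<mu> (of_real y) - (exp (\<mu> * of_real d) * complex_of_real y powr (- \<mu>)) * bessel_ser (- \<mu>) (of_real y)))"
      unfolding macdonald_ser_def by (simp add: algebra_simps)
    also have "\<dots> = of_real pi / sin (of_real pi * \<mu>) * (exp (- \<mu> * of_real d) * bessel_ser (- \<mu>) (of_real y) - exp (\<mu> * of_real d) * bessel_ser \<mu> (of_real y))"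
      unfolding 1 by (simp add: algebra_simps)
    finally have main: "exp (\<mu> * of_real d) * macdonald_ser (- \<mu>) (of_real y) = \<dots>" .
    have e1: "complex_of_real y = exp (2 * of_real d)"
      by (simp add: y_def flip: exp_of_real)
    have e2: "complex_of_real d = of_real x - of_real (ln 2)" by (simp add: d_def)
    show ?thesis
      unfolding macdonald_log_def e2[symmetric] e1[symmetric] by (rule main)
  qed
  finally show ?thesis .
qed

lemma eq_on_right_strip:
  assumes "f holomorphic_on right_strip" "g holomorphic_on right_strip"
    and "\<And>x. f (of_real x) = g (of_real x)" and "l \<in> right_strip"
  shows "f l = g l"
proof -
  have "0 islimpt (range complex_of_real)"
    unfolding islimpt_approachable
  proof (intro allI impI)
    fix e :: real assume "e > 0"
    then show "\<exists>x'\<in>range complex_of_real. x' \<noteq> 0 \<and> dist x' 0 < e"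
      by (intro bexI[of _ "of_real (e / 2)"]) (auto simp del: of_real_divide)
  qed
  then have "(\<lambda>l. f l - g l) l = 0"
    by (rule analytic_continuation[OF _ right_strip_open right_strip_connected, rotated 3])
      (use assms in \<open>auto simp: right_strip_def intro!: holomorphic_intros\<close>)
  then show ?thesis by simp
qed

lemma macdonald_int_eq_log:
  assumes "\<kappa> \<noteq> 0" "l \<in> right_strip"
  shows "macdonald_int (\<i> * of_real \<kappa> + of_int n) l = macdonald_log (\<i> * of_real \<kappa> + of_int n) l"
  by (rule eq_on_right_strip[OF macdonald_int_holomorphic macdonald_log_holomorphic macdonald_int_real[OF assms(1)] assms(2)])

lemma macdonald_int_cnj: "macdonald_int (cnj \<mu>) (cnj l) = cnj (macdonald_int \<mu> l)"
proof -
  have "macdonald_kernel (cnj \<mu>) (cnj l) t = cnj (macdonald_kernel \<mu> l t)" for t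
    by (simp add: macdonald_kernel_def exp_cnj)
  then show ?thesis by (simp add: macdonald_int_def)
qed

section \<open>Shifting lines of integration\<close>

lemma tendsto_half_line_integral:
  fixes f :: "real \<Rightarrow> complex"
  assumes f: "set_integrable lborel {0..} f"
  shows "(\<lambda>n. LINT x:{0..real n}|lborel. f x) \<longlonglongrightarrow> (LINT x:{0..}|lborel. f x)"
proof -
  let ?g = "\<lambda>x. indicator {0..} x *\<^sub>R f x"
  have "(\<lambda>n. LINT x:{- real n..real n}|lborel. ?g x) \<longlonglongrightarrow> integral\<^sup>L lborel ?g"
    using f unfolding set_integrable_def by (rule tendsto_integral_exhaustion)
  moreover have "(LINT x:{- real n..real n}|lborel. ?g x) = (LINT x:{0..real n}|lborel. f x)" for n
    unfolding set_lebesgue_integral_def by (intro Bochner_Integration.integral_cong) (auto simp: indicator_def)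
  ultimately show ?thesis by (simp add: set_lebesgue_integral_def)
qed

lemma vertical_increment_bound:
  fixes F f :: "complex \<Rightarrow> complex" and x b :: real
  assumes F: "\<And>w. (F has_field_derivative f w) (at w)"
    and le: "\<And>u. 0 \<le> u \<Longrightarrow> u \<le> 1 \<Longrightarrow> norm (f (of_real x + \<i> * of_real (u * b))) \<le> B"
  shows "norm (F (of_real x + \<i> * of_real b) - F (of_real x)) \<le> B * \<bar>b\<bar>"
proof -
  have "norm (F (of_real x + \<i> * of_real b) - F (of_real x)) \<le> B * norm (of_real x + \<i> * of_real b - of_real x)"
  proof (rule field_differentiable_bound[where S = "closed_segment (of_real x) (of_real x + \<i> * of_real b)" and f' = f])
    fix w assume "w \<in> closed_segment (complex_of_real x) (of_real x + \<i> * of_real b)"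
    then obtain u where "0 \<le> u" "u \<le> 1" "w = of_real x + \<i> * of_real (u * b)"
      unfolding closed_segment_def by (auto simp: scaleR_conv_of_real algebra_simps)
    then show "norm (f w) \<le> B" using le by simp
  qed (auto intro: has_field_derivative_at_within[OF F])
  then show ?thesis by (simp add: norm_mult)
qed

lemma integral_horizontal:
  fixes F f :: "complex \<Rightarrow> complex"
  assumes F: "\<And>w. (F has_field_derivative f w) (at w)" and "a \<le> b"
  shows "(LINT x:{a..b}|lborel. f (of_real x + c)) = F (of_real b + c) - F (of_real a + c)"
  unfolding set_lebesgue_integral_def
proof (rule integral_FTC_Icc[OF assms(2)])
  fix x :: real
  have "((\<lambda>w. F (w + c)) has_field_derivative f (of_real x + c) * 1) (at (of_real x))"
    by (rule DERIV_chain2[OF F]) (auto intro!: derivative_eq_intros)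
  then have "((\<lambda>w. F (w + c)) has_field_derivative f (of_real x + c)) (at (of_real x))" by simp
  then have "((\<lambda>x. F (of_real x + c)) has_vector_derivative f (of_real x + c)) (at x)"
    by (rule has_vector_derivative_real_field)
  then show "((\<lambda>x. F (of_real x + c)) has_vector_derivative f (of_real x + c)) (at x within {a..b})"
    by (rule has_vector_derivative_at_within)
next
  have "f field_differentiable at w" for w
  proof -
    have "F holomorphic_on UNIV" using F by (auto simp: holomorphic_on_def field_differentiable_def)
    then have "deriv F holomorphic_on UNIV" by (intro holomorphic_deriv) auto
    moreover have "deriv F = f" using F DERIV_imp_deriv by blast
    ultimately show ?thesis by (auto simp: holomorphic_on_def)
  qed
  then have "continuous_on UNIV f"
    by (simp add: continuous_at_imp_continuous_on field_differentiable_imp_continuous_at)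
  then show "continuous_on {a..b} (\<lambda>x. f (of_real x + c))"
    by (rule continuous_on_compose2) (auto intro!: continuous_intros)
qed

lemma entire_line_continuous:
  assumes "f holomorphic_on UNIV"
  shows "continuous_on A (\<lambda>x. f (of_real x + c))"
  by (rule continuous_on_compose2[OF holomorphic_on_imp_continuous_on[OF assms]]) (auto intro!: continuous_intros)

text \<open>
  A primitive of \<open>f\<close> compares the truncated integrals over the two lines; their difference is the
  contribution of the vertical sides, which vanishes by the decay assumption.
\<close>

lemma line_integral_shift:
  fixes f :: "complex \<Rightarrow> complex" and b C :: real
  assumes hol: "f holomorphic_on UNIV"
    and le: "\<And>x \<tau>. \<bar>\<tau>\<bar> \<le> \<bar>b\<bar> \<Longrightarrow> norm (f (of_real x + \<i> * of_real \<tau>)) \<le> C * exp (- \<bar>x\<bar>)"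
  shows "(\<integral>x. f (of_real x + \<i> * of_real b) \<partial>lborel) = (\<integral>x. f (of_real x) \<partial>lborel)"
proof -
  obtain F where F: "\<And>w. (F has_field_derivative f w) (at w)"
    using holomorphic_convex_primitive'[OF convex_UNIV open_UNIV hol] by auto
  have int: "integrable lborel (\<lambda>x. f (of_real x + \<i> * of_real \<tau>))" if "\<bar>\<tau>\<bar> \<le> \<bar>b\<bar>" for \<tau>
    by (rule integrable_of_exp_bound[OF borel_measurable_continuous_onI[OF entire_line_continuous[OF hol]] le[OF that]])
  have V: "norm (F (of_real x + \<i> * of_real b) - F (of_real x)) \<le> C * exp (- \<bar>x\<bar>) * \<bar>b\<bar>" for x
    by (rule vertical_increment_bound[OF F le]) (simp add: abs_mult mult_left_le_one_le)
  have "(\<lambda>n. (LINT x:{- real n..real n}|lborel. f (of_real x + \<i> * of_real b)) - (LINT x:{- real n..real n}|lborel. f (of_real x + \<i> * of_real 0)))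
     \<longlonglongrightarrow> (\<integral>x. f (of_real x + \<i> * of_real b) \<partial>lborel) - (\<integral>x. f (of_real x + \<i> * of_real 0) \<partial>lborel)"
    by (intro tendsto_diff tendsto_integral_exhaustion int) auto
  moreover have "(\<lambda>n. (LINT x:{- real n..real n}|lborel. f (of_real x + \<i> * of_real b)) - (LINT x:{- real n..real n}|lborel. f (of_real x + \<i> * of_real 0))) \<longlonglongrightarrow> 0"
  proof (rule tendsto_norm_zero_cancel, rule tendsto_sandwich[OF _ _ tendsto_const])
    have "norm ((LINT x:{- real n..real n}|lborel. f (of_real x + \<i> * of_real b)) - (LINT x:{- real n..real n}|lborel. f (of_real x + \<i> * of_real 0))) \<le> 2 * C * \<bar>b\<bar> * exp (- real n)" for n
    proof -
      have "(LINT x:{- real n..real n}|lborel. f (of_real x + \<i> * of_real b)) - (LINT x:{- real n..real n}|lborel. f (of_real x + \<i> * of_real 0))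
         = (F (of_real (real n) + \<i> * of_real b) - F (of_real (real n))) - (F (of_real (- real n) + \<i> * of_real b) - F (of_real (- real n)))"
        by (subst (1 2) integral_horizontal[OF F]) auto
      also have "norm \<dots> \<le> C * exp (- \<bar>real n\<bar>) * \<bar>b\<bar> + C * exp (- \<bar>- real n\<bar>) * \<bar>b\<bar>"
        by (rule order_trans[OF norm_triangle_ineq4 add_mono[OF V V]])
      finally show ?thesis by (simp add: algebra_simps)
    qed
    then show "\<forall>\<^sub>F n in sequentially. norm ((LINT x:{- real n..real n}|lborel. f (of_real x + \<i> * of_real b)) - (LINT x:{- real n..real n}|lborel. f (of_real x + \<i> * of_real 0))) \<le> 2 * C * \<bar>b\<bar> * exp (- real n)" by simp
    show "(\<lambda>n. 2 * C * \<bar>b\<bar> * exp (- real n)) \<longlonglongrightarrow> 0" by real_asymp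
  qed auto
  ultimately show ?thesis using LIMSEQ_unique by fastforce
qed

text \<open>
  As for full lines, except that the vertical side at \<open>x = 0\<close> remains.
\<close>

lemma half_line_integral_shift:
  fixes f :: "complex \<Rightarrow> complex" and b C :: real
  assumes hol: "f holomorphic_on UNIV" and b: "0 \<le> b"
    and le: "\<And>x \<tau>. 0 \<le> x \<Longrightarrow> 0 \<le> \<tau> \<Longrightarrow> \<tau> \<le> b \<Longrightarrow> norm (f (of_real x + \<i> * of_real \<tau>)) \<le> C * exp (- x)"
  shows "(LINT x:{0..}|lborel. f (of_real x)) =
     \<i> * integral {0..b} (\<lambda>\<tau>. f (\<i> * of_real \<tau>)) + (LINT x:{0..}|lborel. f (of_real x + \<i> * of_real b))"
proof -
  obtain F where F: "\<And>w. (F has_field_derivative f w) (at w)"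
    using holomorphic_convex_primitive'[OF convex_UNIV open_UNIV hol] by auto
  have int: "set_integrable lborel {0..} (\<lambda>x. f (of_real x + \<i> * of_real \<tau>))" if "0 \<le> \<tau>" "\<tau> \<le> b" for \<tau>
    unfolding set_integrable_def
  proof (rule integrable_of_exp_bound)
    show "(\<lambda>x. indicator {0..} x *\<^sub>R f (of_real x + \<i> * of_real \<tau>)) \<in> borel_measurable borel"
      by (intro borel_measurable_scaleR borel_measurable_continuous_onI[OF entire_line_continuous[OF hol]]) auto
    have "0 \<le> C * exp (- 0)" using le[of 0 0] b norm_ge_zero order_trans by (metis order_refl)
    then show "norm (indicator {0..} x *\<^sub>R f (of_real x + \<i> * of_real \<tau>)) \<le> C * exp (- \<bar>x\<bar>)" for x
      using le[OF _ that] by (auto simp: indicator_def)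
  qed
  have V: "norm (F (of_real x + \<i> * of_real b) - F (of_real x)) \<le> C * exp (- x) * \<bar>b\<bar>" if "x \<ge> 0" for x
    by (rule vertical_increment_bound[OF F le]) (use that b in \<open>auto simp: mult_left_le_one_le\<close>)
  have vert: "F (\<i> * of_real b) - F 0 = \<i> * integral {0..b} (\<lambda>\<tau>. f (\<i> * of_real \<tau>))"
  proof -
    have "((\<lambda>\<tau>. \<i> * f (\<i> * of_real \<tau>)) has_integral (F (\<i> * of_real b) - F (\<i> * of_real 0))) {0..b}"
    proof (rule fundamental_theorem_of_calculus[OF b])
      fix \<tau> :: real
      have "((\<lambda>w. F (\<i> * w)) has_field_derivative f (\<i> * of_real \<tau>) * \<i>) (at (of_real \<tau>))"
        by (rule DERIV_chain2[OF F]) (auto intro!: derivative_eq_intros)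
      then have "((\<lambda>w. F (\<i> * w)) has_field_derivative \<i> * f (\<i> * of_real \<tau>)) (at (of_real \<tau>))" by (simp add: mult.commute)
      then have "((\<lambda>\<tau>. F (\<i> * of_real \<tau>)) has_vector_derivative \<i> * f (\<i> * of_real \<tau>)) (at \<tau>)"
        by (rule has_vector_derivative_real_field)
      then show "((\<lambda>\<tau>. F (\<i> * of_real \<tau>)) has_vector_derivative \<i> * f (\<i> * of_real \<tau>)) (at \<tau> within {0..b})"
        by (rule has_vector_derivative_at_within)
    qed
    from integral_unique[OF this] show ?thesis by simp
  qed
  let ?d = "\<lambda>n. (LINT x:{0..real n}|lborel. f (of_real x + \<i> * of_real 0)) - (LINT x:{0..real n}|lborel. f (of_real x + \<i> * of_real b))"
  have lim1: "?d \<longlonglongrightarrow> (LINT x:{0..}|lborel. f (of_real x + \<i> * of_real 0)) - (LINT x:{0..}|lborel. f (of_real x + \<i> * of_real b))"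
    by (intro tendsto_diff tendsto_half_line_integral int) (use b in auto)
  have deq: "?d n = (F (\<i> * of_real b) - F 0) - (F (of_real (real n) + \<i> * of_real b) - F (of_real (real n)))" for n
    by (subst (1 2) integral_horizontal[OF F]) auto
  have "(\<lambda>n. F (of_real (real n) + \<i> * of_real b) - F (of_real (real n))) \<longlonglongrightarrow> 0"
  proof (rule tendsto_norm_zero_cancel, rule tendsto_sandwich[OF _ _ tendsto_const])
    show "\<forall>\<^sub>F n in sequentially. norm (F (of_real (real n) + \<i> * of_real b) - F (of_real (real n))) \<le> C * exp (- real n) * \<bar>b\<bar>"
      by (intro always_eventually allI V) simp
    show "(\<lambda>n. C * exp (- real n) * \<bar>b\<bar>) \<longlonglongrightarrow> 0" by real_asymp
  qed auto
  then have "?d \<longlonglongrightarrow> (F (\<i> * of_real b) - F 0) - 0"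
    unfolding deq by (intro tendsto_diff tendsto_const)
  then have "(LINT x:{0..}|lborel. f (of_real x + \<i> * of_real 0)) - (LINT x:{0..}|lborel. f (of_real x + \<i> * of_real b)) = F (\<i> * of_real b) - F 0"
    using LIMSEQ_unique[OF lim1] by simp
  then show ?thesis unfolding vert by (simp add: diff_eq_eq)
qed

lemma integral_split_halves:
  fixes f :: "real \<Rightarrow> complex"
  assumes f: "integrable lborel f"
  shows "integral\<^sup>L lborel f = (LINT x:{0..}|lborel. f x + f (- x))"
proof -
  have f': "integrable lborel (\<lambda>x. f (0 + (-1) * x))"
    using f by (subst lborel_integrable_real_affine_iff) auto
  have i1: "integrable lborel (\<lambda>x. indicator {0..} x *\<^sub>R f x)" "integrable lborel (\<lambda>x. indicator {..<0} x *\<^sub>R f x)"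
    "integrable lborel (\<lambda>x. indicator {0..} x *\<^sub>R f (- x))"
    using f f' by (auto intro!: integrable_mult_indicator)
  have "integral\<^sup>L lborel f = (\<integral>x. indicator {0..} x *\<^sub>R f x + indicator {..<0} x *\<^sub>R f x \<partial>lborel)"
    by (intro Bochner_Integration.integral_cong) (auto simp: indicator_def)
  also have "\<dots> = (\<integral>x. indicator {0..} x *\<^sub>R f x \<partial>lborel) + (\<integral>x. indicator {..<0} x *\<^sub>R f x \<partial>lborel)"
    by (rule Bochner_Integration.integral_add[OF i1(1,2)])
  also have "(\<integral>x. indicator {..<0} x *\<^sub>R f x \<partial>lborel) = (\<integral>x. indicator {..<0} (0 + (-1) * x) *\<^sub>R f (0 + (-1) * x) \<partial>lborel)"
    by (subst lborel_integral_real_affine[where c = "-1" and t = 0]) auto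
  also have "\<dots> = (\<integral>x. indicator {0..} x *\<^sub>R f (- x) \<partial>lborel)"
  proof (rule integral_cong_AE)
    show "AE x in lborel. indicator {..<0} (0 + (-1) * x) *\<^sub>R f (0 + (-1) * x) = indicator {0..} x *\<^sub>R f (- x)"
      using AE_lborel_singleton[of 0] by eventually_elim (auto simp: indicator_def)
  qed (use f in \<open>auto simp: measurable_lborel1\<close>)
  also have "(\<integral>x. indicator {0..} x *\<^sub>R f x \<partial>lborel) + (\<integral>x. indicator {0..} x *\<^sub>R f (- x) \<partial>lborel) = (LINT x:{0..}|lborel. f x + f (- x))"
    unfolding set_lebesgue_integral_def scaleR_add_right
    by (rule Bochner_Integration.integral_add[OF i1(1,3), symmetric])
  finally show ?thesis .
qed

section \<open>The Macdonald function along rotated rays\<close>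

text \<open>
  The integrand of \<open>K_n (R exp (- \<i> \<alpha>))\<close> after the half line has been shifted up by \<open>\<i> \<alpha>\<close>, which undoes the
  rotation of the argument at infinity.
\<close>

definition ray_tail :: "int \<Rightarrow> real \<Rightarrow> real \<Rightarrow> real \<Rightarrow> complex" where
  "ray_tail n R \<alpha> x = exp (- (of_real R * exp (- \<i> * of_real \<alpha>) * cosh (of_real x + \<i> * of_real \<alpha>))) * cosh (of_int n * (of_real x + \<i> * of_real \<alpha>))"

lemma norm_cosh_le:
  "norm (cosh (of_real x + \<i> * of_real \<tau>)) \<le> cosh x"
proof -
  have "norm (cosh (of_real x + \<i> * of_real \<tau> :: complex)) = norm (exp (of_real x + \<i> * of_real \<tau>) + exp (- (of_real x + \<i> * of_real \<tau>))) / 2"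
    by (simp add: cosh_field_def norm_divide)
  also have "\<dots> \<le> (norm (exp (of_real x + \<i> * of_real \<tau> :: complex)) + norm (exp (- (of_real x + \<i> * of_real \<tau> :: complex)))) / 2"
    by (intro divide_right_mono norm_triangle_ineq) simp
  also have "\<dots> = cosh x" by (simp add: cosh_field_def)
  finally show ?thesis .
qed

lemma cosh_int_le: "cosh (of_int n * x) \<le> exp (\<bar>of_int n\<bar> * \<bar>x :: real\<bar>)"
proof -
  have "cosh (of_int n * x) = cosh \<bar>of_int n * x\<bar>" by (simp add: cosh_real_abs)
  also have "\<dots> \<le> exp \<bar>of_int n * x\<bar>" by (simp add: cosh_field_def)
  finally show ?thesis by (simp add: abs_mult)
qed

lemma norm_cosh_int_le:
  "norm (cosh (of_int n * (of_real x + \<i> * of_real \<tau>) :: complex)) \<le> exp (\<bar>of_int n\<bar> * \<bar>x\<bar>)"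
proof -
  have "of_int n * (of_real x + \<i> * of_real \<tau>) = complex_of_real (of_int n * x) + \<i> * of_real (of_int n * \<tau>)"
    by (simp add: algebra_simps)
  then have "norm (cosh (of_int n * (of_real x + \<i> * of_real \<tau>) :: complex)) \<le> cosh (of_int n * x)"
    using norm_cosh_le by metis
  then show ?thesis using cosh_int_le order_trans by blast
qed

lemma cosh_Complex:
  "cosh (of_real x + \<i> * of_real \<tau>) = Complex (cosh x * cos \<tau>) (sinh x * sin \<tau>)"
  by (simp add: complex_eq_iff cosh_field_def sinh_field_def Re_exp Im_exp algebra_simps diff_divide_distrib add_divide_distrib)

lemma Re_rotated_cosh:
  "Re (of_real R * exp (- \<i> * of_real \<alpha>) * cosh (of_real x + \<i> * of_real \<tau>)) =
   R * (cos \<alpha> * cos \<tau> * cosh x + sin \<alpha> * sin \<tau> * sinh x)"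
  unfolding cosh_Complex by (simp add: Re_exp Im_exp algebra_simps)

text \<open>
  The exponent has real part \<open>- R\<close> times \<open>cos\<^sup>2 \<alpha> cosh x + sin\<^sup>2 \<alpha> sinh x \<ge> sinh x\<close>, a lower bound independent
  of \<open>\<alpha>\<close> that survives the limit \<open>\<alpha> \<rightarrow> \<pi> / 2\<close>.
\<close>

lemma norm_ray_tail_le:
  assumes "R \<ge> 0" "x \<ge> 0"
  shows "norm (ray_tail n R \<alpha> x) \<le> exp (- (R * sinh x) + \<bar>of_int n\<bar> * \<bar>x\<bar>)"
proof -
  have "sinh x \<le> (cos \<alpha>)\<^sup>2 * cosh x + (sin \<alpha>)\<^sup>2 * sinh x"
  proof -
    have "sinh x = (cos \<alpha>)\<^sup>2 * sinh x + (sin \<alpha>)\<^sup>2 * sinh x"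
      by (simp flip: distrib_right)
    also have "\<dots> \<le> (cos \<alpha>)\<^sup>2 * cosh x + (sin \<alpha>)\<^sup>2 * sinh x"
      by (intro add_mono mult_left_mono) (auto simp: sinh_le_cosh_real)
    finally show ?thesis .
  qed
  then have "R * sinh x \<le> R * (cos \<alpha> * cos \<alpha> * cosh x + sin \<alpha> * sin \<alpha> * sinh x)"
    using assms by (intro mult_left_mono) (auto simp: power2_eq_square)
  then have "norm (exp (- (of_real R * exp (- \<i> * of_real \<alpha>) * cosh (of_real x + \<i> * of_real \<alpha>)))) \<le> exp (- (R * sinh x))"
    unfolding norm_exp_eq_Re uminus_complex.sel Re_rotated_cosh by simp
  then have "norm (ray_tail n R \<alpha> x) \<le> exp (- (R * sinh x)) * exp (\<bar>of_int n\<bar> * \<bar>x\<bar>)"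
    unfolding ray_tail_def norm_mult by (intro mult_mono norm_cosh_int_le) auto
  then show ?thesis unfolding exp_add .
qed

lemma ray_tail_continuous: "continuous_on A (ray_tail n R \<alpha>)"
  unfolding ray_tail_def cosh_field_def by (intro continuous_intros) auto

text \<open>
  Folding the line at \<open>0\<close> replaces \<open>exp (- n x)\<close> by \<open>2 cosh (n x)\<close> on a half line. Shifting this half line
  by \<open>\<i> \<alpha>\<close> leaves a vertical segment, an oscillatory integral of the type bounded above, and a tail that
  decays uniformly in \<open>\<alpha>\<close>.
\<close>

lemma macdonald_int_rotated:
  assumes R: "R > 0" and a: "0 \<le> \<alpha>" "\<alpha> < pi / 2"
  shows "macdonald_int (of_int n) (of_real (ln R) - \<i> * of_real \<alpha>) =
    2 * (\<i> * integral {0..\<alpha>} (\<lambda>\<tau>. exp (- (of_real R * exp (- \<i> * of_real \<alpha>) * of_real (cos \<tau>))) * of_real (cos (of_int n * \<tau>)))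
      + (LINT x:{0..}|lborel. ray_tail n R \<alpha> x))"
proof -
  define X where "X = of_real R * exp (- \<i> * complex_of_real \<alpha>)"
  define l where "l = complex_of_real (ln R) - \<i> * of_real \<alpha>"
  have X: "exp l = X" using R by (simp add: l_def X_def exp_diff exp_minus exp_of_real field_simps)
  have cosa: "cos \<alpha> > 0" using a by (intro cos_gt_zero_pi) auto
  have ReX: "Re X = R * cos \<alpha>" by (simp add: X_def Re_exp)
  have ReX0: "Re (exp l) > 0" using R cosa by (simp add: X ReX)
  define f where "f = (\<lambda>w. exp (- (X * cosh w)) * cosh (of_int n * w))"
  have hol: "f holomorphic_on UNIV" unfolding f_def cosh_field_def by (intro holomorphic_intros) auto
  have "macdonald_int (of_int n) l = (LINT x:{0..}|lborel. macdonald_kernel (of_int n) l x + macdonald_kernel (of_int n) l (- x))"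
    unfolding macdonald_int_def by (rule integral_split_halves[OF macdonald_kernel_integrable[OF ReX0]])
  also have "\<dots> = (LINT x:{0..}|lborel. 2 * f (of_real x))"
  proof (rule set_lebesgue_integral_cong)
    show "\<forall>x. x \<in> {0..} \<longrightarrow> macdonald_kernel (of_int n) l x + macdonald_kernel (of_int n) l (- x) = 2 * f (of_real x)"
    proof (intro allI impI)
      fix x :: real
      have c: "cosh (complex_of_real x) = of_real (cosh x)" by (simp add: cosh_field_def flip: exp_of_real)
      have "macdonald_kernel (of_int n) l x = exp (- (X * cosh (of_real x))) * exp (- (of_int n * of_real x))"
        "macdonald_kernel (of_int n) l (- x) = exp (- (X * cosh (of_real x))) * exp (of_int n * of_real x)"
        unfolding macdonald_kernel_def X c exp_add[symmetric] by simp_all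
      then show "macdonald_kernel (of_int n) l x + macdonald_kernel (of_int n) l (- x) = 2 * f (of_real x)"
        unfolding f_def cosh_field_def[of "of_int n * _"] by (simp add: algebra_simps)
    qed
  qed auto
  also have "\<dots> = 2 * (LINT x:{0..}|lborel. f (of_real x))" by simp
  also have "(LINT x:{0..}|lborel. f (of_real x)) =
     \<i> * integral {0..\<alpha>} (\<lambda>\<tau>. f (\<i> * of_real \<tau>)) + (LINT x:{0..}|lborel. f (of_real x + \<i> * of_real \<alpha>))"
  proof (rule half_line_integral_shift[OF hol a(1)])
    fix x \<tau> :: real assume x: "0 \<le> x" and t: "0 \<le> \<tau>" "\<tau> \<le> \<alpha>"
    have ct: "cos \<tau> \<ge> cos \<alpha>" using a t pi_gt_zero by (intro cos_monotone_0_pi_le) auto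
    have "R * cos \<alpha> * cos \<alpha> * cosh x \<le> R * (cos \<alpha> * cos \<tau> * cosh x + sin \<alpha> * sin \<tau> * sinh x)"
    proof -
      have "0 \<le> sin \<alpha> * sin \<tau> * sinh x"
        using a t x pi_gt_zero by (intro mult_nonneg_nonneg sin_ge_zero) auto
      moreover have "cos \<alpha> * cos \<alpha> * cosh x \<le> cos \<alpha> * cos \<tau> * cosh x"
        using ct cosa by (intro mult_right_mono mult_left_mono) auto
      ultimately have "R * (cos \<alpha> * cos \<alpha> * cosh x) \<le> R * (cos \<alpha> * cos \<tau> * cosh x + sin \<alpha> * sin \<tau> * sinh x)"
        using R by (intro mult_left_mono) linarith+
      then show ?thesis by (simp only: mult.assoc)
    qed
    then have "norm (exp (- (X * cosh (of_real x + \<i> * of_real \<tau>)))) \<le> exp (- (R * cos \<alpha> * cos \<alpha> * cosh x))"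
      unfolding X_def norm_exp_eq_Re uminus_complex.sel Re_rotated_cosh by simp
    then have "norm (f (of_real x + \<i> * of_real \<tau>)) \<le> exp (- (R * cos \<alpha> * cos \<alpha> * cosh x)) * exp (\<bar>of_int n\<bar> * \<bar>x\<bar>)"
      unfolding f_def norm_mult by (intro mult_mono norm_cosh_int_le) auto
    also have "\<dots> = exp (- (R * cos \<alpha> * cos \<alpha> * cosh x) + \<bar>of_int n\<bar> * \<bar>x\<bar>)" by (rule exp_add[symmetric])
    also have "\<dots> \<le> exp ((\<bar>of_int n\<bar> + 1)\<^sup>2 / (R * cos \<alpha> * cos \<alpha>)) * exp (- \<bar>x\<bar>)"
      using R cosa by (intro exp_neg_cosh_bound) auto
    finally show "norm (f (of_real x + \<i> * of_real \<tau>)) \<le> exp ((\<bar>of_int n\<bar> + 1)\<^sup>2 / (R * cos \<alpha> * cos \<alpha>)) * exp (- x)"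
      using x by simp
  qed
  also have "(\<lambda>\<tau>. f (\<i> * of_real \<tau>)) = (\<lambda>\<tau>. exp (- (X * of_real (cos \<tau>))) * of_real (cos (of_int n * \<tau>)))"
  proof
    fix \<tau> :: real
    have "cosh (\<i> * complex_of_real t) = of_real (cos t)" for t
      by (simp add: cosh_conv_cos cos_of_real)
    from this[of \<tau>] this[of "of_int n * \<tau>"]
    show "f (\<i> * of_real \<tau>) = exp (- (X * of_real (cos \<tau>))) * of_real (cos (of_int n * \<tau>))"
      unfolding f_def by (simp add: mult.left_commute)
  qed
  also have "(\<lambda>x. f (of_real x + \<i> * of_real \<alpha>)) = ray_tail n R \<alpha>"
    by (rule ext) (simp add: f_def ray_tail_def X_def)
  finally show ?thesis unfolding l_def X_def .
qed

lemma sinh_ge_self: "x \<ge> 0 \<Longrightarrow> x \<le> sinh (x::real)"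
proof -
  assume x: "x \<ge> 0"
  have "sinh 0 - 0 \<le> sinh x - x"
  proof (rule DERIV_nonneg_imp_nondecreasing[OF x])
    fix u :: real
    have "((\<lambda>x. sinh x - x) has_real_derivative cosh u - 1) (at u)"
      by (auto intro!: derivative_eq_intros)
    then show "\<exists>D. ((\<lambda>x. sinh x - x) has_real_derivative D) (at u) \<and> 0 \<le> D"
      using cosh_real_ge_1[of u] by force
  qed
  then show ?thesis by simp
qed

text \<open>
  One half of \<open>R sinh x\<close> yields the decay \<open>exp (- R x / 2)\<close>, the other half absorbs \<open>exp (m \<bar>x\<bar>)\<close>. The constant
  depends on \<open>R0\<close> only, so that integration over \<open>x\<close> gains a factor \<open>1 / R\<close>.
\<close>

lemma exp_neg_sinh_bound:
  fixes R R0 m x :: real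
  assumes "0 < R0" "R0 \<le> R" "0 \<le> x" "0 \<le> m"
  shows "exp (- (R * sinh x) + m * \<bar>x\<bar>) \<le> exp (R0 / 2 + (m + 1)\<^sup>2 / (R0 / 2)) * exp (- (R / 2 * \<bar>x\<bar>))"
proof -
  have s: "cosh x - 1 \<le> sinh x"
  proof -
    have "cosh x - sinh x = exp (- x)" by (simp add: cosh_field_def sinh_field_def flip: diff_divide_distrib)
    moreover have "exp (- x) \<le> 1" using assms by simp
    ultimately show ?thesis by linarith
  qed
  have "R / 2 * sinh x \<ge> R / 2 * x" using sinh_ge_self[of x] assms by (intro mult_left_mono) auto
  moreover have "R / 2 * sinh x \<ge> R0 / 2 * sinh x" using assms by (intro mult_right_mono) auto
  moreover have "R0 / 2 * sinh x \<ge> R0 / 2 * (cosh x - 1)" using s assms by (intro mult_left_mono) auto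
  moreover have "R0 / 2 * (cosh x - 1) = R0 / 2 * cosh x - R0 / 2" by (simp add: right_diff_distrib)
  moreover have "R * sinh x = R / 2 * sinh x + R / 2 * sinh x" by simp
  ultimately have "- (R * sinh x) + m * \<bar>x\<bar> \<le> (- (R0 / 2 * cosh x) + m * \<bar>x\<bar>) + (R0 / 2 - R / 2 * x)" by linarith
  then have "exp (- (R * sinh x) + m * \<bar>x\<bar>) \<le> exp (- (R0 / 2 * cosh x) + m * \<bar>x\<bar>) * exp (R0 / 2 - R / 2 * x)"
    unfolding exp_add[symmetric] by simp
  also have "\<dots> \<le> (exp ((m + 1)\<^sup>2 / (R0 / 2)) * 1) * exp (R0 / 2 - R / 2 * x)"
  proof (intro mult_right_mono)
    have "exp (- (R0 / 2 * cosh x) + m * \<bar>x\<bar>) \<le> exp ((m + 1)\<^sup>2 / (R0 / 2)) * exp (- \<bar>x\<bar>)"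
      using assms by (intro exp_neg_cosh_bound) auto
    also have "\<dots> \<le> exp ((m + 1)\<^sup>2 / (R0 / 2)) * 1" by (intro mult_left_mono) auto
    finally show "exp (- (R0 / 2 * cosh x) + m * \<bar>x\<bar>) \<le> exp ((m + 1)\<^sup>2 / (R0 / 2)) * 1" .
  qed auto
  also have "\<dots> = exp (R0 / 2 + (m + 1)\<^sup>2 / (R0 / 2)) * exp (- (R / 2 * \<bar>x\<bar>))"
    using assms(3) unfolding mult_1_right exp_add[symmetric] by (intro arg_cong[where f = exp]) simp
  finally show ?thesis .
qed

lemma integral_exp_neg_abs:
  assumes "a > 0"
  shows "(\<integral>t. exp (- (a * \<bar>t\<bar>)) \<partial>lborel) = (1 / a) * (\<integral>t. exp (- \<bar>t::real\<bar>) \<partial>lborel)"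
proof -
  have "(\<integral>t. exp (- \<bar>t::real\<bar>) \<partial>lborel) = \<bar>a\<bar> *\<^sub>R (\<integral>t. exp (- \<bar>0 + a * t\<bar>) \<partial>lborel)"
    using assms by (intro lborel_integral_real_affine) auto
  also have "(\<lambda>t. exp (- \<bar>0 + a * t\<bar>)) = (\<lambda>t. exp (- (a * \<bar>t\<bar>)))" using assms by (simp add: abs_mult)
  finally show ?thesis using assms by simp
qed

lemma ray_tail_integral_bound:
  assumes "R0 > 0"
  obtains C where "C \<ge> 0" "\<And>R \<alpha>. R0 \<le> R \<Longrightarrow> norm (LINT x:{0..}|lborel. ray_tail n R \<alpha> x) \<le> C / R"
proof -
  define M where "M = exp (R0 / 2 + (\<bar>of_int n\<bar> + 1)\<^sup>2 / (R0 / 2))"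
  define I where "I = (\<integral>t. exp (- \<bar>t::real\<bar>) \<partial>lborel)"
  have I: "I \<ge> 0" unfolding I_def by (rule Bochner_Integration.integral_nonneg) auto
  show ?thesis
  proof (rule that[of "2 * M * I"])
    show "2 * M * I \<ge> 0" using I by (simp add: M_def)
    fix R \<alpha> assume R: "R0 \<le> R"
    have "norm (LINT x:{0..}|lborel. ray_tail n R \<alpha> x) \<le> (\<integral>x. M * exp (- (R / 2 * \<bar>x\<bar>)) \<partial>lborel)"
      unfolding set_lebesgue_integral_def
    proof (rule Bochner_Integration.integral_norm_bound_integral)
      have le: "norm (indicator {0..} x *\<^sub>R ray_tail n R \<alpha> x) \<le> M * exp (- (R / 2 * \<bar>x\<bar>))" for x
        using order_trans[OF norm_ray_tail_le[of R x n \<alpha>] exp_neg_sinh_bound[of R0 R x "\<bar>of_int n\<bar>"]] R assms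
        by (auto simp: indicator_def M_def)
      show i: "integrable lborel (\<lambda>x. M * exp (- (R / 2 * \<bar>x\<bar>)))"
        using assms R by (intro integrable_mult_right integrable_exp_neg_abs) auto
      show "integrable lborel (\<lambda>x. indicator {0..} x *\<^sub>R ray_tail n R \<alpha> x)"
      proof (rule Bochner_Integration.integrable_bound[OF i])
        show "(\<lambda>x. indicator {0..} x *\<^sub>R ray_tail n R \<alpha> x) \<in> borel_measurable lborel"
          using borel_measurable_continuous_onI[OF ray_tail_continuous[of UNIV n R \<alpha>]] by simp
      qed (use order_trans[OF le abs_ge_self] in auto)
      show "norm (indicator {0..} x *\<^sub>R ray_tail n R \<alpha> x) \<le> M * exp (- (R / 2 * \<bar>x\<bar>))" for x by (rule le)
    qed
    also have "\<dots> = M * ((1 / (R / 2)) * I)"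
      using integral_exp_neg_abs[of "R / 2"] R assms by (simp add: I_def)
    finally show "norm (LINT x:{0..}|lborel. ray_tail n R \<alpha> x) \<le> 2 * M * I / R" by (simp add: mult_ac)
  qed
qed

text \<open>
  Uniformity in \<open>\<alpha> < \<pi> / 2\<close> is the point: the exponential decay of the Macdonald function degenerates
  at the imaginary axis, while \<open>R\<^sup>-\<^sup>1\<^sup>/\<^sup>2\<close> persists.
\<close>

lemma macdonald_int_rotated_bound:
  assumes "R0 > 0"
  obtains C where "C \<ge> 0" "\<And>R \<alpha>. R0 \<le> R \<Longrightarrow> 0 \<le> \<alpha> \<Longrightarrow> \<alpha> < pi / 2 \<Longrightarrow>
     norm (macdonald_int (of_int n) (of_real (ln R) - \<i> * of_real \<alpha>)) \<le> C / sqrt R"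
proof -
  obtain C where C: "C \<ge> 0" "\<And>R \<alpha>. R0 \<le> R \<Longrightarrow> norm (LINT x:{0..}|lborel. ray_tail n R \<alpha> x) \<le> C / R"
    using ray_tail_integral_bound[OF assms, of n] by blast
  show ?thesis
  proof (rule that[of "2 * (7 * (1 + \<bar>of_int n\<bar>) + C / sqrt R0)"])
    show "0 \<le> 2 * (7 * (1 + \<bar>of_int n\<bar>) + C / sqrt R0)" using C assms by simp
    fix R \<alpha> :: real assume R: "R0 \<le> R" and a: "0 \<le> \<alpha>" "\<alpha> < pi / 2"
    define X where "X = of_real R * exp (- \<i> * complex_of_real \<alpha>)"
    have X: "Re X \<ge> 0" "X \<noteq> 0" "norm X = R"
      using R assms a by (auto simp: X_def Re_exp norm_mult intro!: mult_nonneg_nonneg cos_ge_zero)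
    have "C / R = C / sqrt R / sqrt R" using R assms by simp
    also have "\<dots> \<le> C / sqrt R0 / sqrt R"
      using R assms C by (intro divide_right_mono divide_left_mono) auto
    finally have CR: "C / R \<le> C / sqrt R0 / sqrt R" .
    have "norm (macdonald_int (of_int n) (of_real (ln R) - \<i> * of_real \<alpha>)) \<le>
      2 * (norm (integral {0..\<alpha>} (\<lambda>\<tau>. exp (- (X * of_real (cos \<tau>))) * of_real (cos (of_int n * \<tau>)))) + norm (LINT x:{0..}|lborel. ray_tail n R \<alpha> x))"
      using R assms a norm_triangle_ineq unfolding X_def
      by (subst macdonald_int_rotated) (auto simp: norm_mult intro!: order_trans[OF norm_triangle_ineq])
    also have "\<dots> \<le> 2 * (7 * (1 + \<bar>of_int n\<bar>) / sqrt R + C / sqrt R0 / sqrt R)"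
      using oscillatory_bound[of \<alpha> X "of_int n"] X a C(2)[OF R, of \<alpha>] CR by (intro mult_left_mono add_mono) auto
    also have "\<dots> = 2 * (7 * (1 + \<bar>of_int n\<bar>) + C / sqrt R0) / sqrt R" by (simp add: add_divide_distrib)
    finally show "norm (macdonald_int (of_int n) (of_real (ln R) - \<i> * of_real \<alpha>)) \<le> 2 * (7 * (1 + \<bar>of_int n\<bar>) + C / sqrt R0) / sqrt R" .
  qed
qed

section \<open>The jump of the Macdonald function across the imaginary axis\<close>

text \<open>
  An explicit sequence in \<open>[0, \<pi> / 2)\<close> tending to \<open>\<pi> / 2\<close>, for use with dominated convergence.
\<close>

definition angle_seq :: "nat \<Rightarrow> real" where
  "angle_seq k = pi / 2 * (1 - 1 / (real k + 1))"

lemma angle_seq: "0 \<le> angle_seq k" "angle_seq k < pi / 2" "angle_seq \<longlonglongrightarrow> pi / 2"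
proof -
  show "0 \<le> angle_seq k" unfolding angle_seq_def by (intro mult_nonneg_nonneg) auto
  have "pi / 2 * (1 - 1 / (real k + 1)) < pi / 2 * 1" by (intro mult_strict_left_mono) auto
  then show "angle_seq k < pi / 2" unfolding angle_seq_def by simp
  have "(\<lambda>k. pi / 2 * (1 - 1 / (real k + 1))) \<longlonglongrightarrow> pi / 2 * (1 - 0)"
    by (intro tendsto_intros) real_asymp
  then show "angle_seq \<longlonglongrightarrow> pi / 2" by (simp add: angle_seq_def[abs_def])
qed

text \<open>
  Bessel's integral for \<open>(-1)\<^sup>p \<pi> J_2p (R)\<close>.
\<close>

definition bessel_angle :: "int \<Rightarrow> real \<Rightarrow> real" where
  "bessel_angle p R = (LINT \<tau>:{0..pi}|lborel. cos (R * cos \<tau>) * cos (2 * of_int p * \<tau>))"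

lemma lebesgue_eq_HK_interval:
  fixes f :: "real \<Rightarrow> 'a::euclidean_space"
  assumes "continuous_on {a..b} f"
  shows "set_integrable lborel {a..b} f" "(LINT x:{a..b}|lborel. f x) = integral {a..b} f"
  using borel_integrable_atLeastAtMost'[OF assms] set_borel_integral_eq_integral(2) by auto

text \<open>
  The reflection \<open>\<tau> \<mapsto> \<pi> - \<tau>\<close> reduces the integral to \<open>[0, \<pi> / 2]\<close>, where it is the real part of an
  oscillatory integral with \<open>X = - \<i> R\<close>.
\<close>

lemma bessel_angle_half:
  "bessel_angle p R = 2 * Re (integral {0..pi/2} (\<lambda>\<tau>. exp (- (- \<i> * of_real R * of_real (cos \<tau>))) * of_real (cos (of_int (2 * p) * \<tau>))))"
proof -
  define h where "h = (\<lambda>\<tau>. cos (R * cos \<tau>) * cos (2 * of_int p * \<tau>))"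
  have cont: "continuous_on A h" for A unfolding h_def by (intro continuous_intros)
  have refl: "h (pi - \<tau>) = h \<tau>" for \<tau>
  proof -
    have "cos (2 * of_int p * (pi - \<tau>)) = cos (of_int p * (2 * pi) - 2 * of_int p * \<tau>)"
      by (simp add: algebra_simps)
    also have "\<dots> = cos (2 * of_int p * \<tau>)"
      by (simp add: cos_diff mult.commute[of _ "2 * pi"])
    finally show ?thesis unfolding h_def by simp
  qed
  have "integral {0..pi} h = integral {0..pi/2} h + integral {pi/2..pi} h"
    using cont by (intro Henstock_Kurzweil_Integration.integral_combine[symmetric] integrable_continuous_real) auto
  also have "integral {pi/2..pi} h = (LINT \<tau>:{pi/2..pi}|lborel. h \<tau>)"
    by (rule lebesgue_eq_HK_interval(2)[OF cont, symmetric])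
  also have "\<dots> = (\<integral>\<tau>. indicator {pi/2..pi} (pi + (-1) * \<tau>) *\<^sub>R h (pi + (-1) * \<tau>) \<partial>lborel)"
    unfolding set_lebesgue_integral_def by (subst lborel_integral_real_affine[where c = "-1" and t = pi]) auto
  also have "\<dots> = (LINT \<tau>:{0..pi/2}|lborel. h \<tau>)"
    unfolding set_lebesgue_integral_def
    by (intro Bochner_Integration.integral_cong) (auto simp: indicator_def refl)
  also have "\<dots> = integral {0..pi/2} h"
    by (rule lebesgue_eq_HK_interval(2)[OF cont])
  finally have "bessel_angle p R = 2 * integral {0..pi/2} h"
    using lebesgue_eq_HK_interval(2)[OF cont, of 0 pi] by (simp add: bessel_angle_def h_def)
  also have "h = Re \<circ> (\<lambda>\<tau>. exp (- (- \<i> * of_real R * of_real (cos \<tau>))) * of_real (cos (of_int (2 * p) * \<tau>)))"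
    by (rule ext) (simp add: h_def Re_exp)
  also have "integral {0..pi/2} \<dots> = Re (integral {0..pi/2} (\<lambda>\<tau>. exp (- (- \<i> * of_real R * of_real (cos \<tau>))) * of_real (cos (of_int (2 * p) * \<tau>))))"
    by (intro integral_linear integrable_continuous_real bounded_linear_Re continuous_intros)
  finally show ?thesis .
qed

lemma bessel_angle_bound:
  assumes "R > 0"
  shows "\<bar>bessel_angle p R\<bar> \<le> 14 * (1 + 2 * \<bar>of_int p\<bar>) / sqrt R"
proof -
  have "\<bar>bessel_angle p R\<bar> \<le> 2 * norm (integral {0..pi/2} (\<lambda>\<tau>. exp (- (- \<i> * of_real R * of_real (cos \<tau>))) * of_real (cos (of_int (2 * p) * \<tau>))))"
    unfolding bessel_angle_half abs_mult by (simp add: abs_Re_le_cmod)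
  also have "\<dots> \<le> 2 * (7 * (1 + \<bar>of_int (2 * p)\<bar>) / sqrt (norm (- \<i> * of_real R :: complex)))"
    using assms by (intro mult_left_mono oscillatory_bound) auto
  finally show ?thesis using assms by (simp add: norm_mult abs_mult)
qed

text \<open>
  The classical relation \<open>K_2p (- \<i> R) - K_2p (\<i> R) = (-1)\<^sup>p \<pi> \<i> J_2p (R)\<close>. The two values are complex conjugates, so the
  jump is \<open>2 \<i>\<close> times an imaginary part. In the rotated representation the tail becomes real at
  \<open>\<alpha> = \<pi> / 2\<close>, because the order is even, and only the oscillatory segment is left.
\<close>

lemma macdonald_int_jump:
  assumes R: "R > 0"
  shows "(\<lambda>k. macdonald_int (of_int (2 * p)) (of_real (ln R) - \<i> * of_real (angle_seq k))
      - macdonald_int (of_int (2 * p)) (of_real (ln R) + \<i> * of_real (angle_seq k))) \<longlonglongrightarrow> 2 * \<i> * of_real (bessel_angle p R)"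
proof -
  let ?n = "2 * p"
  let ?X = "\<lambda>\<alpha>. of_real R * exp (- \<i> * complex_of_real \<alpha>)"
  let ?g = "\<lambda>\<alpha> \<tau>. exp (- (?X \<alpha> * of_real (cos \<tau>))) * complex_of_real (cos (of_int ?n * \<tau>))"
  have Xlim: "?X (pi / 2) = - \<i> * of_real R"
    by (simp add: complex_eq_iff Re_exp Im_exp)
  have gcont: "continuous_on A (?g \<alpha>)" for A \<alpha> by (intro continuous_intros)
  \<comment> \<open>the upper limit and the integrand converge together\<close>
  have p1: "(\<lambda>k. integral {0..angle_seq k} (?g (angle_seq k))) \<longlonglongrightarrow> integral {0..pi/2} (?g (pi / 2))"
    unfolding lebesgue_eq_HK_interval(2)[OF gcont, symmetric] set_lebesgue_integral_def
  proof (rule integral_dominated_convergence[where w = "\<lambda>\<tau>. indicator {0..pi/2} \<tau> *\<^sub>R (1::real)"])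
    show "integrable lborel (\<lambda>\<tau>. indicator {0..pi/2} \<tau> *\<^sub>R (1::real))"
      using borel_integrable_atLeastAtMost'[of 0 "pi/2" "\<lambda>_. 1::real"] by (simp add: set_integrable_def)
    show "AE \<tau> in lborel. (\<lambda>k. indicator {0..angle_seq k} \<tau> *\<^sub>R ?g (angle_seq k) \<tau>) \<longlonglongrightarrow> indicator {0..pi/2} \<tau> *\<^sub>R ?g (pi / 2) \<tau>"
      using AE_lborel_singleton[of "pi / 2"]
    proof eventually_elim
      case (elim \<tau>)
      have "(\<lambda>k. indicator {0..pi/2} \<tau> *\<^sub>R ?g (angle_seq k) \<tau>) \<longlonglongrightarrow> indicator {0..pi/2} \<tau> *\<^sub>R ?g (pi / 2) \<tau>"
        by (intro tendsto_intros angle_seq)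
      moreover have "\<forall>\<^sub>F k in sequentially. indicator {0..pi/2} \<tau> *\<^sub>R ?g (angle_seq k) \<tau> = indicator {0..angle_seq k} \<tau> *\<^sub>R ?g (angle_seq k) \<tau>"
      proof (cases "\<tau> < pi / 2")
        case True
        have "\<forall>\<^sub>F k in sequentially. \<tau> < angle_seq k" using order_tendstoD(1)[OF angle_seq(3) True] .
        then show ?thesis by eventually_elim (use True in \<open>auto simp: indicator_def\<close>)
      next
        case False
        have "indicator {0..pi/2} \<tau> = (0::real)" "indicator {0..angle_seq k} \<tau> = (0::real)" for k
          using False elim angle_seq(2)[of k] by (auto simp: indicator_def)
        then show ?thesis by simp
      qed
      ultimately show ?case by (rule Lim_transform_eventually)
    qed
    show "AE \<tau> in lborel. norm (indicator {0..angle_seq k} \<tau> *\<^sub>R ?g (angle_seq k) \<tau>) \<le> indicator {0..pi/2} \<tau> *\<^sub>R 1" for k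
    proof (rule AE_I2)
      fix \<tau> :: real
      show "norm (indicator {0..angle_seq k} \<tau> *\<^sub>R ?g (angle_seq k) \<tau>) \<le> indicator {0..pi/2} \<tau> *\<^sub>R 1"
      proof (cases "\<tau> \<in> {0..angle_seq k}")
        case True
        then have "0 \<le> \<tau>" "\<tau> \<le> pi / 2" using angle_seq(2)[of k] by auto
        moreover have "0 \<le> R * cos (angle_seq k) * cos \<tau>"
          using R True angle_seq(1,2)[of k] by (intro mult_nonneg_nonneg cos_ge_zero) auto
        then have "norm (exp (- (?X (angle_seq k) * of_real (cos \<tau>)))) \<le> 1"
          by (simp add: Re_exp)
        then have "norm (?g (angle_seq k) \<tau>) \<le> 1 * 1"
          unfolding norm_mult by (intro mult_mono) (auto simp del: norm_exp_eq_Re)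
        ultimately show ?thesis using True by (simp add: indicator_def)
      next
        case False
        then have "indicator {0..angle_seq k} \<tau> = (0::real)" by (auto simp: indicator_def)
        then show ?thesis by (simp only: scaleR_zero_left norm_zero) simp
      qed
    qed
  qed (auto intro!: borel_measurable_scaleR borel_measurable_continuous_onI gcont)
  have tailm: "(\<lambda>x. indicator {0..} x *\<^sub>R ray_tail ?n R \<alpha> x) \<in> borel_measurable lborel" for \<alpha>
    using borel_measurable_continuous_onI[OF ray_tail_continuous[of UNIV ?n R \<alpha>]] by simp
  \<comment> \<open>a majorant of the tail that is independent of the angle\<close>
  define w where "w = (\<lambda>x. exp (R / 2 + (\<bar>of_int ?n\<bar> + 1)\<^sup>2 / (R / 2)) * exp (- (R / 2 * \<bar>x\<bar>)))"
  have wi: "integrable lborel w"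
    unfolding w_def using R by (intro integrable_mult_right integrable_exp_neg_abs) auto
  have wle: "norm (indicator {0..} x *\<^sub>R ray_tail ?n R \<alpha> x) \<le> w x" for x \<alpha>
    using order_trans[OF norm_ray_tail_le[of R x ?n \<alpha>] exp_neg_sinh_bound[of R R x "\<bar>of_int ?n\<bar>"]] R
    by (auto simp: indicator_def w_def)
  have p2: "(\<lambda>k. LINT x:{0..}|lborel. ray_tail ?n R (angle_seq k) x) \<longlonglongrightarrow> (LINT x:{0..}|lborel. ray_tail ?n R (pi / 2) x)"
    unfolding set_lebesgue_integral_def
  proof (rule integral_dominated_convergence[OF tailm tailm wi])
    have "(\<lambda>k. indicator {0..} x *\<^sub>R ray_tail ?n R (angle_seq k) x) \<longlonglongrightarrow> indicator {0..} x *\<^sub>R ray_tail ?n R (pi / 2) x" for x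
      unfolding ray_tail_def cosh_field_def by (intro tendsto_intros angle_seq) auto
    then show "AE x in lborel. (\<lambda>k. indicator {0..} x *\<^sub>R ray_tail ?n R (angle_seq k) x) \<longlonglongrightarrow> indicator {0..} x *\<^sub>R ray_tail ?n R (pi / 2) x" by simp
  qed (use wle in auto)
  have "(\<lambda>k. macdonald_int (of_int ?n) (of_real (ln R) - \<i> * of_real (angle_seq k))) \<longlonglongrightarrow>
     2 * (\<i> * integral {0..pi/2} (?g (pi / 2)) + (LINT x:{0..}|lborel. ray_tail ?n R (pi / 2) x))"
    unfolding macdonald_int_rotated[OF R angle_seq(1,2)] by (intro tendsto_intros p1 p2)
  from tendsto_Im[OF this]
  have imlim: "(\<lambda>k. Im (macdonald_int (of_int ?n) (of_real (ln R) - \<i> * of_real (angle_seq k)))) \<longlonglongrightarrow>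
     2 * Re (integral {0..pi/2} (?g (pi / 2))) + 2 * Im (LINT x:{0..}|lborel. ray_tail ?n R (pi / 2) x)"
    by simp
  have "Im (LINT x:{0..}|lborel. ray_tail ?n R (pi / 2) x) = 0"
  proof -
    have "Im (ray_tail ?n R (pi / 2) x) = 0" for x
    proof -
      have a: "exp (- \<i> * of_real (pi / 2)) * cosh (of_real x + \<i> * of_real (pi / 2)) = complex_of_real (sinh x)"
        unfolding cosh_Complex by (simp add: complex_eq_iff Re_exp Im_exp)
      have "of_int ?n * (complex_of_real x + \<i> * of_real (pi / 2)) = of_real (of_int ?n * x) + \<i> * of_real (pi * of_int p)"
        by (simp add: algebra_simps)
      then have b: "Im (cosh (of_int ?n * (complex_of_real x + \<i> * of_real (pi / 2)))) = 0"
        by (simp only: cosh_Complex) simp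
      have c: "- (of_real R * exp (- \<i> * of_real (pi / 2)) * cosh (of_real x + \<i> * of_real (pi / 2))) = complex_of_real (- (R * sinh x))"
        unfolding mult.assoc a by simp
      show ?thesis unfolding ray_tail_def c exp_of_real using b by simp
    qed
    moreover have "integrable lborel (\<lambda>x. indicator {0..} x *\<^sub>R ray_tail ?n R (pi / 2) x)"
      by (rule Bochner_Integration.integrable_bound[OF wi tailm]) (use order_trans[OF wle abs_ge_self] in auto)
    ultimately show ?thesis
      unfolding set_lebesgue_integral_def by (subst integral_Im[symmetric]) auto
  qed
  with imlim have "(\<lambda>k. Im (macdonald_int (of_int ?n) (of_real (ln R) - \<i> * of_real (angle_seq k)))) \<longlonglongrightarrow> bessel_angle p R"
    unfolding bessel_angle_half Xlim by simp
  then have "(\<lambda>k. 2 * \<i> * complex_of_real (Im (macdonald_int (of_int ?n) (of_real (ln R) - \<i> * of_real (angle_seq k))))) \<longlonglongrightarrow> 2 * \<i> * of_real (bessel_angle p R)"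
    by (intro tendsto_intros)
  moreover have "macdonald_int (of_int ?n) (of_real (ln R) - \<i> * of_real a) - macdonald_int (of_int ?n) (of_real (ln R) + \<i> * of_real a)
     = 2 * \<i> * complex_of_real (Im (macdonald_int (of_int ?n) (of_real (ln R) - \<i> * of_real a)))" for a
  proof -
    have "macdonald_int (of_int ?n) (of_real (ln R) + \<i> * of_real a) = cnj (macdonald_int (of_int ?n) (of_real (ln R) - \<i> * of_real a))"
      using macdonald_int_cnj[of "of_int ?n" "of_real (ln R) - \<i> * of_real a"] by simp
    then show ?thesis by (simp add: complex_eq_iff)
  qed
  ultimately show ?thesis by simp
qed

text \<open>
  One half of \<open>Re X cosh t\<close>, for \<open>X = exp l\<close>, is at least \<open>Re X / 2\<close> and gives the decay; the other half
  keeps the integral bounded.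
\<close>

lemma macdonald_int_decay:
  assumes "c > 0"
  obtains C where "C \<ge> 0" "\<And>l. c \<le> Re (exp l) \<Longrightarrow> norm (macdonald_int \<mu> l) \<le> C * exp (- Re (exp l) / 2)"
proof -
  define D where "D = exp ((\<bar>Re \<mu>\<bar> + 1)\<^sup>2 / (c / 2))"
  define I where "I = (\<integral>t. exp (- (1 * \<bar>t::real\<bar>)) \<partial>lborel)"
  have I: "I \<ge> 0" unfolding I_def by (rule Bochner_Integration.integral_nonneg) auto
  show ?thesis
  proof (rule that[of "D * I"])
    show "D * I \<ge> 0" using I by (simp add: D_def)
    fix l assume l: "c \<le> Re (exp l)"
    have le: "norm (macdonald_kernel \<mu> l t) \<le> exp (- Re (exp l) / 2) * D * exp (- (1 * \<bar>t\<bar>))" for t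
    proof -
      have "Re (exp l) / 2 * 1 \<le> Re (exp l) / 2 * cosh t" "c / 2 * cosh t \<le> Re (exp l) / 2 * cosh t"
        using l assms cosh_real_ge_1[of t] by (intro mult_left_mono mult_right_mono; simp del: Re_exp)+
      moreover have "Re (exp l) * cosh t = Re (exp l) / 2 * cosh t + Re (exp l) / 2 * cosh t" by simp
      moreover have "- (Re \<mu> * t) \<le> \<bar>Re \<mu>\<bar> * \<bar>t\<bar>"
        using abs_ge_minus_self[of "Re \<mu> * t"] by (simp add: abs_mult)
      ultimately have "- (Re (exp l) * cosh t) - Re \<mu> * t \<le> - Re (exp l) / 2 + (- (c / 2 * cosh t) + \<bar>Re \<mu>\<bar> * \<bar>t\<bar>)" by linarith
      then have "norm (macdonald_kernel \<mu> l t) \<le> exp (- Re (exp l) / 2) * exp (- (c / 2 * cosh t) + \<bar>Re \<mu>\<bar> * \<bar>t\<bar>)"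
        unfolding norm_macdonald_kernel exp_add[symmetric] by simp
      also have "\<dots> \<le> exp (- Re (exp l) / 2) * (D * exp (- \<bar>t\<bar>))"
        unfolding D_def using assms by (intro mult_left_mono exp_neg_cosh_bound) auto
      finally show ?thesis by (simp add: mult.assoc)
    qed
    have "norm (macdonald_int \<mu> l) \<le> (\<integral>t. exp (- Re (exp l) / 2) * D * exp (- (1 * \<bar>t\<bar>)) \<partial>lborel)"
      unfolding macdonald_int_def
      using l assms by (intro Bochner_Integration.integral_norm_bound_integral macdonald_kernel_integrable integrable_mult_right integrable_exp_neg_abs le) auto
    also have "\<dots> = exp (- Re (exp l) / 2) * D * I" unfolding I_def by (rule Bochner_Integration.integral_mult_right_zero)
    finally show "norm (macdonald_int \<mu> l) \<le> D * I * exp (- Re (exp l) / 2)" by (simp add: mult_ac)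
  qed
qed

lemma (in pair_sigma_finite) integrable_product:
  fixes f :: "'a \<Rightarrow> real" and g :: "'b \<Rightarrow> real"
  assumes f: "integrable M1 f" and g: "integrable M2 g"
  shows "integrable (M1 \<Otimes>\<^sub>M M2) (\<lambda>x. f (fst x) * g (snd x))"
proof (rule Fubini_integrable)
  have [measurable]: "f \<in> borel_measurable M1" "g \<in> borel_measurable M2" using f g by auto
  show "(\<lambda>x. f (fst x) * g (snd x)) \<in> borel_measurable (M1 \<Otimes>\<^sub>M M2)" by measurable
  show "integrable M1 (\<lambda>x. \<integral>y. norm (f (fst (x, y)) * g (snd (x, y))) \<partial>M2)"
    using f by (simp add: abs_mult)
  show "AE x in M1. integrable M2 (\<lambda>y. f (fst (x, y)) * g (snd (x, y)))"
    using g by simp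
qed

section \<open>The product formula for Macdonald functions\<close>

text \<open>
  The same complex number as \<open>trh r \<theta>\<close>, in the form of a hyperbolic cosine to which the addition formulas
  apply. It is seen here as a function of \<open>r\<close> for a fixed argument \<open>\<theta>\<close> of \<open>z\<close>.
\<close>

definition zeta :: "real \<Rightarrow> real \<Rightarrow> complex" where
  "zeta \<theta> r = cosh (of_real r + \<i> * of_real \<theta>)"

lemma zeta_Complex: "zeta \<theta> r = Complex (cosh r * cos \<theta>) (sinh r * sin \<theta>)"
  unfolding zeta_def by (rule cosh_Complex)

lemma cnj_zeta: "cnj (zeta \<theta> r) = cosh (of_real r - \<i> * of_real \<theta>)"
  by (simp add: zeta_def cosh_field_def exp_cnj)

definition zeta_arg :: "real \<Rightarrow> real \<Rightarrow> real" where "zeta_arg \<theta> r = Arg (zeta \<theta> r)"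

lemma zeta_polar: "zeta \<theta> r = of_real (norm (zeta \<theta> r)) * exp (\<i> * of_real (zeta_arg \<theta> r))"
  unfolding zeta_arg_def by (cases "zeta \<theta> r = 0") (auto simp: Arg_eq)

context
  fixes \<theta> :: real
  assumes theta: "\<bar>\<theta>\<bar> < pi / 2"
begin

lemma cos_theta: "cos \<theta> > 0"
  using theta by (intro cos_gt_zero_pi) auto

lemma Re_zeta_pos: "Re (zeta \<theta> r) > 0"
  using cos_theta by (simp add: zeta_Complex)

lemma zeta_not_nonpos: "zeta \<theta> r \<notin> \<real>\<^sub>\<le>\<^sub>0"
  using Re_zeta_pos[of r] by (auto simp: complex_nonpos_Reals_iff)

lemma zeta_nonzero: "zeta \<theta> r \<noteq> 0"
  using Re_zeta_pos[of r] by auto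

lemma norm_zeta_ge: "norm (zeta \<theta> r) \<ge> cos \<theta> * cosh r"
  using complex_Re_le_cmod[of "zeta \<theta> r"] by (simp add: zeta_Complex mult.commute)

lemma zeta_continuous: "continuous_on A (zeta \<theta>)"
  unfolding zeta_def cosh_field_def by (intro continuous_intros) auto

lemma zeta_arg_continuous: "continuous_on A (zeta_arg \<theta>)"
  unfolding zeta_arg_def
  by (rule continuous_on_compose2[OF continuous_on_Arg zeta_continuous])
    (use zeta_not_nonpos in auto)

lemma zeta_arg_bound: "\<bar>zeta_arg \<theta> r\<bar> < pi / 2"
  unfolding zeta_arg_def using Re_zeta_pos[of r] zeta_nonzero Re_Ln_pos_lt[of "zeta \<theta> r"]
  by (simp add: Arg_eq_Im_Ln)

lemma ln_norm_continuous: "continuous_on A (\<lambda>r. ln (2 * norm (zeta \<theta> r)))"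
  using zeta_nonzero by (intro continuous_intros zeta_continuous) auto

lemma exp_shift_ln: "exp (l + complex_of_real (ln (2 * norm (zeta \<theta> r)))) = 2 * of_real (norm (zeta \<theta> r)) * exp l"
  using zeta_nonzero[of r] by (simp add: exp_add exp_of_real)

lemma in_strip_shift: "l \<in> right_strip \<Longrightarrow> l + of_real x \<in> right_strip"
  by (simp add: right_strip_def)

text \<open>
  In the exponents \<open>e\<^sup>i\<^sup>\<theta> cosh (r + \<sigma>) + e\<^sup>-\<^sup>i\<^sup>\<theta> cosh (r - \<sigma>)\<close> equals \<open>2 \<bar>\<zeta>\<bar> cosh (\<sigma> + \<i> arg \<zeta>)\<close> for
  \<open>\<zeta> = cosh (r + \<i> \<theta>)\<close>. Shifting the line by \<open>\<i> arg \<zeta>\<close>, which is legitimate since \<open>\<bar>arg \<zeta>\<bar> < \<pi> / 2\<close>, leaves the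
  integral of a Macdonald function of order \<open>2 p\<close>, and the shift contributes the phase.
\<close>

lemma product_inner:
  fixes L r :: real and p :: int and \<nu> :: complex
  shows "(\<integral>\<sigma>. macdonald_kernel (\<nu> + of_int p) (of_real L + \<i> * of_real \<theta>) (r + \<sigma>) *
       macdonald_kernel (\<nu> - of_int p) (of_real L - \<i> * of_real \<theta>) (r - \<sigma>) \<partial>lborel) =
    exp (- 2 * \<nu> * of_real r) * exp (2 * \<i> * of_int p * of_real (zeta_arg \<theta> r)) *
      macdonald_int (of_int (2 * p)) (of_real L + of_real (ln (2 * norm (zeta \<theta> r))))"
proof -
  define \<rho> where "\<rho> = norm (zeta \<theta> r)"
  define \<phi> where "\<phi> = zeta_arg \<theta> r"
  define F where "F = (\<lambda>w::complex. exp (- (2 * of_real (exp L * \<rho>) * cosh w) - 2 * of_int p * w))"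
  have \<rho>: "\<rho> > 0" using zeta_nonzero[of r] by (simp add: \<rho>_def)
  have hol: "F holomorphic_on UNIV" unfolding F_def cosh_field_def by (intro holomorphic_intros) auto
  have z: "zeta \<theta> r = of_real \<rho> * exp (\<i> * of_real \<phi>)" unfolding \<rho>_def \<phi>_def by (rule zeta_polar)
  have zc: "cnj (zeta \<theta> r) = of_real \<rho> * exp (- \<i> * of_real \<phi>)"
  proof -
    have "cnj (exp (\<i> * of_real \<phi>)) = exp (- \<i> * of_real \<phi>)" by (simp add: complex_eq_iff Re_exp Im_exp)
    then show ?thesis unfolding z by (simp only: complex_cnj_mult complex_cnj_complex_of_real)
  qed
  have cosh_sum: "exp (\<i> * of_real \<theta>) * of_real (cosh (r + \<sigma>)) + exp (- \<i> * of_real \<theta>) * of_real (cosh (r - \<sigma>))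
      = 2 * of_real \<rho> * cosh (of_real \<sigma> + \<i> * of_real \<phi>)" for \<sigma>
  proof -
    have "exp (\<i> * of_real \<theta>) * complex_of_real (cosh (r + \<sigma>)) + exp (- \<i> * of_real \<theta>) * of_real (cosh (r - \<sigma>))
       = exp (of_real \<sigma>) * cosh (of_real r + \<i> * of_real \<theta>) + exp (- of_real \<sigma>) * cosh (of_real r - \<i> * of_real \<theta>)"
      by (simp add: cosh_field_def ring_distribs add_divide_distrib exp_of_real[symmetric] mult_exp_exp) (simp add: algebra_simps)
    also have "\<dots> = exp (of_real \<sigma>) * zeta \<theta> r + exp (- of_real \<sigma>) * cnj (zeta \<theta> r)"
      unfolding cnj_zeta unfolding zeta_def ..
    also have "\<dots> = of_real \<rho> * (exp (of_real \<sigma>) * exp (\<i> * of_real \<phi>) + exp (- of_real \<sigma>) * exp (- \<i> * of_real \<phi>))"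
      unfolding zc unfolding z by (simp add: ring_distribs mult_ac)
    also have "\<dots> = 2 * of_real \<rho> * cosh (of_real \<sigma> + \<i> * of_real \<phi>)"
      unfolding cosh_field_def mult_exp_exp by simp
    finally show ?thesis .
  qed
  have "macdonald_kernel (\<nu> + of_int p) (of_real L + \<i> * of_real \<theta>) (r + \<sigma>) *
       macdonald_kernel (\<nu> - of_int p) (of_real L - \<i> * of_real \<theta>) (r - \<sigma>) =
    exp (- 2 * \<nu> * of_real r) * exp (2 * \<i> * of_int p * of_real \<phi>) * F (of_real \<sigma> + \<i> * of_real \<phi>)" for \<sigma>
  proof -
    have e: "exp (of_real L + \<i> * of_real \<theta>) = of_real (exp L) * exp (\<i> * of_real \<theta>)"
      "exp (of_real L - \<i> * of_real \<theta>) = of_real (exp L) * exp (- \<i> * of_real \<theta>)"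
      by (simp_all add: exp_add exp_of_real exp_diff exp_minus divide_inverse)
    have "- (exp (of_real L + \<i> * of_real \<theta>) * of_real (cosh (r + \<sigma>))) - (\<nu> + of_int p) * of_real (r + \<sigma>)
       + (- (exp (of_real L - \<i> * of_real \<theta>) * of_real (cosh (r - \<sigma>))) - (\<nu> - of_int p) * of_real (r - \<sigma>))
      = - (of_real (exp L) * (exp (\<i> * of_real \<theta>) * of_real (cosh (r + \<sigma>)) + exp (- \<i> * of_real \<theta>) * of_real (cosh (r - \<sigma>)))) - 2 * \<nu> * of_real r - 2 * of_int p * of_real \<sigma>"
      unfolding e by (simp add: ring_distribs)
    also have "\<dots> = - 2 * \<nu> * of_real r + 2 * \<i> * of_int p * of_real \<phi> +
        (- (2 * of_real (exp L * \<rho>) * cosh (of_real \<sigma> + \<i> * of_real \<phi>)) - 2 * of_int p * (of_real \<sigma> + \<i> * of_real \<phi>))"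
      unfolding cosh_sum by (simp add: ring_distribs)
    finally show ?thesis unfolding macdonald_kernel_def F_def mult_exp_exp by (rule arg_cong)
  qed
  then have "(\<integral>\<sigma>. macdonald_kernel (\<nu> + of_int p) (of_real L + \<i> * of_real \<theta>) (r + \<sigma>) *
       macdonald_kernel (\<nu> - of_int p) (of_real L - \<i> * of_real \<theta>) (r - \<sigma>) \<partial>lborel) =
     exp (- 2 * \<nu> * of_real r) * exp (2 * \<i> * of_int p * of_real \<phi>) * (\<integral>\<sigma>. F (of_real \<sigma> + \<i> * of_real \<phi>) \<partial>lborel)"
    by simp
  also have "(\<integral>\<sigma>. F (of_real \<sigma> + \<i> * of_real \<phi>) \<partial>lborel) = (\<integral>\<sigma>. F (of_real \<sigma>) \<partial>lborel)"
  proof (rule line_integral_shift[OF hol])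
    fix x \<tau> :: real assume t: "\<bar>\<tau>\<bar> \<le> \<bar>\<phi>\<bar>"
    have c0: "cos \<phi> > 0" using zeta_arg_bound[of r] by (intro cos_gt_zero_pi) (auto simp: \<phi>_def)
    have "cos \<bar>\<phi>\<bar> \<le> cos \<bar>\<tau>\<bar>" using t zeta_arg_bound[of r] pi_gt_zero by (intro cos_monotone_0_pi_le) (auto simp: \<phi>_def)
    then have ct: "cos \<phi> \<le> cos \<tau>" by simp
    have le1: "2 * exp L * \<rho> * cos \<phi> * cosh x \<le> 2 * (exp L * \<rho>) * (cosh x * cos \<tau>)"
      using ct \<rho> by (simp add: mult_ac mult_left_mono)
    have le2: "- (2 * of_int p * x) \<le> \<bar>2 * of_int p\<bar> * \<bar>x\<bar>"
      unfolding abs_mult[symmetric] by (rule abs_ge_minus_self)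
    have "Re (- (2 * of_real (exp L * \<rho>) * cosh (of_real x + \<i> * of_real \<tau>)) - 2 * of_int p * (of_real x + \<i> * of_real \<tau>))
       = - (2 * (exp L * \<rho>) * (cosh x * cos \<tau>)) - 2 * of_int p * x"
      unfolding cosh_Complex by simp
    also have "\<dots> \<le> - (2 * exp L * \<rho> * cos \<phi> * cosh x) + \<bar>2 * of_int p\<bar> * \<bar>x\<bar>"
      using le1 le2 by linarith
    finally have "Re (- (2 * of_real (exp L * \<rho>) * cosh (of_real x + \<i> * of_real \<tau>)) - 2 * of_int p * (of_real x + \<i> * of_real \<tau>))
       \<le> - (2 * exp L * \<rho> * cos \<phi> * cosh x) + \<bar>2 * of_int p\<bar> * \<bar>x\<bar>" .
    then have "norm (F (of_real x + \<i> * of_real \<tau>)) \<le> exp (- (2 * exp L * \<rho> * cos \<phi> * cosh x) + \<bar>2 * of_int p\<bar> * \<bar>x\<bar>)"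
      unfolding F_def norm_exp_eq_Re by simp
    also have "\<dots> \<le> exp ((\<bar>2 * of_int p\<bar> + 1)\<^sup>2 / (2 * exp L * \<rho> * cos \<phi>)) * exp (- \<bar>x\<bar>)"
      using \<rho> c0 by (intro exp_neg_cosh_bound) auto
    finally show "norm (F (of_real x + \<i> * of_real \<tau>)) \<le> exp ((\<bar>2 * of_int p\<bar> + 1)\<^sup>2 / (2 * exp L * \<rho> * cos \<phi>)) * exp (- \<bar>x\<bar>)" .
  qed
  also have "\<dots> = macdonald_int (of_int (2 * p)) (of_real L + of_real (ln (2 * \<rho>)))"
  proof -
    have "cosh (complex_of_real x) = of_real (cosh x)" for x by (simp add: cosh_field_def flip: exp_of_real)
    then show ?thesis
      unfolding macdonald_int_def macdonald_kernel_def F_def \<rho>_def exp_shift_ln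
      by (simp add: mult_ac flip: exp_of_real)
  qed
  finally show ?thesis unfolding \<phi>_def \<rho>_def .
qed

text \<open>
  The product of two integrals over \<open>s\<close> and \<open>t\<close> in the coordinates \<open>s = r + \<sigma>\<close>, \<open>t = r - \<sigma>\<close>. The factor \<open>2\<close>
  is the Jacobian.
\<close>

lemma product_formula_real:
  fixes L :: real and p :: int and \<nu> :: complex
  shows "macdonald_int (\<nu> + of_int p) (of_real L + \<i> * of_real \<theta>) * macdonald_int (\<nu> - of_int p) (of_real L - \<i> * of_real \<theta>) =
    2 * (\<integral>r. exp (- 2 * \<nu> * of_real r) * exp (2 * \<i> * of_int p * of_real (zeta_arg \<theta> r)) *
      macdonald_int (of_int (2 * p)) (of_real L + of_real (ln (2 * norm (zeta \<theta> r)))) \<partial>lborel)"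
proof -
  define k1 where "k1 = macdonald_kernel (\<nu> + of_int p) (of_real L + \<i> * of_real \<theta>)"
  define k2 where "k2 = macdonald_kernel (\<nu> - of_int p) (of_real L - \<i> * of_real \<theta>)"
  have pos: "0 < Re (exp (of_real L + \<i> * of_real \<theta>))" "0 < Re (exp (of_real L - \<i> * of_real \<theta>))"
    using cos_theta by (simp_all add: Re_exp)
  obtain C1 where C1: "\<And>t. norm (k1 t) \<le> C1 * exp (- \<bar>t\<bar>)"
    using macdonald_kernel_bound[OF pos(1) order_refl] unfolding k1_def by blast
  obtain C2 where C2: "\<And>t. norm (k2 t) \<le> C2 * exp (- \<bar>t\<bar>)"
    using macdonald_kernel_bound[OF pos(2) order_refl] unfolding k2_def by blast
  have meas [measurable]: "k1 \<in> borel_measurable borel" "k2 \<in> borel_measurable borel"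
    by (simp_all add: k1_def k2_def)
  \<comment> \<open>for fixed \<open>s\<close> the substitution \<open>t = 2 r - s\<close> is affine; afterwards \<open>s = r + \<sigma>\<close> for fixed \<open>r\<close>\<close>
  define g where "g = (\<lambda>s r. k1 s * k2 (- s + 2 * r))"
  have C0: "C1 \<ge> 0" "C2 \<ge> 0" using C1[of 0] C2[of 0] by (simp_all add: order_trans[OF norm_ge_zero])
  have int: "integrable (lborel \<Otimes>\<^sub>M lborel) (\<lambda>(s, r). g s r)"
  proof (rule Bochner_Integration.integrable_bound)
    show "integrable (lborel \<Otimes>\<^sub>M lborel) (\<lambda>x::real \<times> real. C1 * C2 * (exp (- (1/2 * \<bar>fst x\<bar>)) * exp (- (1 * \<bar>snd x\<bar>))))"
      by (intro integrable_mult_right lborel_pair.integrable_product integrable_exp_neg_abs) auto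
    show "AE x in lborel \<Otimes>\<^sub>M lborel. norm (case x of (s, r) \<Rightarrow> g s r) \<le> norm (C1 * C2 * (exp (- (1/2 * \<bar>fst x\<bar>)) * exp (- (1 * \<bar>snd x\<bar>))))"
    proof (rule AE_I2, clarify, simp only: prod.case fst_conv snd_conv)
      fix s r :: real
      have "norm (g s r) \<le> (C1 * exp (- \<bar>s\<bar>)) * (C2 * exp (- \<bar>- s + 2 * r\<bar>))"
        unfolding g_def norm_mult using C0 by (intro mult_mono C1 C2) auto
      also have "\<dots> = C1 * C2 * exp (- \<bar>s\<bar> + - \<bar>- s + 2 * r\<bar>)"
        unfolding exp_add by (simp only: mult_ac)
      also have "\<dots> \<le> C1 * C2 * exp (- (1/2 * \<bar>s\<bar>) + - (1 * \<bar>r\<bar>))"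
      proof (rule mult_left_mono)
        have "- \<bar>s\<bar> + - \<bar>- s + 2 * r\<bar> \<le> - (1/2 * \<bar>s\<bar>) + - (1 * \<bar>r\<bar>)" by arith
        then show "exp (- \<bar>s\<bar> + - \<bar>- s + 2 * r\<bar>) \<le> exp (- (1/2 * \<bar>s\<bar>) + - (1 * \<bar>r\<bar>))" by (rule exp_le_cancel_iff[THEN iffD2])
      qed (use C0 in simp)
      also have "\<dots> \<le> norm (C1 * C2 * (exp (- (1/2 * \<bar>s\<bar>)) * exp (- (1 * \<bar>r\<bar>))))"
        unfolding exp_add real_norm_def by (rule abs_ge_self)
      finally show "norm (g s r) \<le> norm (C1 * C2 * (exp (- (1/2 * \<bar>s\<bar>)) * exp (- (1 * \<bar>r\<bar>))))" .
    qed
  qed (simp add: g_def split_beta')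
  have "macdonald_int (\<nu> + of_int p) (of_real L + \<i> * of_real \<theta>) * macdonald_int (\<nu> - of_int p) (of_real L - \<i> * of_real \<theta>)
     = (\<integral>s. k1 s * (\<integral>t. k2 t \<partial>lborel) \<partial>lborel)"
    unfolding macdonald_int_def k1_def k2_def by simp
  also have "\<dots> = (\<integral>s. 2 * (\<integral>r. g s r \<partial>lborel) \<partial>lborel)"
  proof (rule Bochner_Integration.integral_cong[OF refl])
    fix s :: real
    have "(\<integral>t. k2 t \<partial>lborel) = \<bar>2\<bar> *\<^sub>R (\<integral>r. k2 (- s + 2 * r) \<partial>lborel)"
      by (rule lborel_integral_real_affine) simp
    then show "k1 s * (\<integral>t. k2 t \<partial>lborel) = 2 * (\<integral>r. g s r \<partial>lborel)"
      by (simp add: g_def scaleR_conv_of_real)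
  qed
  also have "\<dots> = 2 * (\<integral>s. (\<integral>r. g s r \<partial>lborel) \<partial>lborel)" by simp
  also have "(\<integral>s. (\<integral>r. g s r \<partial>lborel) \<partial>lborel) = (\<integral>r. (\<integral>s. g s r \<partial>lborel) \<partial>lborel)"
    by (rule lborel_pair.Fubini_integral[OF int, symmetric])
  also have "\<dots> = (\<integral>r. (\<integral>\<sigma>. k1 (r + \<sigma>) * k2 (r - \<sigma>) \<partial>lborel) \<partial>lborel)"
  proof (rule Bochner_Integration.integral_cong[OF refl])
    fix r :: real
    have "(\<integral>s. g s r \<partial>lborel) = \<bar>1\<bar> *\<^sub>R (\<integral>\<sigma>. g (r + 1 * \<sigma>) r \<partial>lborel)"
      by (rule lborel_integral_real_affine) simp
    then show "(\<integral>s. g s r \<partial>lborel) = (\<integral>\<sigma>. k1 (r + \<sigma>) * k2 (r - \<sigma>) \<partial>lborel)" by (simp add: g_def)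
  qed
  finally show ?thesis unfolding k1_def k2_def product_inner .
qed

end

section \<open>The product formula on the boundary of the strip\<close>

definition phase :: "real \<Rightarrow> int \<Rightarrow> real \<Rightarrow> real \<Rightarrow> complex" where
  "phase \<kappa> p \<theta> r = exp (- 2 * (\<i> * of_real \<kappa>) * of_real r) * exp (2 * \<i> * of_int p * of_real (zeta_arg \<theta> r))"

lemma norm_phase [simp]: "norm (phase \<kappa> p \<theta> r) = 1"
  by (simp add: phase_def norm_mult)

definition angular_integrand :: "real \<Rightarrow> int \<Rightarrow> real \<Rightarrow> complex \<Rightarrow> real \<Rightarrow> complex" where
  "angular_integrand \<kappa> p \<theta> L r = phase \<kappa> p \<theta> r * macdonald_int (of_int (2 * p)) (L + of_real (ln (2 * norm (zeta \<theta> r))))"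

lemma phase_continuous:
  assumes "\<bar>\<theta>\<bar> < pi / 2"
  shows "continuous_on A (phase \<kappa> p \<theta>)"
  unfolding phase_def by (intro continuous_intros zeta_arg_continuous[OF assms])

lemma angular_integrand_continuous:
  assumes "\<bar>\<theta>\<bar> < pi / 2" "L \<in> right_strip"
  shows "continuous_on A (angular_integrand \<kappa> p \<theta> L)"
  unfolding angular_integrand_def
proof (intro continuous_on_mult phase_continuous[OF assms(1)])
  show "continuous_on A (\<lambda>r. macdonald_int (of_int (2 * p)) (L + of_real (ln (2 * norm (zeta \<theta> r)))))"
    by (rule continuous_on_compose2[OF holomorphic_on_imp_continuous_on[OF macdonald_int_holomorphic]])
      (use in_strip_shift[OF assms] in \<open>auto intro!: continuous_intros ln_norm_continuous[OF assms(1)]\<close>)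
qed

lemma angular_integrand_measurable:
  assumes "\<bar>\<theta>\<bar> < pi / 2" "L \<in> right_strip"
  shows "angular_integrand \<kappa> p \<theta> L \<in> borel_measurable borel"
  by (rule borel_measurable_continuous_onI) (rule angular_integrand_continuous[OF assms])

text \<open>
  The argument \<open>2 e\<^sup>L \<bar>\<zeta>\<bar>\<close> of the Macdonald function has real part of size \<open>cosh r\<close> as long as \<open>Re e\<^sup>L\<close> stays away
  from \<open>0\<close>.
\<close>

lemma angular_integrand_bound:
  assumes th: "\<bar>\<theta>\<bar> < pi / 2" and c: "c > 0"
  obtains C where "\<And>L r. c \<le> Re (exp L) \<Longrightarrow> norm (angular_integrand \<kappa> p \<theta> L r) \<le> C * exp (- \<bar>r\<bar>)"
proof -
  define c0 where "c0 = 2 * cos \<theta> * c"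
  have c0: "c0 > 0" using c cos_theta[OF th] by (simp add: c0_def)
  obtain C where C: "C \<ge> 0" "\<And>l. c0 \<le> Re (exp l) \<Longrightarrow> norm (macdonald_int (of_int (2 * p)) l) \<le> C * exp (- Re (exp l) / 2)"
    using macdonald_int_decay[OF c0] by blast
  show ?thesis
  proof (rule that[of "C * exp ((0 + 1)\<^sup>2 / (c0 / 2))"])
    fix L r assume L: "c \<le> Re (exp L)"
    let ?l = "L + complex_of_real (ln (2 * norm (zeta \<theta> r)))"
    have "c0 * cosh r = 2 * (cos \<theta> * cosh r) * c" by (simp add: c0_def mult_ac)
    also have "\<dots> \<le> 2 * norm (zeta \<theta> r) * Re (exp L)"
      using norm_zeta_ge[OF th, of r] L c cos_theta[OF th] by (intro mult_mono) (auto simp: less_imp_le)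
    also have "\<dots> = Re (exp ?l)" unfolding exp_shift_ln[OF th] by (simp del: Re_exp)
    finally have l: "c0 * cosh r \<le> Re (exp ?l)" .
    moreover have "c0 * 1 \<le> c0 * cosh r" using c0 cosh_real_ge_1[of r] by (intro mult_left_mono) auto
    ultimately have "norm (macdonald_int (of_int (2 * p)) ?l) \<le> C * exp (- Re (exp ?l) / 2)"
      by (intro C(2)) simp
    also have "\<dots> \<le> C * exp (- (c0 / 2 * cosh r) + 0 * \<bar>r\<bar>)"
      using l C(1) by (intro mult_left_mono) (auto simp del: Re_exp)
    also have "\<dots> \<le> C * (exp ((0 + 1)\<^sup>2 / (c0 / 2)) * exp (- \<bar>r\<bar>))"
      using C(1) c0 by (intro mult_left_mono exp_neg_cosh_bound) auto
    finally show "norm (angular_integrand \<kappa> p \<theta> L r) \<le> C * exp ((0 + 1)\<^sup>2 / (c0 / 2)) * exp (- \<bar>r\<bar>)"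
      unfolding angular_integrand_def norm_mult by simp
  qed
qed

lemma angular_integrand_integrable:
  assumes "\<bar>\<theta>\<bar> < pi / 2" "L \<in> right_strip"
  shows "integrable lborel (angular_integrand \<kappa> p \<theta> L)"
proof -
  obtain C where "\<And>L' r. Re (exp L) \<le> Re (exp L') \<Longrightarrow> norm (angular_integrand \<kappa> p \<theta> L' r) \<le> C * exp (- \<bar>r\<bar>)"
    using angular_integrand_bound[OF assms(1) Re_exp_pos[OF assms(2)]] by blast
  then show ?thesis
    using integrable_of_exp_bound[OF angular_integrand_measurable[OF assms]] by blast
qed

lemma angular_int_holomorphic:
  assumes th: "\<bar>\<theta>\<bar> < pi / 2"
  shows "(\<lambda>L. \<integral>r. angular_integrand \<kappa> p \<theta> L r \<partial>lborel) holomorphic_on right_strip"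
proof (rule holomorphic_onI)
  fix L assume L: "L \<in> right_strip"
  define c where "c = Re (exp L) / 2"
  have c: "0 < c" "c < Re (exp L)" using Re_exp_pos[OF L] unfolding c_def by linarith+
  define S where "S = right_strip \<inter> {w. c < Re (exp w)}"
  have S: "open S" "L \<in> S"
    using c L unfolding S_def by (auto intro!: open_Int right_strip_open open_Collect_less continuous_intros)
  obtain C where C: "\<And>L' r. c \<le> Re (exp L') \<Longrightarrow> norm (angular_integrand \<kappa> p \<theta> L' r) \<le> C * exp (- \<bar>r\<bar>)"
    using angular_integrand_bound[OF th c(1)] by blast
  have "((\<lambda>w. \<integral>r. angular_integrand \<kappa> p \<theta> w r \<partial>lborel) has_field_derivative (\<integral>r. deriv (\<lambda>w. angular_integrand \<kappa> p \<theta> w r) L \<partial>lborel)) (at L)"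
  proof (rule parametric_integral_has_field_derivative(2)[OF S])
    show "integrable lborel (\<lambda>r::real. C * exp (- (1 * \<bar>r\<bar>)))"
      by (intro integrable_mult_right integrable_exp_neg_abs) auto
    show "(\<lambda>w. angular_integrand \<kappa> p \<theta> w r) holomorphic_on S" for r
      unfolding angular_integrand_def
      by (intro holomorphic_on_mult holomorphic_on_const
          holomorphic_on_compose_gen[OF _ macdonald_int_holomorphic, unfolded o_def] holomorphic_intros)
        (auto simp: S_def intro!: in_strip_shift[OF th])
    show "norm (angular_integrand \<kappa> p \<theta> w r) \<le> C * exp (- (1 * \<bar>r\<bar>))" if "w \<in> S" for w r
      using C[of w r] that by (simp add: S_def)
  qed (auto simp: S_def intro!: angular_integrand_measurable[OF th])
  then show "(\<lambda>L. \<integral>r. angular_integrand \<kappa> p \<theta> L r \<partial>lborel) field_differentiable at L within right_strip"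
    unfolding field_differentiable_def using has_field_derivative_at_within by blast
qed

text \<open>
  The left side of the product formula as an entire function of \<open>L\<close>.
\<close>

definition macdonald_product :: "real \<Rightarrow> int \<Rightarrow> real \<Rightarrow> complex \<Rightarrow> complex" where
  "macdonald_product \<kappa> p \<theta> L = macdonald_log (\<i> * of_real \<kappa> + of_int p) (L + \<i> * of_real \<theta>) *
     macdonald_log (\<i> * of_real \<kappa> - of_int p) (L - \<i> * of_real \<theta>)"

lemma macdonald_product_holomorphic: "macdonald_product \<kappa> p \<theta> holomorphic_on A"
  unfolding macdonald_product_def
  by (intro holomorphic_on_mult holomorphic_on_compose_gen[OF _ macdonald_log_holomorphic[of _ UNIV], unfolded o_def] holomorphic_intros) auto

lemma product_formula:
  assumes k: "\<kappa> \<noteq> 0" and th: "\<bar>\<theta>\<bar> < pi / 2" and L: "L \<in> right_strip"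
  shows "macdonald_product \<kappa> p \<theta> L = 2 * (\<integral>r. angular_integrand \<kappa> p \<theta> L r \<partial>lborel)"
proof (rule eq_on_right_strip[OF macdonald_product_holomorphic _ _ L])
  show "(\<lambda>L. 2 * (\<integral>r. angular_integrand \<kappa> p \<theta> L r \<partial>lborel)) holomorphic_on right_strip"
    by (intro holomorphic_on_mult holomorphic_on_const angular_int_holomorphic[OF th])
  fix x :: real
  have s: "of_real x + \<i> * of_real \<theta> \<in> right_strip" "of_real x - \<i> * of_real \<theta> \<in> right_strip"
    using th by (auto simp: right_strip_def)
  have "macdonald_int (\<i> * of_real \<kappa> - of_int p) (of_real x - \<i> * of_real \<theta>) = macdonald_log (\<i> * of_real \<kappa> - of_int p) (of_real x - \<i> * of_real \<theta>)"
    using macdonald_int_eq_log[OF k s(2), of "- p"] by simp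
  then show "macdonald_product \<kappa> p \<theta> (of_real x) = 2 * (\<integral>r. angular_integrand \<kappa> p \<theta> (of_real x) r \<partial>lborel)"
    unfolding macdonald_product_def macdonald_int_eq_log[OF k s(1), symmetric] angular_integrand_def phase_def
    using product_formula_real[OF th, of "\<i> * of_real \<kappa>" p x] by simp
qed

text \<open>
  At \<open>L = x \<mp> \<i> \<alpha>\<close> the two sides of the product formula are defined for \<open>\<alpha> < \<pi> / 2\<close>, and their differences
  are compared in the limit \<open>\<alpha> \<rightarrow> \<pi> / 2\<close>. On the right the arguments \<open>R e\<^sup>\<mp>\<^sup>i\<^sup>\<alpha>\<close> of the Macdonald function
  approach the imaginary axis. Since \<open>R\<close> grows like \<open>exp \<bar>r\<bar>\<close>, the uniform bound \<open>C / \<surd>R\<close> provides the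
  integrable majorant \<open>exp (- \<bar>r\<bar> / 2)\<close>.
\<close>

lemma product_boundary_jump:
  fixes x :: real
  assumes k: "\<kappa> \<noteq> 0" and th: "\<bar>\<theta>\<bar> < pi / 2"
  shows "macdonald_product \<kappa> p \<theta> (of_real x - \<i> * of_real (pi / 2)) - macdonald_product \<kappa> p \<theta> (of_real x + \<i> * of_real (pi / 2))
    = 4 * \<i> * (\<integral>r. phase \<kappa> p \<theta> r * of_real (bessel_angle p (2 * exp x * norm (zeta \<theta> r))) \<partial>lborel)"
proof -
  let ?K = "macdonald_int (of_int (2 * p))"
  define R where "R = (\<lambda>r. 2 * exp x * norm (zeta \<theta> r))"
  define a where "a = angle_seq"
  have strip: "of_real x - \<i> * of_real (a k) \<in> right_strip" "of_real x + \<i> * of_real (a k) \<in> right_strip" for k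
    using angle_seq(1,2)[of k] by (auto simp: right_strip_def a_def)
  have R0: "R r > 0" for r using zeta_nonzero[OF th] by (simp add: R_def)
  have lnR: "of_real x - c + complex_of_real (ln (2 * norm (zeta \<theta> r))) = of_real (ln (R r)) - c"
     "of_real x + c + complex_of_real (ln (2 * norm (zeta \<theta> r))) = of_real (ln (R r)) + c" for r c
  proof -
    have "ln (R r) = ln (exp x * (2 * norm (zeta \<theta> r)))" by (simp add: R_def mult_ac)
    also have "\<dots> = x + ln (2 * norm (zeta \<theta> r))" using zeta_nonzero[OF th, of r] by (subst ln_mult_pos) auto
    finally show "of_real x - c + complex_of_real (ln (2 * norm (zeta \<theta> r))) = of_real (ln (R r)) - c"
     "of_real x + c + complex_of_real (ln (2 * norm (zeta \<theta> r))) = of_real (ln (R r)) + c" by simp_all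
  qed
  define J where "J = (\<lambda>k r. phase \<kappa> p \<theta> r * (?K (of_real (ln (R r)) - \<i> * of_real (a k)) - ?K (of_real (ln (R r)) + \<i> * of_real (a k))))"
  have J: "J k = (\<lambda>r. angular_integrand \<kappa> p \<theta> (of_real x - \<i> * of_real (a k)) r - angular_integrand \<kappa> p \<theta> (of_real x + \<i> * of_real (a k)) r)" for k
    unfolding J_def angular_integrand_def lnR by (simp add: right_diff_distrib)
  have eqk: "macdonald_product \<kappa> p \<theta> (of_real x - \<i> * of_real (a k)) - macdonald_product \<kappa> p \<theta> (of_real x + \<i> * of_real (a k)) = 2 * (\<integral>r. J k r \<partial>lborel)" for k
    unfolding product_formula[OF k th strip(1)] product_formula[OF k th strip(2)] J
    using angular_integrand_integrable[OF th strip(1)] angular_integrand_integrable[OF th strip(2)] by simp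
  have lhs: "(\<lambda>k. macdonald_product \<kappa> p \<theta> (of_real x - \<i> * of_real (a k)) - macdonald_product \<kappa> p \<theta> (of_real x + \<i> * of_real (a k)))
    \<longlonglongrightarrow> macdonald_product \<kappa> p \<theta> (of_real x - \<i> * of_real (pi / 2)) - macdonald_product \<kappa> p \<theta> (of_real x + \<i> * of_real (pi / 2))"
  proof -
    have c: "isCont (macdonald_product \<kappa> p \<theta>) w" for w
      using holomorphic_on_imp_continuous_on[OF macdonald_product_holomorphic[of \<kappa> p \<theta> UNIV]]
      by (simp add: continuous_on_eq_continuous_at)
    show ?thesis unfolding a_def
      by (intro tendsto_diff isCont_tendsto_compose[OF c] tendsto_intros angle_seq)
  qed
  define b where "b = exp x * cos \<theta>"
  have b: "b > 0" using cos_theta[OF th] by (simp add: b_def)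
  have Rge: "R r \<ge> b * exp \<bar>r\<bar>" for r
  proof -
    have "exp \<bar>r\<bar> \<le> 2 * cosh r" by (cases "r \<ge> 0") (auto simp: cosh_def)
    then have "b * exp \<bar>r\<bar> \<le> b * (2 * cosh r)" using b by (intro mult_left_mono) auto
    also have "\<dots> = 2 * exp x * (cos \<theta> * cosh r)" by (simp add: b_def)
    also have "\<dots> \<le> R r" unfolding R_def using norm_zeta_ge[OF th] by (intro mult_left_mono) auto
    finally show ?thesis .
  qed
  obtain C where C: "C \<ge> 0" "\<And>R \<alpha>. b \<le> R \<Longrightarrow> 0 \<le> \<alpha> \<Longrightarrow> \<alpha> < pi / 2 \<Longrightarrow>
     norm (?K (of_real (ln R) - \<i> * of_real \<alpha>)) \<le> C / sqrt R"
    using macdonald_int_rotated_bound[OF b, of "2 * p"] by blast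
  have le: "norm (J k r) \<le> 2 * C / sqrt b * exp (- (1 / 2 * \<bar>r\<bar>))" for k r
  proof -
    have "b * 1 \<le> b * exp \<bar>r\<bar>" using b by (intro mult_left_mono) auto
    then have bR: "b \<le> R r" using Rge[of r] by simp
    have m: "norm (?K (of_real (ln (R r)) - \<i> * of_real (a k))) \<le> C / sqrt (R r)"
      using angle_seq(1,2)[of k] bR by (intro C(2)) (auto simp: a_def)
    have "?K (of_real (ln (R r)) + \<i> * of_real (a k)) = cnj (?K (of_real (ln (R r)) - \<i> * of_real (a k)))"
      using macdonald_int_cnj[of "of_int (2 * p)" "of_real (ln (R r)) - \<i> * of_real (a k)"] by simp
    then have m': "norm (?K (of_real (ln (R r)) + \<i> * of_real (a k))) \<le> C / sqrt (R r)" using m by simp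
    have "norm (J k r) \<le> C / sqrt (R r) + C / sqrt (R r)"
      unfolding J_def norm_mult norm_phase mult_1_left by (rule order_trans[OF norm_triangle_ineq4 add_mono[OF m m']])
    also have "\<dots> = 2 * C / sqrt (R r)" by simp
    also have "\<dots> \<le> 2 * C / sqrt (b * exp \<bar>r\<bar>)"
      using Rge[of r] C(1) b R0[of r] by (intro divide_left_mono) auto
    also have "sqrt (b * exp \<bar>r\<bar>) = sqrt b * exp (1 / 2 * \<bar>r\<bar>)"
    proof -
      have "exp \<bar>r\<bar> = (exp (1 / 2 * \<bar>r\<bar>))\<^sup>2" by (simp add: power2_eq_square flip: exp_add)
      then show ?thesis by (simp add: real_sqrt_mult)
    qed
    finally show ?thesis unfolding exp_minus by (simp add: divide_simps)
  qed
  have lim: "(\<lambda>k. \<integral>r. J k r \<partial>lborel) \<longlonglongrightarrow> (\<integral>r. phase \<kappa> p \<theta> r * (2 * \<i> * of_real (bessel_angle p (R r))) \<partial>lborel)"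
  proof (rule integral_dominated_convergence)
    show Jm: "J k \<in> borel_measurable lborel" for k
      unfolding J using angular_integrand_measurable[OF th strip(1)] angular_integrand_measurable[OF th strip(2)] by simp
    have Jlim: "(\<lambda>k. J k r) \<longlonglongrightarrow> phase \<kappa> p \<theta> r * (2 * \<i> * of_real (bessel_angle p (R r)))" for r
      unfolding J_def a_def by (intro tendsto_mult tendsto_const macdonald_int_jump R0)
    then show "AE r in lborel. (\<lambda>k. J k r) \<longlonglongrightarrow> phase \<kappa> p \<theta> r * (2 * \<i> * of_real (bessel_angle p (R r)))" by simp
    show "(\<lambda>r. phase \<kappa> p \<theta> r * (2 * \<i> * of_real (bessel_angle p (R r)))) \<in> borel_measurable lborel"
      by (rule borel_measurable_LIMSEQ_metric[OF Jm Jlim])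
    show "integrable lborel (\<lambda>r. 2 * C / sqrt b * exp (- (1 / 2 * \<bar>r\<bar>)))"
      by (intro integrable_mult_right integrable_exp_neg_abs) auto
  qed (use le in auto)
  have "(\<lambda>k. 2 * (\<integral>r. J k r \<partial>lborel)) \<longlonglongrightarrow> 2 * (\<integral>r. phase \<kappa> p \<theta> r * (2 * \<i> * of_real (bessel_angle p (R r))) \<partial>lborel)"
    by (intro tendsto_mult tendsto_const lim)
  with lhs have "macdonald_product \<kappa> p \<theta> (of_real x - \<i> * of_real (pi / 2)) - macdonald_product \<kappa> p \<theta> (of_real x + \<i> * of_real (pi / 2))
    = 2 * (\<integral>r. phase \<kappa> p \<theta> r * (2 * \<i> * of_real (bessel_angle p (R r))) \<partial>lborel)"
    unfolding eqk by (rule LIMSEQ_unique)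
  also have "(\<lambda>r. phase \<kappa> p \<theta> r * (2 * \<i> * of_real (bessel_angle p (R r)))) = (\<lambda>r. (2 * \<i>) * (phase \<kappa> p \<theta> r * of_real (bessel_angle p (R r))))"
    by (simp add: mult_ac)
  finally show ?thesis unfolding R_def by simp
qed

section \<open>The kernel as a boundary jump\<close>

text \<open>
  Rotating the argument by \<open>\<mp> \<pi> / 2\<close> changes the sign of its square, so \<open>I_\<mu>\<close> turns into \<open>J_\<mu>\<close> with a phase.
\<close>

lemma macdonald_log_rotate:
  "macdonald_log \<mu> (l - \<i> * of_real (pi / 2)) = of_real pi / sin (of_real pi * \<mu>) *
     (exp (\<i> * of_real pi * \<mu> / 2) * bessel_J_log (- \<mu>) l - exp (- (\<i> * of_real pi * \<mu> / 2)) * bessel_J_log \<mu> l)"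
  "macdonald_log \<mu> (l + \<i> * of_real (pi / 2)) = of_real pi / sin (of_real pi * \<mu>) *
     (exp (- (\<i> * of_real pi * \<mu> / 2)) * bessel_J_log (- \<mu>) l - exp (\<i> * of_real pi * \<mu> / 2) * bessel_J_log \<mu> l)"
proof -
  define d where "d = l - of_real (ln 2)"
  have y: "exp (2 * (d - \<i> * of_real (pi / 2))) = - exp (2 * d)" "exp (2 * (d + \<i> * of_real (pi / 2))) = - exp (2 * d)"
    by (simp_all add: ring_distribs exp_diff exp_add mult.assoc[symmetric] mult.commute[of \<i>])
  have e: "exp (s * (d - \<i> * of_real (pi / 2))) = exp (- (\<i> * of_real pi * s / 2)) * exp (s * d)"
    "exp (s * (d + \<i> * of_real (pi / 2))) = exp (\<i> * of_real pi * s / 2) * exp (s * d)" for s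
    unfolding mult_exp_exp by (rule arg_cong[where f = exp], simp add: algebra_simps)+
  have d: "l - \<i> * of_real (pi / 2) - of_real (ln 2) = d - \<i> * of_real (pi / 2)"
    "l + \<i> * of_real (pi / 2) - of_real (ln 2) = d + \<i> * of_real (pi / 2)" by (simp_all add: d_def)
  show "macdonald_log \<mu> (l - \<i> * of_real (pi / 2)) = of_real pi / sin (of_real pi * \<mu>) *
     (exp (\<i> * of_real pi * \<mu> / 2) * bessel_J_log (- \<mu>) l - exp (- (\<i> * of_real pi * \<mu> / 2)) * bessel_J_log \<mu> l)"
    "macdonald_log \<mu> (l + \<i> * of_real (pi / 2)) = of_real pi / sin (of_real pi * \<mu>) *
     (exp (- (\<i> * of_real pi * \<mu> / 2)) * bessel_J_log (- \<mu>) l - exp (\<i> * of_real pi * \<mu> / 2) * bessel_J_log \<mu> l)"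
    unfolding macdonald_log_def bessel_J_log_eq_ser d unfolding y unfolding e d_def[symmetric] by (simp_all add: mult.assoc)
qed

lemma sin_pi_add_int:
  "sin (of_real pi * (\<nu> + of_int p)) = exp (\<i> * of_real pi * of_int p) * sin (of_real pi * \<nu>)"
  "sin (of_real pi * (\<nu> - of_int p)) = exp (\<i> * of_real pi * of_int p) * sin (of_real pi * \<nu>)"
  "exp (\<i> * of_real pi * of_int p) * exp (\<i> * of_real pi * of_int p) = (1::complex)"
proof -
  have s: "sin (complex_of_real pi * of_int p) = 0"
    by (metis of_real_0 of_real_mult of_real_of_int_eq sin_npi_int sin_of_real)
  have c: "exp (\<i> * of_real pi * of_int p) = cos (complex_of_real pi * of_int p)"
    using exp_Euler[of "complex_of_real pi * of_int p"] s by (simp add: mult.assoc)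
  show "sin (of_real pi * (\<nu> + of_int p)) = exp (\<i> * of_real pi * of_int p) * sin (of_real pi * \<nu>)"
    "sin (of_real pi * (\<nu> - of_int p)) = exp (\<i> * of_real pi * of_int p) * sin (of_real pi * \<nu>)"
    unfolding c by (simp_all add: ring_distribs sin_add sin_diff s)
  show "exp (\<i> * of_real pi * of_int p) * exp (\<i> * of_real pi * of_int p) = (1::complex)"
    unfolding c using sin_cos_squared_add3[of "complex_of_real pi * of_int p"] s by simp
qed

text \<open>
  Each of the two boundary values is a product of two combinations of \<open>J_{-\<mu>}\<close> and \<open>J_\<mu>\<close>. In the
  difference the mixed terms cancel, because \<open>p\<close> is an integer, and the pure terms
  carry the coefficient \<open>2 \<i> sin (\<pi> \<nu>)\<close>, which reduces the denominator \<open>sin\<^sup>2 (\<pi> \<nu>)\<close> to \<open>sin (\<pi> \<nu>)\<close>.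
\<close>

lemma bold_J_product:
  fixes x \<theta> \<kappa> :: real and p :: int
  assumes k: "\<kappa> \<noteq> 0"
  shows "\<i> * bold_J (\<i> * of_real \<kappa>) p (exp (of_real x + \<i> * of_real \<theta>)) =
     macdonald_product \<kappa> p \<theta> (of_real x - \<i> * of_real (pi / 2)) - macdonald_product \<kappa> p \<theta> (of_real x + \<i> * of_real (pi / 2))"
proof -
  define \<nu> where "\<nu> = \<i> * complex_of_real \<kappa>"
  define l where "l = complex_of_real x + \<i> * of_real \<theta>"
  have cl: "cnj l = of_real x - \<i> * of_real \<theta>" by (simp add: l_def)
  define s where "s = sin (of_real pi * \<nu>)"
  have s0: "s \<noteq> 0" using sin_pi_imaginary_nonzero[OF k, of 0] by (simp add: s_def \<nu>_def)
  define A1 where "A1 = bessel_J_log (- (\<nu> + of_int p)) l"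
  define A2 where "A2 = bessel_J_log (\<nu> + of_int p) l"
  define B1 where "B1 = bessel_J_log (- (\<nu> - of_int p)) (cnj l)"
  define B2 where "B2 = bessel_J_log (\<nu> - of_int p) (cnj l)"
  define e where "e = exp (\<i> * of_real pi * of_int p :: complex)"
  define u where "u = exp (\<i> * of_real pi * (\<nu> + of_int p) / 2)"
  define u' where "u' = exp (- (\<i> * of_real pi * (\<nu> + of_int p) / 2))"
  define v where "v = exp (\<i> * of_real pi * (\<nu> - of_int p) / 2)"
  define v' where "v' = exp (- (\<i> * of_real pi * (\<nu> - of_int p) / 2))"
  have ee: "e * e = 1" unfolding e_def by (rule sin_pi_add_int(3))
  \<comment> \<open>coefficient of the pure terms\<close>
  have uv: "u * v - u' * v' = 2 * \<i> * s"
  proof -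
    have "u * v = exp (\<i> * (of_real pi * \<nu>))" "u' * v' = exp (- (\<i> * (of_real pi * \<nu>)))"
      unfolding u_def v_def u'_def v'_def mult_exp_exp by (rule arg_cong[where f = exp], simp add: field_simps)+
    then show ?thesis unfolding s_def sin_exp_eq by simp
  qed
  \<comment> \<open>coefficient of the mixed terms\<close>
  have uv': "u * v' = u' * v"
  proof -
    have "u * v' = e"
      unfolding u_def v'_def e_def mult_exp_exp by (rule arg_cong[where f = exp]) (simp add: algebra_simps add_divide_distrib diff_divide_distrib)
    moreover have "u' * v = inverse e"
      unfolding u'_def v_def e_def mult_exp_exp exp_minus[symmetric] by (rule arg_cong[where f = exp]) (simp add: algebra_simps add_divide_distrib diff_divide_distrib)
    moreover have "inverse e = e" using ee by (metis inverse_unique)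
    ultimately show ?thesis by simp
  qed
  define q where "q = of_real pi / (e * s) * (of_real pi / (e * s))"
  have q: "q * s = of_real pi ^ 2 / s"
    unfolding q_def using s0 ee by (simp add: field_simps power2_eq_square)
  have m1: "macdonald_product \<kappa> p \<theta> (of_real x - \<i> * of_real (pi / 2)) = q * ((u * A1 - u' * A2) * (v * B1 - v' * B2))"
  proof -
    have "of_real x - \<i> * of_real (pi / 2) + \<i> * of_real \<theta> = l - \<i> * of_real (pi / 2)"
      "of_real x - \<i> * of_real (pi / 2) - \<i> * of_real \<theta> = cnj l - \<i> * of_real (pi / 2)" by (simp_all add: l_def)
    then show ?thesis
      unfolding macdonald_product_def \<nu>_def[symmetric] by (simp only: macdonald_log_rotate(1) sin_pi_add_int(1,2))
        (simp only: A1_def A2_def B1_def B2_def u_def u'_def v_def v'_def e_def s_def q_def mult_ac)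
  qed
  have m2: "macdonald_product \<kappa> p \<theta> (of_real x + \<i> * of_real (pi / 2)) = q * ((u' * A1 - u * A2) * (v' * B1 - v * B2))"
  proof -
    have "of_real x + \<i> * of_real (pi / 2) + \<i> * of_real \<theta> = l + \<i> * of_real (pi / 2)"
      "of_real x + \<i> * of_real (pi / 2) - \<i> * of_real \<theta> = cnj l + \<i> * of_real (pi / 2)" by (simp_all add: l_def)
    then show ?thesis
      unfolding macdonald_product_def \<nu>_def[symmetric] by (simp only: macdonald_log_rotate(2) sin_pi_add_int(1,2))
        (simp only: A1_def A2_def B1_def B2_def u_def u'_def v_def v'_def e_def s_def q_def mult_ac)
  qed
  have "macdonald_product \<kappa> p \<theta> (of_real x - \<i> * of_real (pi / 2)) - macdonald_product \<kappa> p \<theta> (of_real x + \<i> * of_real (pi / 2))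
     = q * ((u * v - u' * v') * (A1 * B1 - A2 * B2) - (u * v' - u' * v) * (A1 * B2 - A2 * B1))"
    unfolding m1 m2 by (simp add: algebra_simps)
  also have "\<dots> = \<i> * (2 * (q * s) * (A1 * B1 - A2 * B2))"
    unfolding uv uv' by (simp add: mult_ac)
  also have "2 * (q * s) * (A1 * B1 - A2 * B2) = bold_J \<nu> p (exp l)"
  proof -
    have "bold_J \<nu> p (exp l) = bold_J_quot \<nu> p (exp l)" using s0 by (simp add: bold_J_def s_def)
    also have "\<dots> = 2 * of_real pi ^ 2 / s * (A1 * B1 - A2 * B2)"
      unfolding bold_J_quot_def bessel_J2_branch[OF refl] s_def[symmetric] A1_def A2_def B1_def B2_def by simp
    finally show ?thesis unfolding q by simp
  qed
  finally show ?thesis unfolding \<nu>_def l_def by simp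
qed

section \<open>Angular Fourier coefficients of the dual kernel\<close>

definition angular_coeff :: "int \<Rightarrow> complex \<Rightarrow> real \<Rightarrow> complex" where
  "angular_coeff p z r = (LINT \<omega>:{0..<pi}|lborel. of_real (cos (2 * Re (z * trh r \<omega>))) * exp (- (2 * \<i> * of_int p * of_real \<omega>)))"

text \<open>
  The expression is symmetric in the angle \<open>\<omega>\<close> and the argument \<open>\<theta>\<close> of \<open>z\<close>; as a function of \<open>\<omega>\<close> it is a
  pure cosine, shifted by \<open>arg \<zeta>\<close>.
\<close>

lemma Re_mult_trh:
  "Re (exp (of_real x + \<i> * of_real \<theta>) * trh r \<omega>) = exp x * norm (zeta \<theta> r) * cos (\<omega> + zeta_arg \<theta> r)"
proof -
  have "Re (zeta \<theta> r) = norm (zeta \<theta> r) * cos (zeta_arg \<theta> r)"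
    using arg_cong[OF zeta_polar[of \<theta> r], of Re] by (simp add: Re_exp)
  moreover have "Im (zeta \<theta> r) = norm (zeta \<theta> r) * sin (zeta_arg \<theta> r)"
    using arg_cong[OF zeta_polar[of \<theta> r], of Im] by (simp add: Im_exp)
  ultimately have "norm (zeta \<theta> r) * cos (\<omega> + zeta_arg \<theta> r) = cos \<omega> * (cosh r * cos \<theta>) - sin \<omega> * (sinh r * sin \<theta>)"
    by (simp add: zeta_Complex cos_add algebra_simps)
  moreover have "Re (exp (of_real x + \<i> * of_real \<theta>) * trh r \<omega>) = exp x * (cos \<omega> * (cosh r * cos \<theta>) - sin \<omega> * (sinh r * sin \<theta>))"
    by (simp add: trh_def Re_exp Im_exp algebra_simps)
  ultimately show ?thesis by (simp only: mult.assoc)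
qed

lemma integral_atLeastLessThan_eq:
  fixes f :: "real \<Rightarrow> complex"
  assumes "continuous_on UNIV f"
  shows "(LINT x:{a..<b}|lborel. f x) = (LINT x:{a..b}|lborel. f x)"
  unfolding set_lebesgue_integral_def
proof (rule integral_cong_AE)
  have [measurable]: "f \<in> borel_measurable borel" using assms by (rule borel_measurable_continuous_onI)
  show "(\<lambda>x. indicator {a..<b} x *\<^sub>R f x) \<in> borel_measurable lborel"
    "(\<lambda>x. indicator {a..b} x *\<^sub>R f x) \<in> borel_measurable lborel" by measurable
  show "AE x in lborel. indicator {a..<b} x *\<^sub>R f x = indicator {a..b} x *\<^sub>R f x"
    using AE_lborel_singleton[of b] by eventually_elim (auto simp: indicator_def)
qed

text \<open>
  After the shift by \<open>arg \<zeta>\<close> the integrand is a \<open>\<pi>\<close>-periodic function integrated over a period, so the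
  shift only contributes a phase.
\<close>

lemma angular_coeff_eq:
  "angular_coeff p (exp (of_real x + \<i> * of_real \<theta>)) r =
     exp (2 * \<i> * of_int p * of_real (zeta_arg \<theta> r)) * of_real (bessel_angle p (2 * exp x * norm (zeta \<theta> r)))"
proof -
  define R where "R = 2 * exp x * norm (zeta \<theta> r)"
  define \<phi> where "\<phi> = zeta_arg \<theta> r"
  define g where "g = (\<lambda>w::complex. cos (of_real R * cos w) * exp (- (2 * \<i> * of_int p * w)))"
  have hol: "g holomorphic_on UNIV" unfolding g_def by (intro holomorphic_intros)
  obtain G where G: "\<And>w. (G has_field_derivative g w) (at w)"
    using holomorphic_convex_primitive'[OF convex_UNIV open_UNIV hol] by auto
  have ep: "exp (- (2 * \<i> * of_int p * complex_of_real pi)) = 1"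
    using exp_2pi_1_int[of "- p"] by (simp add: mult_ac)
  have per: "g (w + of_real pi) = g w" for w
  proof -
    have "exp (- (2 * \<i> * of_int p * (w + of_real pi))) = exp (- (2 * \<i> * of_int p * w)) * exp (- (2 * \<i> * of_int p * of_real pi))"
      unfolding mult_exp_exp by (rule arg_cong[where f = exp]) (simp add: algebra_simps)
    then have "exp (- (2 * \<i> * of_int p * (w + of_real pi))) = exp (- (2 * \<i> * of_int p * w))" unfolding ep by simp
    moreover have "cos (w + complex_of_real pi) = - cos w"
      by (simp add: cos_add flip: cos_of_real sin_of_real)
    ultimately show ?thesis unfolding g_def by simp
  qed
  have gr: "g (of_real t) = of_real (cos (R * cos t)) * exp (- (2 * \<i> * of_int p * of_real t))" for t
    unfolding g_def by (simp only: cos_of_real of_real_mult[symmetric])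
  have "((\<lambda>w. G (w + of_real pi) - G w) has_field_derivative 0) (at w)" for w
  proof -
    have "((\<lambda>w. G (w + of_real pi)) has_field_derivative g (w + of_real pi) * 1) (at w)"
      by (rule DERIV_chain2[OF G]) (auto intro!: derivative_eq_intros)
    from DERIV_diff[OF this G[of w]] show ?thesis by (simp add: per)
  qed
  \<comment> \<open>the integral over a period starting at \<open>w\<close> is constant in \<open>w\<close>\<close>
  then obtain c where c: "\<And>w. G (w + of_real pi) - G w = c"
    using has_field_derivative_zero_constant[of UNIV "\<lambda>w. G (w + of_real pi) - G w"] by auto
  have cont: "continuous_on UNIV (\<lambda>\<omega>. g (of_real \<omega> + w))" for w by (rule entire_line_continuous[OF hol])
  have shift: "(LINT \<omega>:{0..pi}|lborel. g (of_real \<omega> + w)) = c" for w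
    using integral_horizontal[OF G, of 0 pi w] c[of w] by (simp add: add.commute)
  have "c = of_real (bessel_angle p R)"
  proof -
    have c0: "c = (\<integral>\<omega>. indicator {0..pi} \<omega> *\<^sub>R g (of_real \<omega>) \<partial>lborel)"
      using shift[of 0] by (simp add: set_lebesgue_integral_def)
    also have "\<dots> = (\<integral>\<omega>. indicator {0..pi} (pi + (-1) * \<omega>) *\<^sub>R g (of_real (pi + (-1) * \<omega>)) \<partial>lborel)"
      by (subst lborel_integral_real_affine[where c = "-1" and t = pi]) auto
    also have "\<dots> = (\<integral>\<omega>. cnj (indicator {0..pi} \<omega> *\<^sub>R g (of_real \<omega>)) \<partial>lborel)"
    proof (rule Bochner_Integration.integral_cong[OF refl])
      fix \<omega> :: real
      have "g (of_real (pi + (-1) * \<omega>)) = g (of_real (- \<omega>) + of_real pi)" by (simp add: add.commute)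
      also have "\<dots> = g (of_real (- \<omega>))" by (rule per)
      also have "\<dots> = cnj (g (of_real \<omega>))" unfolding gr by (simp add: exp_cnj)
      finally have "g (of_real (pi + (-1) * \<omega>)) = cnj (g (of_real \<omega>))" .
      moreover have "indicator {0..pi} (pi + (-1) * \<omega>) = (indicator {0..pi} \<omega> :: real)" by (auto simp: indicator_def)
      ultimately show "indicator {0..pi} (pi + (-1) * \<omega>) *\<^sub>R g (of_real (pi + (-1) * \<omega>)) = cnj (indicator {0..pi} \<omega> *\<^sub>R g (of_real \<omega>))"
        by simp
    qed
    also have "\<dots> = cnj c" unfolding c0 by (rule Bochner_Integration.integral_cnj)
    finally have "Im c = 0" by (metis complex_cnj_cancel_iff Im_complex_of_real Reals_cnj_iff complex_is_Real_iff)
    moreover have "Re c = bessel_angle p R"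
    proof -
      have "integrable lborel (\<lambda>\<omega>. indicator {0..pi} \<omega> *\<^sub>R g (of_real \<omega>))"
        using lebesgue_eq_HK_interval(1)[OF continuous_on_subset[OF cont[of 0] subset_UNIV], of 0 pi] by (simp add: set_integrable_def)
      then have "Re c = (\<integral>\<omega>. Re (indicator {0..pi} \<omega> *\<^sub>R g (of_real \<omega>)) \<partial>lborel)"
        unfolding c0 by (rule integral_Re[symmetric])
      also have "\<dots> = bessel_angle p R"
        unfolding bessel_angle_def set_lebesgue_integral_def
        by (intro Bochner_Integration.integral_cong) (auto simp: gr Re_exp mult_ac)
      finally show ?thesis .
    qed
    ultimately show ?thesis by (simp add: complex_eq_iff)
  qed
  note c_eq = this
  have "angular_coeff p (exp (of_real x + \<i> * of_real \<theta>)) r = (LINT \<omega>:{0..<pi}|lborel. exp (2 * \<i> * of_int p * of_real \<phi>) * g (of_real \<omega> + of_real \<phi>))"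
    unfolding angular_coeff_def
  proof (rule set_lebesgue_integral_cong)
    have "of_real (cos (2 * Re (exp (of_real x + \<i> * of_real \<theta>) * trh r \<omega>))) * exp (- (2 * \<i> * of_int p * of_real \<omega>))
       = exp (2 * \<i> * of_int p * of_real \<phi>) * g (of_real \<omega> + of_real \<phi>)" for \<omega>
    proof -
      have e: "exp (- (2 * \<i> * of_int p * of_real \<omega>)) = exp (2 * \<i> * of_int p * of_real \<phi>) * exp (- (2 * \<i> * of_int p * complex_of_real (\<omega> + \<phi>)))"
        unfolding mult_exp_exp by (rule arg_cong[where f = exp]) (simp add: algebra_simps)
      have "2 * Re (exp (of_real x + \<i> * of_real \<theta>) * trh r \<omega>) = R * cos (\<omega> + \<phi>)"
        unfolding Re_mult_trh R_def \<phi>_def by simp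
      then show ?thesis unfolding e of_real_add[symmetric] gr by (simp only: mult_ac)
    qed
    then show "\<forall>\<omega>. \<omega> \<in> {0..<pi} \<longrightarrow> of_real (cos (2 * Re (exp (of_real x + \<i> * of_real \<theta>) * trh r \<omega>))) * exp (- (2 * \<i> * of_int p * of_real \<omega>))
       = exp (2 * \<i> * of_int p * of_real \<phi>) * g (of_real \<omega> + of_real \<phi>)" by blast
  qed auto
  also have "\<dots> = exp (2 * \<i> * of_int p * of_real \<phi>) * (LINT \<omega>:{0..<pi}|lborel. g (of_real \<omega> + of_real \<phi>))" by simp
  also have "(LINT \<omega>:{0..<pi}|lborel. g (of_real \<omega> + of_real \<phi>)) = of_real (bessel_angle p R)"
    unfolding integral_atLeastLessThan_eq[OF cont] shift c_eq ..
  finally show ?thesis unfolding \<phi>_def R_def .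
qed

lemma norm_zeta_ge_sinh: "norm (zeta \<theta> r) \<ge> \<bar>sinh r\<bar>"
proof -
  have c: "(cosh r)\<^sup>2 = (sinh r)\<^sup>2 + 1" by (rule cosh_square_eq)
  have "(norm (zeta \<theta> r))\<^sup>2 = (cosh r)\<^sup>2 * (cos \<theta>)\<^sup>2 + (sinh r)\<^sup>2 * (sin \<theta>)\<^sup>2"
    by (simp add: zeta_Complex cmod_power2 power_mult_distrib)
  also have "\<dots> = (sinh r)\<^sup>2 * ((sin \<theta>)\<^sup>2 + (cos \<theta>)\<^sup>2) + (cos \<theta>)\<^sup>2" unfolding c by (simp only: distrib_left distrib_right)
  finally have "(sinh r)\<^sup>2 \<le> (norm (zeta \<theta> r))\<^sup>2" by simp
  then show ?thesis using abs_le_square_iff[of "sinh r" "norm (zeta \<theta> r)"] by simp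
qed

lemma bessel_angle_le_pi: "\<bar>bessel_angle p R\<bar> \<le> pi"
proof -
  have "norm (integral {0..pi} (\<lambda>\<tau>. cos (R * cos \<tau>) * cos (2 * of_int p * \<tau>))) \<le> 1 * (pi - 0)"
  proof (rule integral_bound)
    show "continuous_on {0..pi} (\<lambda>\<tau>. cos (R * cos \<tau>) * cos (2 * of_int p * \<tau>))" by (intro continuous_intros)
    fix t show "norm (cos (R * cos t) * cos (2 * of_int p * t)) \<le> 1"
      using mult_mono[of "\<bar>cos (R * cos t)\<bar>" 1 "\<bar>cos (2 * of_int p * t)\<bar>" 1] by (simp add: abs_mult)
  qed simp
  moreover have "bessel_angle p R = integral {0..pi} (\<lambda>\<tau>. cos (R * cos \<tau>) * cos (2 * of_int p * \<tau>))"
    unfolding bessel_angle_def by (rule lebesgue_eq_HK_interval(2)) (intro continuous_intros)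
  ultimately show ?thesis by simp
qed

text \<open>
  For \<open>\<bar>r\<bar> > 1\<close> the bound \<open>R\<^sup>-\<^sup>1\<^sup>/\<^sup>2\<close> on Bessel's integral is used with \<open>R \<ge> exp x exp \<bar>r\<bar> / 2\<close>; near \<open>r = 0\<close> the
  argument may vanish and the trivial bound \<open>\<pi>\<close> takes over. No constant depends on \<open>\<theta>\<close>.
\<close>

lemma angular_coeff_polar_bound:
  "norm (angular_coeff p (exp (of_real x + \<i> * of_real \<theta>)) r) \<le>
     (8 + 14 / sqrt (exp x / 2)) * (1 + 2 * \<bar>of_int p\<bar>) * exp (- (1 / 2 * \<bar>r\<bar>))"
proof -
  define R where "R = 2 * exp x * norm (zeta \<theta> r)"
  define q where "q = 1 + 2 * \<bar>real_of_int p\<bar>"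
  have q: "q \<ge> 1" by (simp add: q_def)
  have "norm (angular_coeff p (exp (of_real x + \<i> * of_real \<theta>)) r) = \<bar>bessel_angle p R\<bar>"
    unfolding angular_coeff_eq R_def by (simp add: norm_mult)
  also have "\<dots> \<le> (8 + 14 / sqrt (exp x / 2)) * q * exp (- (1 / 2 * \<bar>r\<bar>))"
  proof (cases "\<bar>r\<bar> \<le> 1")
    case True
    have "exp (1 / 2 * \<bar>r\<bar>) \<le> exp (1 / 2)" using True by simp
    also have "\<dots> \<le> 1 + 1/2 + (1/2)\<^sup>2" by (rule exp_bound) auto
    also have "\<dots> \<le> 2" by (simp add: power2_eq_square)
    finally have e: "exp (1 / 2 * \<bar>r\<bar>) \<le> 2" .
    have "\<bar>bessel_angle p R\<bar> \<le> 4" using bessel_angle_le_pi[of p R] pi_less_4 by linarith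
    also have "4 \<le> 8 * 1 * exp (- (1 / 2 * \<bar>r\<bar>))" using e by (simp add: exp_minus field_simps)
    also have "\<dots> \<le> (8 + 14 / sqrt (exp x / 2)) * q * exp (- (1 / 2 * \<bar>r\<bar>))"
      using q by (intro mult_right_mono mult_mono) auto
    finally show ?thesis .
  next
    case False
    have "exp \<bar>r\<bar> / 4 \<le> \<bar>sinh r\<bar>"
    proof -
      have "1 + \<bar>r\<bar> \<le> exp \<bar>r\<bar>" by (rule exp_ge_add_one_self)
      then have e2: "2 \<le> exp \<bar>r\<bar>" using False by linarith
      then have "exp (- \<bar>r\<bar>) \<le> inverse 2" unfolding exp_minus by (intro le_imp_inverse_le) auto
      then have "exp (- \<bar>r\<bar>) \<le> exp \<bar>r\<bar> / 2" using e2 by simp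
      then have "exp \<bar>r\<bar> / 4 \<le> sinh \<bar>r\<bar>" by (simp add: sinh_field_def)
      then show ?thesis by (simp add: sinh_real_abs)
    qed
    then have "exp \<bar>r\<bar> / 4 \<le> norm (zeta \<theta> r)" using norm_zeta_ge_sinh[of r \<theta>] by linarith
    then have "2 * exp x * (exp \<bar>r\<bar> / 4) \<le> R" unfolding R_def by (intro mult_left_mono) auto
    then have Rge: "exp x / 2 * exp \<bar>r\<bar> \<le> R" by simp
    have pos: "0 < exp x / 2 * exp \<bar>r\<bar>" by simp
    have R0: "R > 0" using Rge pos by linarith
    have "\<bar>bessel_angle p R\<bar> \<le> 14 * q / sqrt R" unfolding q_def by (rule bessel_angle_bound[OF R0])
    also have "\<dots> \<le> 14 * q / sqrt (exp x / 2 * exp \<bar>r\<bar>)"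
      using Rge R0 q by (intro divide_left_mono mult_pos_pos) (auto simp: real_sqrt_gt_zero)
    also have "sqrt (exp x / 2 * exp \<bar>r\<bar>) = sqrt (exp x / 2) * exp (1 / 2 * \<bar>r\<bar>)"
    proof -
      have "exp \<bar>r\<bar> = (exp (1 / 2 * \<bar>r\<bar>))\<^sup>2" by (simp add: power2_eq_square flip: exp_add)
      then have "sqrt (exp \<bar>r\<bar>) = exp (1 / 2 * \<bar>r\<bar>)" by simp
      then show ?thesis by (simp only: real_sqrt_mult)
    qed
    also have "14 * q / (sqrt (exp x / 2) * exp (1 / 2 * \<bar>r\<bar>)) = (14 / sqrt (exp x / 2)) * q * exp (- (1 / 2 * \<bar>r\<bar>))"
      unfolding exp_minus by (simp only: divide_inverse inverse_mult_distrib mult_ac)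
    also have "\<dots> \<le> (8 + 14 / sqrt (exp x / 2)) * q * exp (- (1 / 2 * \<bar>r\<bar>))"
      using q by (intro mult_right_mono) auto
    finally show ?thesis .
  qed
  finally show ?thesis unfolding q_def .
qed

lemma angular_coeff_tendsto:
  assumes "Z \<longlonglongrightarrow> z" "T \<longlonglongrightarrow> r"
  shows "(\<lambda>k. angular_coeff p (Z k) (T k)) \<longlonglongrightarrow> angular_coeff p z r"
  unfolding angular_coeff_def set_lebesgue_integral_def
proof (rule integral_dominated_convergence[where w = "\<lambda>\<tau>. indicator {0..<pi} \<tau> *\<^sub>R (1::real)"])
  have m: "(\<lambda>\<omega>. indicator {0..<pi} \<omega> *\<^sub>R (complex_of_real (cos (2 * Re (w * trh s \<omega>))) * exp (- (2 * \<i> * of_int p * of_real \<omega>)))) \<in> borel_measurable borel" for w s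
  proof -
    have "continuous_on UNIV (\<lambda>\<omega>. complex_of_real (cos (2 * Re (w * trh s \<omega>))) * exp (- (2 * \<i> * of_int p * of_real \<omega>)))"
      unfolding trh_def by (intro continuous_intros)
    from borel_measurable_continuous_onI[OF this] show ?thesis
      by (intro borel_measurable_scaleR) auto
  qed
  then show "(\<lambda>\<omega>. indicator {0..<pi} \<omega> *\<^sub>R (complex_of_real (cos (2 * Re (z * trh r \<omega>))) * exp (- (2 * \<i> * of_int p * of_real \<omega>)))) \<in> borel_measurable lborel"
    "(\<lambda>\<omega>. indicator {0..<pi} \<omega> *\<^sub>R (complex_of_real (cos (2 * Re (Z k * trh (T k) \<omega>))) * exp (- (2 * \<i> * of_int p * of_real \<omega>)))) \<in> borel_measurable lborel" for k
    by simp_all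
  have "integrable lborel (indicator {0..<pi} :: real \<Rightarrow> real)" by (rule integrable_real_indicator) auto
  then show "integrable lborel (\<lambda>\<tau>. indicator {0..<pi} \<tau> *\<^sub>R (1::real))" by simp
  have "(\<lambda>k. indicator {0..<pi} \<omega> *\<^sub>R (complex_of_real (cos (2 * Re (Z k * trh (T k) \<omega>))) * exp (- (2 * \<i> * of_int p * of_real \<omega>)))) \<longlonglongrightarrow>
     indicator {0..<pi} \<omega> *\<^sub>R (complex_of_real (cos (2 * Re (z * trh r \<omega>))) * exp (- (2 * \<i> * of_int p * of_real \<omega>)))" for \<omega>
    unfolding trh_def sinh_field_def cosh_field_def by (intro tendsto_intros assms) auto
  then show "AE \<omega> in lborel. (\<lambda>k. indicator {0..<pi} \<omega> *\<^sub>R (complex_of_real (cos (2 * Re (Z k * trh (T k) \<omega>))) * exp (- (2 * \<i> * of_int p * of_real \<omega>)))) \<longlonglongrightarrow>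
     indicator {0..<pi} \<omega> *\<^sub>R (complex_of_real (cos (2 * Re (z * trh r \<omega>))) * exp (- (2 * \<i> * of_int p * of_real \<omega>)))" by simp
  show "AE \<omega> in lborel. norm (indicator {0..<pi} \<omega> *\<^sub>R (complex_of_real (cos (2 * Re (Z k * trh (T k) \<omega>))) * exp (- (2 * \<i> * of_int p * of_real \<omega>)))) \<le> indicator {0..<pi} \<omega> *\<^sub>R 1" for k
    by (intro AE_I2) (auto simp: indicator_def norm_mult)
qed

lemma angular_coeff_continuous: "continuous_on UNIV (angular_coeff p z)"
  unfolding continuous_on_sequentially comp_def using angular_coeff_tendsto by blast

lemma angular_coeff_measurable [measurable]: "angular_coeff p z \<in> borel_measurable borel"
  by (rule borel_measurable_continuous_onI) (rule angular_coeff_continuous)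

section \<open>The integral representation of the kernel\<close>

lemma bold_J_integral_right_half_plane:
  assumes k: "\<kappa> \<noteq> 0" and th: "\<bar>\<theta>\<bar> < pi / 2"
  shows "bold_J (\<i> * of_real \<kappa>) p (exp (of_real x + \<i> * of_real \<theta>)) =
    4 * (\<integral>r. exp (- 2 * (\<i> * of_real \<kappa>) * of_real r) * angular_coeff p (exp (of_real x + \<i> * of_real \<theta>)) r \<partial>lborel)"
proof -
  have "phase \<kappa> p \<theta> r * of_real (bessel_angle p (2 * exp x * norm (zeta \<theta> r))) =
     exp (- 2 * (\<i> * of_real \<kappa>) * of_real r) * angular_coeff p (exp (of_real x + \<i> * of_real \<theta>)) r" for r
    unfolding phase_def angular_coeff_eq by (simp only: mult.assoc)
  then have "\<i> * bold_J (\<i> * of_real \<kappa>) p (exp (of_real x + \<i> * of_real \<theta>)) =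
    4 * \<i> * (\<integral>r. exp (- 2 * (\<i> * of_real \<kappa>) * of_real r) * angular_coeff p (exp (of_real x + \<i> * of_real \<theta>)) r \<partial>lborel)"
    unfolding bold_J_product[OF k] product_boundary_jump[OF k th] by simp
  then have "\<i> * bold_J (\<i> * of_real \<kappa>) p (exp (of_real x + \<i> * of_real \<theta>)) =
    \<i> * (4 * (\<integral>r. exp (- 2 * (\<i> * of_real \<kappa>) * of_real r) * angular_coeff p (exp (of_real x + \<i> * of_real \<theta>)) r \<partial>lborel))"
    by (simp only: mult_ac)
  then show ?thesis unfolding mult_cancel_left by simp
qed

text \<open>
  The product formula is available for \<open>\<bar>\<theta>\<bar> < \<pi> / 2\<close> only, but both sides are continuous in \<open>\<theta>\<close>.
\<close>

lemma bold_J_integral_closed_half_plane: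
  assumes k: "\<kappa> \<noteq> 0" and th: "\<bar>\<theta>\<bar> \<le> pi / 2"
  shows "bold_J (\<i> * of_real \<kappa>) p (exp (of_real x + \<i> * of_real \<theta>)) =
    4 * (\<integral>r. exp (- 2 * (\<i> * of_real \<kappa>) * of_real r) * angular_coeff p (exp (of_real x + \<i> * of_real \<theta>)) r \<partial>lborel)"
proof -
  obtain T where T: "\<And>k. \<bar>T k\<bar> < pi / 2" "T \<longlonglongrightarrow> \<theta>"
  proof (cases "\<bar>\<theta>\<bar> < pi / 2")
    case True
    then show ?thesis using that[of "\<lambda>_. \<theta>"] by simp
  next
    case False
    then have "\<theta> = pi / 2 \<or> \<theta> = - (pi / 2)" using th by linarith
    then show ?thesis
    proof
      assume e: "\<theta> = pi / 2"
      show ?thesis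
      proof (rule that)
        show "\<bar>angle_seq k\<bar> < pi / 2" for k using angle_seq(1,2)[of k] by linarith
        show "angle_seq \<longlonglongrightarrow> \<theta>" unfolding e by (rule angle_seq(3))
      qed
    next
      assume e: "\<theta> = - (pi / 2)"
      show ?thesis
      proof (rule that)
        show "\<bar>- angle_seq k\<bar> < pi / 2" for k using angle_seq(1,2)[of k] by linarith
        show "(\<lambda>k. - angle_seq k) \<longlonglongrightarrow> \<theta>" unfolding e by (rule tendsto_minus[OF angle_seq(3)])
      qed
    qed
  qed
  define E where "E = (\<lambda>\<theta>. exp (complex_of_real x + \<i> * of_real \<theta>))"
  have Elim: "(\<lambda>k. E (T k)) \<longlonglongrightarrow> E \<theta>" unfolding E_def by (intro tendsto_intros T)
  have lhs: "(\<lambda>k. \<i> * bold_J (\<i> * of_real \<kappa>) p (E (T k))) \<longlonglongrightarrow> \<i> * bold_J (\<i> * of_real \<kappa>) p (E \<theta>)"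
  proof -
    have c: "isCont (macdonald_log \<mu>) w" for \<mu> w
      using holomorphic_on_imp_continuous_on[OF macdonald_log_holomorphic[of \<mu> UNIV]]
      by (simp add: continuous_on_eq_continuous_at)
    show ?thesis
      unfolding E_def bold_J_product[OF k] macdonald_product_def
      by (intro tendsto_diff tendsto_mult isCont_tendsto_compose[OF c] tendsto_intros T)
  qed
  have rhs: "(\<lambda>k. \<integral>r. exp (- 2 * (\<i> * of_real \<kappa>) * of_real r) * angular_coeff p (E (T k)) r \<partial>lborel) \<longlonglongrightarrow>
     (\<integral>r. exp (- 2 * (\<i> * of_real \<kappa>) * of_real r) * angular_coeff p (E \<theta>) r \<partial>lborel)"
  proof (rule integral_dominated_convergence)
    have m: "(\<lambda>r. exp (- 2 * (\<i> * of_real \<kappa>) * of_real r) * angular_coeff p w r) \<in> borel_measurable lborel" for w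
      by measurable
    show "(\<lambda>r. exp (- 2 * (\<i> * of_real \<kappa>) * of_real r) * angular_coeff p (E \<theta>) r) \<in> borel_measurable lborel" by (rule m)
    show "(\<lambda>r. exp (- 2 * (\<i> * of_real \<kappa>) * of_real r) * angular_coeff p (E (T k)) r) \<in> borel_measurable lborel" for k by (rule m)
    show "integrable lborel (\<lambda>r. (8 + 14 / sqrt (exp x / 2)) * (1 + 2 * \<bar>of_int p\<bar>) * exp (- (1 / 2 * \<bar>r\<bar>)))"
      by (intro integrable_mult_right integrable_exp_neg_abs) auto
    show "AE r in lborel. (\<lambda>k. exp (- 2 * (\<i> * of_real \<kappa>) * of_real r) * angular_coeff p (E (T k)) r) \<longlonglongrightarrow> exp (- 2 * (\<i> * of_real \<kappa>) * of_real r) * angular_coeff p (E \<theta>) r"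
      by (intro AE_I2 tendsto_mult tendsto_const angular_coeff_tendsto Elim)
    show "AE r in lborel. norm (exp (- 2 * (\<i> * of_real \<kappa>) * of_real r) * angular_coeff p (E (T k)) r) \<le> (8 + 14 / sqrt (exp x / 2)) * (1 + 2 * \<bar>of_int p\<bar>) * exp (- (1 / 2 * \<bar>r\<bar>))" for k
      unfolding norm_mult E_def by (intro AE_I2) (use angular_coeff_polar_bound in simp)
  qed
  have "(\<lambda>k. \<i> * bold_J (\<i> * of_real \<kappa>) p (E (T k))) \<longlonglongrightarrow>
     \<i> * (4 * (\<integral>r. exp (- 2 * (\<i> * of_real \<kappa>) * of_real r) * angular_coeff p (E \<theta>) r \<partial>lborel))"
    unfolding E_def bold_J_integral_right_half_plane[OF k T(1)]
    by (intro tendsto_mult tendsto_const rhs[unfolded E_def])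
  with lhs have "\<i> * bold_J (\<i> * of_real \<kappa>) p (E \<theta>) = \<i> * (4 * (\<integral>r. exp (- 2 * (\<i> * of_real \<kappa>) * of_real r) * angular_coeff p (E \<theta>) r \<partial>lborel))"
    by (rule LIMSEQ_unique)
  then show ?thesis unfolding E_def mult_cancel_left by simp
qed

text \<open>
  Passing from \<open>z\<close> to \<open>- z\<close> multiplies the two factors by phases whose product is \<open>exp (2 \<pi> \<i> p) = 1\<close>.
\<close>

lemma bessel_J2_minus:
  assumes "z \<noteq> 0"
  shows "bessel_J2 \<nu> p (- z) = bessel_J2 \<nu> p z"
proof -
  have s: "bessel_J_log \<mu> (l + \<i> * of_real pi) = exp (\<i> * of_real pi * \<mu>) * bessel_J_log \<mu> l"
    "bessel_J_log \<mu> (l - \<i> * of_real pi) = exp (- (\<i> * of_real pi * \<mu>)) * bessel_J_log \<mu> l" for \<mu> l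
  proof -
    define d where "d = l - of_real (ln 2)"
    have d: "l + \<i> * of_real pi - of_real (ln 2) = d + \<i> * of_real pi" "l - \<i> * of_real pi - of_real (ln 2) = d - \<i> * of_real pi"
      by (simp_all add: d_def)
    have e1: "exp (2 * (d + \<i> * of_real pi)) = exp (2 * d)" "exp (2 * (d - \<i> * of_real pi)) = exp (2 * d)"
      using exp_2pi_1_int[of 1] by (simp_all add: ring_distribs exp_add exp_diff mult_ac)
    have e2: "exp (\<mu> * (d + \<i> * of_real pi)) = exp (\<i> * of_real pi * \<mu>) * exp (\<mu> * d)" "exp (\<mu> * (d - \<i> * of_real pi)) = exp (- (\<i> * of_real pi * \<mu>)) * exp (\<mu> * d)"
      unfolding mult_exp_exp by (rule arg_cong[where f = exp], simp add: algebra_simps)+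
    show "bessel_J_log \<mu> (l + \<i> * of_real pi) = exp (\<i> * of_real pi * \<mu>) * bessel_J_log \<mu> l"
      "bessel_J_log \<mu> (l - \<i> * of_real pi) = exp (- (\<i> * of_real pi * \<mu>)) * bessel_J_log \<mu> l"
      unfolding bessel_J_log_eq_ser d unfolding e1 unfolding e2 d_def[symmetric] by (simp_all only: mult.assoc)
  qed
  have "exp (Ln z + \<i> * of_real pi) = - z" using assms by (simp add: exp_add)
  then have "bessel_J2 \<nu> p (- z) = bessel_J_log (\<nu> + of_int p) (Ln z + \<i> * of_real pi) * bessel_J_log (\<nu> - of_int p) (cnj (Ln z + \<i> * of_real pi))"
    by (rule bessel_J2_branch)
  also have "cnj (Ln z + \<i> * of_real pi) = cnj (Ln z) - \<i> * of_real pi" by simp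
  also have "bessel_J_log (\<nu> + of_int p) (Ln z + \<i> * of_real pi) * bessel_J_log (\<nu> - of_int p) (cnj (Ln z) - \<i> * of_real pi)
     = (exp (\<i> * of_real pi * (\<nu> + of_int p)) * exp (- (\<i> * of_real pi * (\<nu> - of_int p)))) * bessel_J2 \<nu> p z"
    unfolding s bessel_J2_def by (simp only: mult_ac)
  also have "exp (\<i> * of_real pi * (\<nu> + of_int p)) * exp (- (\<i> * of_real pi * (\<nu> - of_int p))) = exp (\<i> * of_real pi * of_int p) * exp (\<i> * of_real pi * of_int p)"
    unfolding mult_exp_exp by (rule arg_cong[where f = exp]) (simp add: algebra_simps)
  also have "\<dots> = 1" by (rule sin_pi_add_int(3))
  finally show ?thesis by simp
qed

lemma bold_J_minus:
  assumes "z \<noteq> 0" "\<kappa> \<noteq> 0"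
  shows "bold_J (\<i> * of_real \<kappa>) p (- z) = bold_J (\<i> * of_real \<kappa>) p z"
  using sin_pi_imaginary_nonzero[OF assms(2), of 0]
  by (simp add: bold_J_def bold_J_quot_def bessel_J2_minus[OF assms(1)])

lemma angular_coeff_minus: "angular_coeff p (- z) = angular_coeff p z"
  by (rule ext) (simp only: angular_coeff_def mult_minus_left uminus_complex.sel mult_minus_right cos_minus)

lemma polar_up_to_sign:
  assumes "z \<noteq> 0"
  obtains x \<theta> where "\<bar>\<theta>\<bar> \<le> pi / 2" "z = exp (of_real x + \<i> * of_real \<theta>) \<or> z = - exp (of_real x + \<i> * of_real \<theta>)"
proof -
  have ex: "\<exists>x \<theta>. \<bar>\<theta>\<bar> \<le> pi / 2 \<and> w = exp (of_real x + \<i> * of_real \<theta>)" if "w \<noteq> 0" "Re w \<ge> 0" for w :: complex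
  proof (intro exI conjI)
    show "\<bar>Im (Ln w)\<bar> \<le> pi / 2" using that Re_Ln_pos_le by blast
    have "Ln w = of_real (Re (Ln w)) + \<i> * of_real (Im (Ln w))" by (rule complex_eq)
    then show "w = exp (of_real (Re (Ln w)) + \<i> * of_real (Im (Ln w)))" using that by (metis exp_Ln)
  qed
  show ?thesis
  proof (cases "Re z \<ge> 0")
    case True
    then show ?thesis using ex[OF assms] that by blast
  next
    case False
    then obtain x \<theta> where "\<bar>\<theta>\<bar> \<le> pi / 2" "- z = exp (of_real x + \<i> * of_real \<theta>)" using ex[of "- z"] assms by auto
    then show ?thesis using that by (metis minus_minus)
  qed
qed

text \<open>
  At \<open>\<kappa> = 0\<close> the kernel is defined by a limit, and sine denominators vanish throughout; this single
  value is irrelevant for integrals over \<open>\<kappa>\<close>.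
\<close>

theorem bold_J_integral:
  assumes "\<kappa> \<noteq> 0" "z \<noteq> 0"
  shows "bold_J (\<i> * of_real \<kappa>) p z = 4 * (\<integral>r. exp (- 2 * (\<i> * of_real \<kappa>) * of_real r) * angular_coeff p z r \<partial>lborel)"
proof -
  obtain x \<theta> where th: "\<bar>\<theta>\<bar> \<le> pi / 2" "z = exp (of_real x + \<i> * of_real \<theta>) \<or> z = - exp (of_real x + \<i> * of_real \<theta>)"
    using polar_up_to_sign[OF assms(2)] by blast
  from th(2) show ?thesis
  proof
    assume "z = exp (of_real x + \<i> * of_real \<theta>)"
    then show ?thesis using bold_J_integral_closed_half_plane[OF assms(1) th(1)] by simp
  next
    assume "z = - exp (of_real x + \<i> * of_real \<theta>)"
    then show ?thesis using bold_J_integral_closed_half_plane[OF assms(1) th(1)] bold_J_minus[OF _ assms(1)] angular_coeff_minus by simp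
  qed
qed

lemma angular_coeff_decay:
  assumes "z \<noteq> 0"
  obtains C where "C \<ge> 0" "\<And>p r. norm (angular_coeff p z r) \<le> C * (1 + 2 * \<bar>of_int p\<bar>) * exp (- (1 / 2 * \<bar>r\<bar>))"
proof -
  obtain x \<theta> where th: "z = exp (of_real x + \<i> * of_real \<theta>) \<or> z = - exp (of_real x + \<i> * of_real \<theta>)"
    using polar_up_to_sign[OF assms] by blast
  then have "angular_coeff p z = angular_coeff p (exp (of_real x + \<i> * of_real \<theta>))" for p
    using angular_coeff_minus by auto
  then show ?thesis using that[of "8 + 14 / sqrt (exp x / 2)"] angular_coeff_polar_bound by simp
qed

section \<open>Gaussian integrals\<close>

lemma gaussian_exp_bound:
  fixes K x m :: real
  assumes "K > 0"
  shows "exp (- (x / K)\<^sup>2) \<le> exp (m\<^sup>2 * K\<^sup>2 / 4) * exp (- (m * \<bar>x\<bar>))"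
proof -
  have "0 \<le> (\<bar>x\<bar> / K - m * K / 2)\<^sup>2" by simp
  also have "(\<bar>x\<bar> / K - m * K / 2)\<^sup>2 = (x / K)\<^sup>2 - m * \<bar>x\<bar> + m\<^sup>2 * K\<^sup>2 / 4"
    using assms by (simp add: power2_diff power_divide power_mult_distrib)
  finally have "- (x / K)\<^sup>2 \<le> m\<^sup>2 * K\<^sup>2 / 4 + - (m * \<bar>x\<bar>)" by linarith
  then show ?thesis unfolding exp_add[symmetric] by simp
qed

lemma integral_gaussian: "(\<integral>x. exp (- x\<^sup>2) \<partial>lborel) = sqrt pi"
proof -
  have "has_bochner_integral lborel (\<lambda>x::real. exp (- x\<^sup>2)) (2 *\<^sub>R (sqrt pi / 2))"
    by (rule has_bochner_integral_even_function[OF gaussian_moment_0]) simp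
  then show ?thesis by (simp add: has_bochner_integral_integral_eq)
qed

definition gauss_osc :: "real \<Rightarrow> real \<Rightarrow> real \<Rightarrow> complex" where
  "gauss_osc K r x = exp (- (of_real x / of_real K)\<^sup>2 - 2 * \<i> * of_real r * of_real x)"

lemma norm_gauss_osc: "norm (gauss_osc K r x) = exp (- (x / K)\<^sup>2)"
proof -
  have "- (complex_of_real x / of_real K)\<^sup>2 - 2 * \<i> * of_real r * of_real x = of_real (- (x / K)\<^sup>2) + \<i> * of_real (- (2 * r * x))"
    by simp
  then show ?thesis unfolding gauss_osc_def norm_exp_eq_Re by (simp only: plus_complex.sel Re_complex_of_real Re_i_times Im_complex_of_real) simp
qed

lemma gauss_osc_continuous: "continuous_on A (gauss_osc K r)"
  unfolding gauss_osc_def divide_inverse by (intro continuous_intros)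

lemma gauss_osc_measurable [measurable]: "gauss_osc K r \<in> borel_measurable borel"
  by (rule borel_measurable_continuous_onI) (rule gauss_osc_continuous)

lemma abs_power_le_exp:
  fixes x :: real
  assumes "j \<le> 2"
  shows "\<bar>x\<bar> ^ j \<le> 2 * exp \<bar>x\<bar>"
proof -
  have e: "1 + \<bar>x\<bar> + \<bar>x\<bar>\<^sup>2 / 2 \<le> exp \<bar>x\<bar>" by (rule exp_lower_Taylor_quadratic) simp
  have e0: "1 \<le> exp \<bar>x\<bar>" "\<bar>x\<bar> \<le> exp \<bar>x\<bar>"
    using e zero_le_power2[of "\<bar>x\<bar>"] abs_ge_zero[of x] by linarith+
  consider "j = 0" | "j = 1" | "j = 2" using assms by linarith
  then show ?thesis
  proof cases
    case 1
    then have "\<bar>x\<bar> ^ j = 1" by simp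
    then show ?thesis using e0 by linarith
  next
    case 2
    then have "\<bar>x\<bar> ^ j = \<bar>x\<bar>" by simp
    then show ?thesis using e0 by linarith
  next
    case 3
    then have "\<bar>x\<bar> ^ j = \<bar>x\<bar>\<^sup>2" by simp
    then show ?thesis using e abs_ge_zero[of x] by linarith
  qed
qed

lemma gauss_osc_poly_bound:
  assumes "K > 0" "j \<le> 2"
  shows "norm (of_real x ^ j * gauss_osc K r x) \<le> 2 * exp (K\<^sup>2) * exp (- \<bar>x\<bar>)"
proof -
  have "\<bar>x\<bar> ^ j \<le> 2 * exp \<bar>x\<bar>" by (rule abs_power_le_exp[OF assms(2)])
  moreover have "exp (- (x / K)\<^sup>2) \<le> exp (K\<^sup>2) * exp (- (2 * \<bar>x\<bar>))"
    using gaussian_exp_bound[OF assms(1), of x 2] by simp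
  ultimately have "\<bar>x\<bar> ^ j * exp (- (x / K)\<^sup>2) \<le> (2 * exp \<bar>x\<bar>) * (exp (K\<^sup>2) * exp (- (2 * \<bar>x\<bar>)))"
    by (intro mult_mono) auto
  also have "\<dots> = 2 * exp (K\<^sup>2) * (exp \<bar>x\<bar> * exp (- (2 * \<bar>x\<bar>)))" by simp
  also have "exp \<bar>x\<bar> * exp (- (2 * \<bar>x\<bar>)) = exp (- \<bar>x\<bar>)" unfolding exp_add[symmetric] by simp
  finally show ?thesis by (simp add: norm_mult norm_power norm_gauss_osc)
qed

lemma gauss_osc_poly_integrable:
  assumes "K > 0" "j \<le> 2"
  shows "integrable lborel (\<lambda>x. of_real x ^ j * gauss_osc K r x)"
  by (rule integrable_of_exp_bound[OF _ gauss_osc_poly_bound[OF assms]]) measurable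

text \<open>
  Completing the square makes the integrand a Gaussian on a horizontal line at height \<open>K\<^sup>2 r\<close>.
\<close>

lemma k_fun_eq_integral:
  assumes K: "K > 0"
  shows "(\<integral>x. gauss_osc K r x \<partial>lborel) = of_real (k_fun K r)"
proof -
  define f where "f = (\<lambda>w::complex. exp (- (w / of_real K)\<^sup>2))"
  have hol: "f holomorphic_on UNIV" unfolding f_def using K by (intro holomorphic_intros) auto
  have "gauss_osc K r x = of_real (exp (- (K * r)\<^sup>2)) * f (of_real x + \<i> * of_real (K\<^sup>2 * r))" for x
    unfolding gauss_osc_def f_def exp_of_real[symmetric] mult_exp_exp using K
    by (intro arg_cong[where f = exp]) (simp add: power2_eq_square field_simps)
  then have "(\<integral>x. gauss_osc K r x \<partial>lborel) = of_real (exp (- (K * r)\<^sup>2)) * (\<integral>x. f (of_real x + \<i> * of_real (K\<^sup>2 * r)) \<partial>lborel)"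
    by simp
  also have "(\<integral>x. f (of_real x + \<i> * of_real (K\<^sup>2 * r)) \<partial>lborel) = (\<integral>x. f (of_real x) \<partial>lborel)"
  proof (rule line_integral_shift[OF hol])
    fix x \<tau> :: real assume t: "\<bar>\<tau>\<bar> \<le> \<bar>K\<^sup>2 * r\<bar>"
    have "((complex_of_real x + \<i> * of_real \<tau>) / of_real K)\<^sup>2 = of_real ((x / K)\<^sup>2 - (\<tau> / K)\<^sup>2) + \<i> * of_real (2 * x * \<tau> / K\<^sup>2)"
      by (simp add: power2_eq_square add_divide_distrib algebra_simps)
    then have "norm (f (of_real x + \<i> * of_real \<tau>)) = exp ((\<tau> / K)\<^sup>2 + - (x / K)\<^sup>2)"
      unfolding f_def norm_exp_eq_Re by (simp only: uminus_complex.sel plus_complex.sel Re_complex_of_real Re_i_times Im_complex_of_real) simp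
    also have "\<dots> = exp ((\<tau> / K)\<^sup>2) * exp (- (x / K)\<^sup>2)" by (rule exp_add)
    also have "\<dots> \<le> exp ((K\<^sup>2 * r / K)\<^sup>2) * (exp (1\<^sup>2 * K\<^sup>2 / 4) * exp (- (1 * \<bar>x\<bar>)))"
    proof (intro mult_mono gaussian_exp_bound[OF K])
      have "\<bar>\<tau> / K\<bar> \<le> \<bar>K\<^sup>2 * r / K\<bar>" unfolding abs_divide using t by (intro divide_right_mono) auto
      then show "exp ((\<tau> / K)\<^sup>2) \<le> exp ((K\<^sup>2 * r / K)\<^sup>2)" by (simp only: exp_le_cancel_iff abs_le_square_iff)
    qed auto
    finally show "norm (f (of_real x + \<i> * of_real \<tau>)) \<le> exp ((K\<^sup>2 * r / K)\<^sup>2) * exp (1\<^sup>2 * K\<^sup>2 / 4) * exp (- \<bar>x\<bar>)" by simp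
  qed
  also have "(\<integral>x. f (of_real x) \<partial>lborel) = of_real (K * sqrt pi)"
  proof -
    have "f (of_real x) = of_real (exp (- (x / K)\<^sup>2))" for x by (simp add: f_def flip: exp_of_real)
    then have "(\<integral>x. f (of_real x) \<partial>lborel) = of_real (\<integral>x. exp (- (x / K)\<^sup>2) \<partial>lborel)" by simp
    also have "(\<integral>x. exp (- (x / K)\<^sup>2) \<partial>lborel) = \<bar>K\<bar> *\<^sub>R (\<integral>x. exp (- ((0 + K * x) / K)\<^sup>2) \<partial>lborel)"
      using K by (intro lborel_integral_real_affine) auto
    also have "\<dots> = K * sqrt pi" using K integral_gaussian by simp
    finally show ?thesis .
  qed
  finally show ?thesis by (simp add: k_fun_def mult_ac)
qed

lemma gauss_osc_deriv:
  assumes "K > 0"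
  shows "(gauss_osc K r has_vector_derivative (- 2 * of_real x / of_real K ^ 2 - 2 * \<i> * of_real r) * gauss_osc K r x) (at x)"
proof -
  have "((\<lambda>w. exp (- (w / of_real K)\<^sup>2 - 2 * \<i> * of_real r * w)) has_field_derivative
      (- 2 * of_real x / of_real K ^ 2 - 2 * \<i> * of_real r) * gauss_osc K r x) (at (of_real x))"
    unfolding gauss_osc_def using assms by (auto intro!: derivative_eq_intros simp: power2_eq_square)
  then show ?thesis unfolding gauss_osc_def by (rule has_vector_derivative_real_field)
qed

lemma deriv2_k_fun:
  assumes K: "K > 0"
  shows "deriv (deriv (k_fun K)) r = (4 * K ^ 4 * r\<^sup>2 - 2 * K\<^sup>2) * k_fun K r"
proof -
  have 1: "(k_fun K has_real_derivative (- 2 * K\<^sup>2 * r) * k_fun K r) (at r)" for r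
    unfolding k_fun_def by (auto intro!: derivative_eq_intros simp: power2_eq_square)
  then have d: "deriv (k_fun K) = (\<lambda>r. (- 2 * K\<^sup>2 * r) * k_fun K r)" using DERIV_imp_deriv by blast
  have "((\<lambda>r. (- 2 * K\<^sup>2 * r) * k_fun K r) has_real_derivative (4 * K ^ 4 * r\<^sup>2 - 2 * K\<^sup>2) * k_fun K r) (at r)"
    by (auto intro!: derivative_eq_intros 1 simp: power2_eq_square power4_eq_xxxx algebra_simps)
  then show ?thesis unfolding d by (rule DERIV_imp_deriv)
qed

text \<open>
  Integrating the derivatives of the Gaussian and of \<open>x\<close> times the Gaussian gives two linear relations
  between the moments of order \<open>0\<close>, \<open>1\<close> and \<open>2\<close>, which determine the second moment.
\<close>

lemma k_fun_deriv2_eq_integral: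
  assumes K: "K > 0"
  shows "(\<integral>x. of_real x ^ 2 * gauss_osc K r x \<partial>lborel) = - of_real (deriv (deriv (k_fun K)) r) / 4"
proof -
  define I where "I = (\<lambda>j. \<integral>x. of_real x ^ j * gauss_osc K r x \<partial>lborel)"
  define c where "c = complex_of_real (K\<^sup>2)"
  have c0: "c \<noteq> 0" using K by (simp add: c_def)
  have int: "integrable lborel (\<lambda>x. of_real x ^ j * gauss_osc K r x)" if "j \<le> 2" for j
    by (rule gauss_osc_poly_integrable[OF K that])
  note b = gauss_osc_poly_bound[OF K]
  have ct: "continuous_on UNIV (\<lambda>x. of_real x ^ j * gauss_osc K r x)" for j
    by (intro continuous_intros gauss_osc_continuous)
  have "(\<integral>x. (- 2 / c) * (of_real x ^ 1 * gauss_osc K r x) + (- 2 * \<i> * of_real r) * (of_real x ^ 0 * gauss_osc K r x) \<partial>lborel) = 0"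
  proof (rule integral_derivative_eq_0)
    show "((\<lambda>x. of_real x ^ 0 * gauss_osc K r x) has_vector_derivative (- 2 / c) * (of_real x ^ 1 * gauss_osc K r x) + (- 2 * \<i> * of_real r) * (of_real x ^ 0 * gauss_osc K r x)) (at x)" for x
      unfolding power_0 mult_1_left
      by (rule has_vector_derivative_eq_rhs[OF gauss_osc_deriv[OF K]]) (simp add: c_def algebra_simps)
    show "norm (of_real x ^ 0 * gauss_osc K r x) \<le> 2 * exp (K\<^sup>2) * exp (- \<bar>x\<bar>)" for x by (rule b) simp
    show "integrable lborel (\<lambda>x. (- 2 / c) * (of_real x ^ 1 * gauss_osc K r x) + (- 2 * \<i> * of_real r) * (of_real x ^ 0 * gauss_osc K r x))"
      by (intro Bochner_Integration.integrable_add integrable_mult_right int) auto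
  qed (intro continuous_on_add continuous_on_mult continuous_on_const ct)
  then have e1: "(- 2 / c) * I 1 + (- 2 * \<i> * of_real r) * I 0 = 0"
    using int[of 0] int[of 1] by (simp add: I_def)
  have "(\<integral>x. (of_real x ^ 0 * gauss_osc K r x) + ((- 2 / c) * (of_real x ^ 2 * gauss_osc K r x) + (- 2 * \<i> * of_real r) * (of_real x ^ 1 * gauss_osc K r x)) \<partial>lborel) = 0"
  proof (rule integral_derivative_eq_0)
    have dx: "((\<lambda>x. complex_of_real x) has_vector_derivative 1) (at x)" for x
      using has_vector_derivative_of_real[of "\<lambda>x. x" 1 "at x"] by simp
    show "((\<lambda>x. of_real x ^ 1 * gauss_osc K r x) has_vector_derivative (of_real x ^ 0 * gauss_osc K r x) + ((- 2 / c) * (of_real x ^ 2 * gauss_osc K r x) + (- 2 * \<i> * of_real r) * (of_real x ^ 1 * gauss_osc K r x))) (at x)" for x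
      unfolding power_one_right
      by (rule has_vector_derivative_eq_rhs[OF has_vector_derivative_mult[OF dx gauss_osc_deriv[OF K]]])
        (simp add: c_def power2_eq_square algebra_simps)
    show "norm (of_real x ^ 1 * gauss_osc K r x) \<le> 2 * exp (K\<^sup>2) * exp (- \<bar>x\<bar>)" for x by (rule b) simp
    show "integrable lborel (\<lambda>x. (of_real x ^ 0 * gauss_osc K r x) + ((- 2 / c) * (of_real x ^ 2 * gauss_osc K r x) + (- 2 * \<i> * of_real r) * (of_real x ^ 1 * gauss_osc K r x)))"
      by (intro Bochner_Integration.integrable_add integrable_mult_right int) auto
  qed (intro continuous_on_add continuous_on_mult continuous_on_const ct)
  then have e2: "I 0 + ((- 2 / c) * I 2 + (- 2 * \<i> * of_real r) * I 1) = 0"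
    using int[of 0] int[of 1] int[of 2] by (simp add: I_def)
  have e3: "I 0 = of_real (k_fun K r)" using k_fun_eq_integral[OF K] by (simp add: I_def)
  have i1: "I 1 = - \<i> * of_real r * c * I 0" using e1 c0 by (simp add: field_simps) (metis minus_minus)
  have "2 * I 2 = c * (I 0 - 2 * \<i> * of_real r * I 1)" using e2 c0 by (simp add: field_simps)
  also have "\<dots> = c * (1 - 2 * of_real (r\<^sup>2) * c) * I 0" unfolding i1 by (simp add: algebra_simps power2_eq_square)
  finally have i2: "2 * I 2 = c * (1 - 2 * of_real (r\<^sup>2) * c) * I 0" .
  have "4 * I 2 = 2 * (2 * I 2)" by simp
  also have "\<dots> = - of_real ((4 * K ^ 4 * r\<^sup>2 - 2 * K\<^sup>2) * k_fun K r)"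
    unfolding i2 e3 c_def by (simp add: algebra_simps power2_eq_square power4_eq_xxxx)
  finally have "4 * I 2 = - of_real ((4 * K ^ 4 * r\<^sup>2 - 2 * K\<^sup>2) * k_fun K r)" .
  then have "I 2 = - of_real ((4 * K ^ 4 * r\<^sup>2 - 2 * K\<^sup>2) * k_fun K r) / 4"
    by (simp only: nonzero_eq_divide_eq[OF zero_neq_numeral[symmetric]] mult.commute)
  then show ?thesis unfolding deriv2_k_fun[OF K] I_def .
qed

section \<open>Uniqueness of Fourier coefficients\<close>

lemma integrable_int_exp:
  assumes c: "c > 0"
  shows "integrable (count_space (UNIV :: int set)) (\<lambda>p. exp (- (c * \<bar>real_of_int p\<bar>)))"
proof -
  let ?f = "\<lambda>p::int. exp (- (c * \<bar>real_of_int p\<bar>))"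
  have s: "summable (\<lambda>n::nat. exp (- (c * real n)))"
  proof -
    have "summable (\<lambda>n::nat. exp (- c) ^ n)" using c by (intro summable_geometric) simp
    moreover have "exp (- c) ^ n = exp (- (c * real n))" for n :: nat
      unfolding exp_of_nat_mult[symmetric] by (simp add: mult.commute)
    ultimately show ?thesis by simp
  qed
  have "Infinite_Set_Sum.abs_summable_on ?f (range int)"
    by (subst abs_summable_on_reindex_iff[symmetric]) (use s in \<open>auto simp: abs_summable_on_nat_iff' inj_on_def\<close>)
  moreover have "Infinite_Set_Sum.abs_summable_on ?f (range (\<lambda>n. - int n))"
    by (subst abs_summable_on_reindex_iff[symmetric]) (use s in \<open>auto simp: abs_summable_on_nat_iff' inj_on_def\<close>)
  ultimately have "Infinite_Set_Sum.abs_summable_on ?f (range int \<union> range (\<lambda>n. - int n))" by (rule abs_summable_on_union)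
  moreover have "range int \<union> range (\<lambda>n. - int n) = UNIV"
  proof -
    have "p \<in> range int \<union> range (\<lambda>n. - int n)" for p :: int
      by (cases p rule: int_cases2) auto
    then show ?thesis by blast
  qed
  ultimately show ?thesis by (simp add: abs_summable_on_def)
qed

text \<open>
  The half-open intervals suit telescoping sums.
\<close>

lemma integral_int_eq_lim:
  fixes u :: "int \<Rightarrow> complex"
  assumes u: "integrable (count_space UNIV) u"
  shows "(\<lambda>n. \<Sum>q\<in>{- int n..<int n}. u q) \<longlonglongrightarrow> (\<integral>q. u q \<partial>count_space UNIV)"
proof -
  have "(\<lambda>n. \<integral>q. indicator {- int n..<int n} q *\<^sub>R u q \<partial>count_space UNIV) \<longlonglongrightarrow> (\<integral>q. u q \<partial>count_space UNIV)"
  proof (rule integral_dominated_convergence[where w = "\<lambda>q. norm (u q)"])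
    show "AE q in count_space UNIV. (\<lambda>n. indicator {- int n..<int n} q *\<^sub>R u q) \<longlonglongrightarrow> u q"
    proof (intro AE_I2 tendsto_eventually)
      fix q :: int
      show "\<forall>\<^sub>F n in sequentially. indicator {- int n..<int n} q *\<^sub>R u q = u q"
        using eventually_gt_at_top[of "nat \<bar>q\<bar>"] by eventually_elim (auto simp: indicator_def)
    qed
  qed (use u in \<open>auto simp: indicator_def\<close>)
  moreover have "(\<integral>q. indicator {- int n..<int n} q *\<^sub>R u q \<partial>count_space UNIV) = (\<Sum>q\<in>{- int n..<int n}. u q)" for n
  proof -
    have "(\<integral>q. indicator {- int n..<int n} q *\<^sub>R u q \<partial>count_space UNIV) = (\<integral>q. u q \<partial>count_space {- int n..<int n})"
      by (subst integral_restrict_space[symmetric]) (auto simp: restrict_count_space)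
    then show ?thesis by (simp add: lebesgue_integral_count_space_finite)
  qed
  ultimately show ?thesis by simp
qed

definition fourier_exp :: "int \<Rightarrow> real \<Rightarrow> complex" where
  "fourier_exp p \<omega> = exp (- (2 * \<i> * of_int p * of_real \<omega>))"

lemma norm_fourier_exp [simp]: "norm (fourier_exp p \<omega>) = 1"
  by (simp add: fourier_exp_def)

lemma fourier_exp_continuous: "continuous_on A (fourier_exp p)"
  unfolding fourier_exp_def by (intro continuous_intros)

lemma fourier_exp_measurable [measurable]: "fourier_exp p \<in> borel_measurable borel"
  by (rule borel_measurable_continuous_onI) (rule fourier_exp_continuous)

lemma fourier_exp_orthogonal:
  "integral {0..pi} (\<lambda>\<omega>. fourier_exp p \<omega> * fourier_exp (- j) \<omega>) = (if p = j then of_real pi else 0)"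
proof (cases "p = j")
  case True
  then have "fourier_exp p \<omega> * fourier_exp (- j) \<omega> = 1" for \<omega>
    unfolding fourier_exp_def mult_exp_exp by simp
  then show ?thesis using True by (simp add: scaleR_conv_of_real)
next
  case False
  define c where "c = - (2 * \<i> * of_int (p - j) :: complex)"
  have c0: "c \<noteq> 0" using False by (simp add: c_def)
  have e: "fourier_exp p \<omega> * fourier_exp (- j) \<omega> = exp (c * of_real \<omega>)" for \<omega>
    unfolding fourier_exp_def mult_exp_exp c_def by (rule arg_cong[where f = exp]) (simp add: algebra_simps)
  have "((\<lambda>\<omega>. exp (c * of_real \<omega>)) has_integral (exp (c * of_real pi) / c - exp (c * of_real 0) / c)) {0..pi}"
  proof (rule fundamental_theorem_of_calculus)
    fix \<omega> :: real
    have "((\<lambda>w. exp (c * w) / c) has_field_derivative exp (c * of_real \<omega>)) (at (of_real \<omega>))"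
      using c0 by (auto intro!: derivative_eq_intros)
    then show "((\<lambda>\<omega>. exp (c * of_real \<omega>) / c) has_vector_derivative exp (c * of_real \<omega>)) (at \<omega> within {0..pi})"
      by (intro has_vector_derivative_at_within[OF has_vector_derivative_real_field])
  qed simp
  moreover have "exp (c * of_real pi) = 1"
  proof -
    have "c * of_real pi = \<i> * (of_int (- (p - j)) * (of_real pi * 2))" by (simp add: c_def algebra_simps)
    then show ?thesis by (simp only: exp_2pi_1_int)
  qed
  ultimately show ?thesis using False unfolding e by (simp add: integral_unique)
qed

text \<open>
  The powers of \<open>cos\<^sup>2 (\<omega> - w0)\<close> concentrate at \<open>w0\<close>. If \<open>D w0\<close> were positive, the contribution of a small
  neighbourhood of \<open>w0\<close> would be at least of order \<open>c1\<^sup>n\<close> and that of its complement at most of order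
  \<open>\<rho>\<^sup>n\<close> with \<open>\<rho> < c1\<close>, so that the integral could not vanish for large \<open>n\<close>.
\<close>

lemma cos_power_kernel_nonpos:
  fixes D :: "real \<Rightarrow> real"
  assumes cont: "continuous_on {0..pi} D" and w: "0 < w0" "w0 < pi"
    and zero: "\<And>n. integral {0..pi} (\<lambda>\<omega>. D \<omega> * (cos (\<omega> - w0))\<^sup>2 ^ n) = 0"
  shows "D w0 \<le> 0"
proof (rule ccontr)
  assume "\<not> D w0 \<le> 0"
  define d where "d = D w0 / 2"
  have d: "d > 0" using \<open>\<not> D w0 \<le> 0\<close> by (simp add: d_def)
  obtain M where "\<forall>x\<in>D ` {0..pi}. norm x \<le> M"
    using compact_imp_bounded[OF compact_continuous_image[OF cont compact_Icc]] unfolding bounded_iff by blast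
  then have M: "\<bar>D \<omega>\<bar> \<le> M" if "\<omega> \<in> {0..pi}" for \<omega> using that by auto
  have M0: "M \<ge> 0" using M[of 0] by force
  obtain e where e: "e > 0" "\<And>\<omega>. \<omega> \<in> {0..pi} \<Longrightarrow> \<bar>\<omega> - w0\<bar> < e \<Longrightarrow> D \<omega> > d"
  proof -
    have "continuous (at w0 within {0..pi}) D" using cont w by (simp add: continuous_on_eq_continuous_within)
    then obtain e where "e > 0" "\<And>\<omega>. \<omega> \<in> {0..pi} \<Longrightarrow> dist \<omega> w0 < e \<Longrightarrow> dist (D \<omega>) (D w0) < d"
      unfolding continuous_within_eps_delta using d by blast
    then show ?thesis using that[of e] by (force simp: dist_real_def d_def abs_if split: if_splits)
  qed
  \<comment> \<open>\<open>\<delta>\<close> stays below the distances of \<open>w0\<close> to \<open>0\<close> and \<open>\<pi>\<close>, so that \<open>\<bar>\<omega> - w0\<bar> \<le> \<pi> - \<delta>\<close> and the kernel has no second peak\<close>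
  define \<delta> where "\<delta> = min e (min w0 (pi - w0)) / 2"
  have \<delta>: "\<delta> > 0" "\<delta> < e" "\<delta> < w0" "\<delta> < pi - w0" "\<delta> < pi / 2"
    using e w by (auto simp: \<delta>_def min_def)
  define c1 where "c1 = (cos (\<delta> / 2))\<^sup>2"
  define \<rho> where "\<rho> = (cos \<delta>)\<^sup>2"
  have cosd: "0 < cos \<delta>" "cos \<delta> < cos (\<delta> / 2)"
    using \<delta> by (auto intro!: cos_gt_zero_pi cos_monotone_0_pi)
  have \<rho>: "0 < \<rho>" "\<rho> < c1" using cosd by (auto simp: \<rho>_def c1_def intro!: power_strict_mono)
  define A where "A = {w0 - \<delta> / 2..w0 + \<delta> / 2}"
  have Asub: "A \<subseteq> {0..pi}" using \<delta> by (auto simp: A_def)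
  have ineq: "d * c1 ^ n * indicator A \<omega> - M * \<rho> ^ n \<le> D \<omega> * (cos (\<omega> - w0))\<^sup>2 ^ n" if \<omega>: "\<omega> \<in> {0..pi}" for \<omega> n
  proof -
    define t where "t = (cos (\<omega> - w0))\<^sup>2"
    have t0: "t \<ge> 0" by (simp add: t_def)
    have mono: "cos b \<le> cos \<bar>\<omega> - w0\<bar>" if "\<bar>\<omega> - w0\<bar> \<le> b" "b \<le> pi" for b
      using that by (intro cos_monotone_0_pi_le) auto
    have m0: "0 \<le> M * \<rho> ^ n" using M0 \<rho> by simp
    consider (in1) "\<omega> \<in> A" | (in2) "\<omega> \<notin> A" "\<bar>\<omega> - w0\<bar> < \<delta>" | (out) "\<omega> \<notin> A" "\<bar>\<omega> - w0\<bar> \<ge> \<delta>" by linarith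
    then have "d * c1 ^ n * indicator A \<omega> - M * \<rho> ^ n \<le> D \<omega> * t ^ n"
    proof cases
      case in1
      then have a: "\<bar>\<omega> - w0\<bar> \<le> \<delta> / 2" unfolding A_def atLeastAtMost_iff by linarith
      then have "D \<omega> > d" using e(2)[OF \<omega>] \<delta> by linarith
      moreover have "c1 \<le> t"
        using mono[of "\<delta> / 2"] a \<delta> cosd unfolding c1_def t_def by (intro power_mono) auto
      then have "c1 ^ n \<le> t ^ n" using \<rho> by (intro power_mono) auto
      ultimately have "d * c1 ^ n \<le> D \<omega> * t ^ n" using d \<rho> by (intro mult_mono) auto
      then show ?thesis using in1 m0 by simp
    next
      case in2
      then have "D \<omega> > d" using e(2)[OF \<omega>] \<delta> by linarith
      then have "0 \<le> D \<omega> * t ^ n" using d t0 by simp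
      then show ?thesis using in2 m0 by simp
    next
      case out
      have "\<bar>cos (\<omega> - w0)\<bar> \<le> cos \<delta>"
      proof -
        have ab: "\<delta> \<le> \<bar>\<omega> - w0\<bar>" "\<bar>\<omega> - w0\<bar> \<le> pi - \<delta>" using out \<omega> \<delta> by auto
        have "cos \<bar>\<omega> - w0\<bar> \<le> cos \<delta>" using ab \<delta> by (intro cos_monotone_0_pi_le) auto
        moreover have "cos (pi - \<delta>) \<le> cos \<bar>\<omega> - w0\<bar>" using ab \<delta> by (intro cos_monotone_0_pi_le) auto
        ultimately show ?thesis by (simp add: abs_le_iff)
      qed
      then have "t \<le> \<rho>" unfolding t_def \<rho>_def using cosd by (metis abs_le_square_iff abs_of_pos)
      then have "t ^ n \<le> \<rho> ^ n" using t0 by (rule power_mono)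
      then have "\<bar>D \<omega>\<bar> * t ^ n \<le> M * \<rho> ^ n" using M[OF \<omega>] M0 t0 by (intro mult_mono) auto
      moreover have "- (\<bar>D \<omega>\<bar> * t ^ n) \<le> D \<omega> * t ^ n"
        using mult_right_mono[of "- \<bar>D \<omega>\<bar>" "D \<omega>" "t ^ n"] t0 by simp
      ultimately show ?thesis using out by simp
    qed
    then show ?thesis by (simp add: t_def)
  qed
  have "d * \<delta> * c1 ^ n \<le> M * pi * \<rho> ^ n" for n
  proof -
    have lo: "((\<lambda>\<omega>. d * c1 ^ n * indicator A \<omega> - M * \<rho> ^ n) has_integral (d * c1 ^ n * \<delta> - pi * (M * \<rho> ^ n))) {0..pi}"
    proof (intro has_integral_diff has_integral_mult_right)
      have "((\<lambda>\<omega>. 1::real) has_integral \<delta>) A"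
        using has_integral_const_real[of "1::real" "w0 - \<delta> / 2" "w0 + \<delta> / 2"] \<delta> by (simp add: A_def)
      then have "((\<lambda>\<omega>. if \<omega> \<in> A then 1 else 0::real) has_integral \<delta>) {0..pi}"
        by (simp only: has_integral_restrict[OF Asub])
      then show "(indicator A has_integral \<delta>) {0..pi}" by (simp add: indicator_def[abs_def] of_bool_def)
      show "((\<lambda>\<omega>. M * \<rho> ^ n) has_integral pi * (M * \<rho> ^ n)) {0..pi}"
        using has_integral_const_real[of "M * \<rho> ^ n" 0 pi] by simp
    qed
    have hi: "((\<lambda>\<omega>. D \<omega> * (cos (\<omega> - w0))\<^sup>2 ^ n) has_integral 0) {0..pi}"
    proof -
      have "(\<lambda>\<omega>. D \<omega> * (cos (\<omega> - w0))\<^sup>2 ^ n) integrable_on {0..pi}"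
        by (intro integrable_continuous_real continuous_on_mult cont continuous_intros)
      from integrable_integral[OF this] show ?thesis unfolding zero .
    qed
    have "d * c1 ^ n * \<delta> - pi * (M * \<rho> ^ n) \<le> 0"
      by (rule has_integral_le[OF lo hi ineq])
    then show ?thesis by (simp add: mult_ac)
  qed
  then have bnd: "d * \<delta> * (c1 / \<rho>) ^ n \<le> M * pi" for n
    using \<rho> by (simp add: power_divide divide_simps)
  have "1 < c1 / \<rho>" using \<rho> by simp
  then obtain n where "M * pi / (d * \<delta>) < (c1 / \<rho>) ^ n" using real_arch_pow by blast
  then have "M * pi < d * \<delta> * (c1 / \<rho>) ^ n" using d \<delta> by (simp add: field_simps)
  then show False using bnd[of n] by linarith
qed

text \<open>
  The function \<open>cos\<^sup>2 (\<omega> - w0)\<close> is a trigonometric polynomial of period \<open>\<pi>\<close>, so by induction the integrals of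
  \<open>D\<close> against all its powers vanish. Now \<open>cos_power_kernel_nonpos\<close> applies to the real and imaginary
  parts of \<open>D\<close> with both signs.
\<close>

lemma fourier_coeffs_zero:
  fixes D :: "real \<Rightarrow> complex"
  assumes cont: "continuous_on {0..pi} D" and w: "0 < w0" "w0 < pi"
    and zero: "\<And>j. integral {0..pi} (\<lambda>\<omega>. D \<omega> * fourier_exp j \<omega>) = 0"
  shows "D w0 = 0"
proof -
  define t where "t = (\<lambda>n \<omega>. complex_of_real ((cos (\<omega> - w0))\<^sup>2 ^ n))"
  have tcont: "continuous_on S (t n)" for S n unfolding t_def by (intro continuous_intros)
  have fint: "(\<lambda>\<omega>. D \<omega> * t n \<omega> * fourier_exp j \<omega>) integrable_on {0..pi}" for n j
    by (intro integrable_continuous_real continuous_on_mult cont tcont fourier_exp_continuous)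
  have *: "integral {0..pi} (\<lambda>\<omega>. D \<omega> * t n \<omega> * fourier_exp j \<omega>) = 0" for n j
  proof (induction n arbitrary: j)
    case 0
    then show ?case using zero[of j] by (simp add: t_def)
  next
    case (Suc n)
    define a where "a = exp (2 * \<i> * complex_of_real w0) / 4"
    define b where "b = exp (- (2 * \<i> * complex_of_real w0)) / 4"
    \<comment> \<open>Euler's formula; the induction hypothesis then applies to the shifted frequencies\<close>
    have c2: "complex_of_real ((cos (\<omega> - w0))\<^sup>2) = 1 / 2 + a * fourier_exp 1 \<omega> + b * fourier_exp (- 1) \<omega>" for \<omega>
    proof -
      have "complex_of_real ((cos (\<omega> - w0))\<^sup>2) = (cos (complex_of_real (\<omega> - w0)))\<^sup>2"
        by (simp only: cos_of_real of_real_power)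
      also have "(cos (complex_of_real (\<omega> - w0)))\<^sup>2 = ((exp (\<i> * of_real (\<omega> - w0)) + exp (- (\<i> * of_real (\<omega> - w0)))) / 2)\<^sup>2"
        by (simp add: cos_exp_eq)
      also have "\<dots> = (exp (\<i> * of_real (\<omega> - w0)) * exp (\<i> * of_real (\<omega> - w0)) + exp (- (\<i> * of_real (\<omega> - w0))) * exp (- (\<i> * of_real (\<omega> - w0))) + 2 * (exp (\<i> * of_real (\<omega> - w0)) * exp (- (\<i> * of_real (\<omega> - w0))))) / 4"
        by (simp add: power2_eq_square field_simps)
      also have "exp (\<i> * of_real (\<omega> - w0)) * exp (- (\<i> * complex_of_real (\<omega> - w0))) = 1"
        unfolding mult_exp_exp by simp
      also have "exp (\<i> * of_real (\<omega> - w0)) * exp (\<i> * of_real (\<omega> - w0)) = exp (- (2 * \<i> * complex_of_real w0)) * fourier_exp (- 1) \<omega>"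
        unfolding fourier_exp_def mult_exp_exp by (rule arg_cong[where f = exp]) (simp add: algebra_simps)
      also have "exp (- (\<i> * of_real (\<omega> - w0))) * exp (- (\<i> * of_real (\<omega> - w0))) = exp (2 * \<i> * complex_of_real w0) * fourier_exp 1 \<omega>"
        unfolding fourier_exp_def mult_exp_exp by (rule arg_cong[where f = exp]) (simp add: algebra_simps)
      finally show ?thesis by (simp add: a_def b_def add_divide_distrib)
    qed
    have fe: "fourier_exp i \<omega> * fourier_exp j \<omega> = fourier_exp (i + j) \<omega>" for i j \<omega>
      unfolding fourier_exp_def mult_exp_exp by (rule arg_cong[where f = exp]) (simp add: algebra_simps)
    have "D \<omega> * t (Suc n) \<omega> * fourier_exp j \<omega> = 1 / 2 * (D \<omega> * t n \<omega> * fourier_exp j \<omega>) +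
       (a * (D \<omega> * t n \<omega> * fourier_exp (1 + j) \<omega>) + b * (D \<omega> * t n \<omega> * fourier_exp (- 1 + j) \<omega>))" for \<omega>
    proof -
      have "t (Suc n) \<omega> = (1 / 2 + a * fourier_exp 1 \<omega> + b * fourier_exp (- 1) \<omega>) * t n \<omega>"
        unfolding c2[symmetric] by (simp add: t_def)
      then show ?thesis unfolding fe[symmetric] by (simp add: algebra_simps)
    qed
    then have "integral {0..pi} (\<lambda>\<omega>. D \<omega> * t (Suc n) \<omega> * fourier_exp j \<omega>) =
      integral {0..pi} (\<lambda>\<omega>. 1 / 2 * (D \<omega> * t n \<omega> * fourier_exp j \<omega>) +
       (a * (D \<omega> * t n \<omega> * fourier_exp (1 + j) \<omega>) + b * (D \<omega> * t n \<omega> * fourier_exp (- 1 + j) \<omega>)))" by simp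
    also have "\<dots> = 0"
    proof (rule integral_unique)
      have h: "((\<lambda>\<omega>. D \<omega> * t n \<omega> * fourier_exp i \<omega>) has_integral 0) {0..pi}" for i
        using integrable_integral[OF fint[of n i]] unfolding Suc.IH .
      have "((\<lambda>\<omega>. 1 / 2 * (D \<omega> * t n \<omega> * fourier_exp j \<omega>) +
       (a * (D \<omega> * t n \<omega> * fourier_exp (1 + j) \<omega>) + b * (D \<omega> * t n \<omega> * fourier_exp (- 1 + j) \<omega>))) has_integral (1 / 2 * 0 + (a * 0 + b * 0))) {0..pi}"
        by (intro has_integral_add has_integral_mult_right h)
      then show "((\<lambda>\<omega>. 1 / 2 * (D \<omega> * t n \<omega> * fourier_exp j \<omega>) +
       (a * (D \<omega> * t n \<omega> * fourier_exp (1 + j) \<omega>) + b * (D \<omega> * t n \<omega> * fourier_exp (- 1 + j) \<omega>))) has_integral 0) {0..pi}" by simp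
    qed
    finally show ?case .
  qed
  have hz: "((\<lambda>\<omega>. D \<omega> * t n \<omega>) has_integral 0) {0..pi}" for n
    using integrable_integral[OF fint[of n 0]] unfolding * by (simp add: fourier_exp_def)
  have nonpos: "h (D w0) \<le> 0" if h: "bounded_linear h" "\<And>x r. h (x * complex_of_real r) = h x * r" for h :: "complex \<Rightarrow> real"
  proof (rule cos_power_kernel_nonpos[OF _ w, of "\<lambda>\<omega>. h (D \<omega>)"])
    show "continuous_on {0..pi} (\<lambda>\<omega>. h (D \<omega>))" by (rule bounded_linear.continuous_on[OF h(1) cont])
    fix n
    have "((h \<circ> (\<lambda>\<omega>. D \<omega> * t n \<omega>)) has_integral h 0) {0..pi}" by (rule has_integral_linear[OF hz h(1)])
    then have "((\<lambda>\<omega>. h (D \<omega>) * (cos (\<omega> - w0))\<^sup>2 ^ n) has_integral 0) {0..pi}"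
      unfolding o_def t_def h(2) using linear_0[OF bounded_linear.linear[OF h(1)]] by simp
    then show "integral {0..pi} (\<lambda>\<omega>. h (D \<omega>) * (cos (\<omega> - w0))\<^sup>2 ^ n) = 0" by (rule integral_unique)
  qed
  have "Re (D w0) \<le> 0" "Im (D w0) \<le> 0" by (intro nonpos bounded_linear_Re bounded_linear_Im; simp)+
  moreover have "- Re (D w0) \<le> 0" "- Im (D w0) \<le> 0"
    by (intro nonpos[of "\<lambda>z. - Re z"] nonpos[of "\<lambda>z. - Im z"] bounded_linear_minus bounded_linear_Re bounded_linear_Im; simp)+
  ultimately show ?thesis by (simp add: complex_eq_iff)
qed

section \<open>Poisson summation for the theta function\<close>

definition gauss_coeff :: "real \<Rightarrow> int \<Rightarrow> real" where
  "gauss_coeff P p = exp (- (of_int p / P)\<^sup>2)"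

text \<open>
  The \<open>j\<close>-th derivative of the series dual to \<open>theta_fun\<close>. The variable is complex, so that termwise
  differentiation follows from holomorphy.
\<close>

definition theta_ser :: "real \<Rightarrow> nat \<Rightarrow> complex \<Rightarrow> complex" where
  "theta_ser P j w = (\<integral>p. of_real (gauss_coeff P p) * ((- (2 * \<i> * of_int p)) ^ j * exp (- (2 * \<i> * of_int p * w))) \<partial>count_space UNIV)"

lemma theta_ser_term_bound:
  assumes "P > 0" "j \<le> 2" "\<bar>Im w\<bar> \<le> a"
  shows "norm (of_real (gauss_coeff P p) * ((- (2 * \<i> * of_int p)) ^ j * exp (- (2 * \<i> * of_int p * w))))
    \<le> 8 * exp ((2 * a + 2)\<^sup>2 * P\<^sup>2 / 4) * exp (- (1 * \<bar>of_int p\<bar>))"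
proof -
  have g: "gauss_coeff P p \<le> exp ((2 * a + 2)\<^sup>2 * P\<^sup>2 / 4) * exp (- ((2 * a + 2) * \<bar>of_int p\<bar>))"
    unfolding gauss_coeff_def by (rule gaussian_exp_bound[OF assms(1)])
  have pw: "norm ((- (2 * \<i> * of_int p :: complex)) ^ j) \<le> 8 * exp \<bar>of_int p\<bar>"
  proof -
    have "norm ((- (2 * \<i> * of_int p :: complex)) ^ j) = 2 ^ j * \<bar>of_int p\<bar> ^ j"
      by (simp add: norm_power norm_mult power_mult_distrib)
    also have "\<dots> \<le> 2 ^ 2 * (2 * exp \<bar>of_int p\<bar>)"
      using assms(2) by (intro mult_mono power_increasing abs_power_le_exp) auto
    finally show ?thesis by simp
  qed
  have e: "norm (exp (- (2 * \<i> * of_int p * w))) \<le> exp (2 * a * \<bar>of_int p\<bar>)"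
  proof -
    have "Re (- (2 * \<i> * of_int p * w)) = 2 * (of_int p * Im w)" by simp
    also have "\<dots> \<le> 2 * (\<bar>of_int p\<bar> * a)"
    proof -
      have "of_int p * Im w \<le> \<bar>of_int p * Im w\<bar>" by simp
      also have "\<dots> \<le> \<bar>of_int p\<bar> * a" unfolding abs_mult using assms(3) by (intro mult_left_mono) auto
      finally show ?thesis by simp
    qed
    finally show ?thesis unfolding norm_exp_eq_Re by (simp add: mult_ac)
  qed
  have "norm (of_real (gauss_coeff P p) * ((- (2 * \<i> * of_int p)) ^ j * exp (- (2 * \<i> * of_int p * w))))
     = gauss_coeff P p * (norm ((- (2 * \<i> * of_int p :: complex)) ^ j) * norm (exp (- (2 * \<i> * of_int p * w))))"
    unfolding norm_mult[of "of_real _"] norm_mult[of "_ ^ j"] by (simp add: gauss_coeff_def)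
  also have "\<dots> \<le> (exp ((2 * a + 2)\<^sup>2 * P\<^sup>2 / 4) * exp (- ((2 * a + 2) * \<bar>of_int p\<bar>))) * ((8 * exp \<bar>of_int p\<bar>) * exp (2 * a * \<bar>of_int p\<bar>))"
    by (intro mult_mono g pw e) (auto simp del: norm_exp_eq_Re simp: gauss_coeff_def)
  also have "\<dots> = 8 * exp ((2 * a + 2)\<^sup>2 * P\<^sup>2 / 4) * (exp (- ((2 * a + 2) * \<bar>of_int p\<bar>)) * (exp \<bar>of_int p\<bar> * exp (2 * a * \<bar>of_int p\<bar>)))"
    by (simp only: mult_ac)
  also have "exp (- ((2 * a + 2) * \<bar>of_int p\<bar>)) * (exp \<bar>of_int p\<bar> * exp (2 * a * \<bar>of_int p\<bar>)) = exp (- (1 * \<bar>real_of_int p\<bar>))"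
    unfolding exp_add[symmetric] by (rule arg_cong[where f = exp]) (simp add: algebra_simps)
  finally show ?thesis .
qed

lemma theta_ser_term_integrable:
  assumes "P > 0" "j \<le> 2"
  shows "integrable (count_space UNIV) (\<lambda>p::int. of_real (gauss_coeff P p) * ((- (2 * \<i> * of_int p)) ^ j * exp (- (2 * \<i> * of_int p * w))))"
proof (rule Bochner_Integration.integrable_bound)
  show "integrable (count_space UNIV) (\<lambda>p::int. 8 * exp ((2 * \<bar>Im w\<bar> + 2)\<^sup>2 * P\<^sup>2 / 4) * exp (- (1 * \<bar>of_int p\<bar>)))"
    by (intro integrable_mult_right integrable_int_exp) auto
qed (use order_trans[OF theta_ser_term_bound[OF assms order_refl] abs_ge_self] in auto)

lemma theta_ser_deriv:
  assumes "P > 0" "j \<le> 1"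
  shows "(theta_ser P j has_field_derivative theta_ser P (Suc j) w) (at w)"
proof -
  define a where "a = \<bar>Im w\<bar> + 1"
  define S where "S = {v. \<bar>Im v\<bar> < a}"
  let ?f = "\<lambda>v (p::int). of_real (gauss_coeff P p) * ((- (2 * \<i> * of_int p)) ^ j * exp (- (2 * \<i> * of_int p * v)))"
  have S: "open S" "w \<in> S"
    unfolding S_def a_def by (auto intro!: open_Collect_less continuous_intros)
  have j2: "j \<le> 2" using assms by simp
  have d: "deriv (\<lambda>v. ?f v p) w = of_real (gauss_coeff P p) * ((- (2 * \<i> * of_int p)) ^ Suc j * exp (- (2 * \<i> * of_int p * w)))" for p
    by (rule DERIV_imp_deriv) (auto intro!: derivative_eq_intros)
  have "((\<lambda>v. \<integral>p. ?f v p \<partial>count_space UNIV) has_field_derivative (\<integral>p. deriv (\<lambda>v. ?f v p) w \<partial>count_space UNIV)) (at w)"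
  proof (rule parametric_integral_has_field_derivative(2)[OF S])
    show "integrable (count_space UNIV) (\<lambda>p::int. 8 * exp ((2 * a + 2)\<^sup>2 * P\<^sup>2 / 4) * exp (- (1 * \<bar>of_int p\<bar>)))"
      by (intro integrable_mult_right integrable_int_exp) auto
    show "(\<lambda>v. ?f v p) holomorphic_on S" for p by (intro holomorphic_intros)
    show "norm (?f v p) \<le> 8 * exp ((2 * a + 2)\<^sup>2 * P\<^sup>2 / 4) * exp (- (1 * \<bar>of_int p\<bar>))" if "v \<in> S" for v p
      by (rule theta_ser_term_bound[OF assms(1) j2]) (use that in \<open>auto simp: S_def\<close>)
  qed auto
  then show ?thesis unfolding d theta_ser_def[symmetric] .
qed

lemma theta_ser_real_eq:
  "theta_ser P 0 (of_real \<omega>) = (\<integral>p. of_real (gauss_coeff P p) * fourier_exp p \<omega> \<partial>count_space UNIV)"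
  by (simp add: theta_ser_def fourier_exp_def)

lemma pair_sigma_finite_lborel_int: "pair_sigma_finite lborel (count_space (UNIV :: int set))"
  by (intro pair_sigma_finite.intro lborel.sigma_finite_measure_axioms sigma_finite_measure_count_space_countable) auto

lemma measurable_pair_int:
  assumes "\<And>p::int. f p \<in> borel_measurable M"
  shows "(\<lambda>x. f (snd x) (fst x)) \<in> borel_measurable (M \<Otimes>\<^sub>M count_space UNIV)"
proof (rule measurable_compose_countable'[where f = "\<lambda>p x. f p (fst x)" and g = snd and I = UNIV])
  show "(\<lambda>x. f p (fst x)) \<in> borel_measurable (M \<Otimes>\<^sub>M count_space UNIV)" for p
    using assms by measurable
qed auto

lemma integral_swap_int:
  fixes F :: "real \<Rightarrow> int \<Rightarrow> complex"
  assumes m: "\<And>q. (\<lambda>\<omega>. F \<omega> q) \<in> borel_measurable borel"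
    and le: "\<And>\<omega> q. norm (F \<omega> q) \<le> indicator {0..pi} \<omega> * (C * exp (- (1 * \<bar>of_int q\<bar>)))"
  shows "integrable (count_space UNIV) (\<lambda>q. \<integral>\<omega>. F \<omega> q \<partial>lborel)"
    and "(\<integral>\<omega>. (\<integral>q. F \<omega> q \<partial>count_space UNIV) \<partial>lborel) = (\<integral>q. (\<integral>\<omega>. F \<omega> q \<partial>lborel) \<partial>count_space UNIV)"
proof -
  interpret pair_sigma_finite lborel "count_space (UNIV :: int set)" by (rule pair_sigma_finite_lborel_int)
  have int: "integrable (lborel \<Otimes>\<^sub>M count_space UNIV) (\<lambda>(\<omega>, q). F \<omega> q)"
  proof (rule Bochner_Integration.integrable_bound)
    show "integrable (lborel \<Otimes>\<^sub>M count_space UNIV) (\<lambda>x. (indicator {0..pi} (fst x) :: real) * (C * exp (- (1 * \<bar>of_int (snd x)\<bar>))))"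
    proof (rule integrable_product)
      show "integrable lborel (indicator {0..pi} :: real \<Rightarrow> real)" by (rule integrable_real_indicator) auto
      show "integrable (count_space UNIV) (\<lambda>p::int. C * exp (- (1 * \<bar>of_int p\<bar>)))"
        by (intro integrable_mult_right integrable_int_exp) auto
    qed
    show "(\<lambda>(\<omega>, q). F \<omega> q) \<in> borel_measurable (lborel \<Otimes>\<^sub>M count_space UNIV)"
      using measurable_pair_int[of "\<lambda>q \<omega>. F \<omega> q" lborel] m by (simp add: split_beta')
    show "AE x in lborel \<Otimes>\<^sub>M count_space UNIV. norm (case x of (\<omega>, q) \<Rightarrow> F \<omega> q) \<le> norm ((indicator {0..pi} (fst x) :: real) * (C * exp (- (1 * \<bar>of_int (snd x)\<bar>))))"
      using order_trans[OF le abs_ge_self] by (intro AE_I2) (auto simp: split_beta')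
  qed
  show "integrable (count_space UNIV) (\<lambda>q. \<integral>\<omega>. F \<omega> q \<partial>lborel)" by (rule integrable_snd[OF int])
  show "(\<integral>\<omega>. (\<integral>q. F \<omega> q \<partial>count_space UNIV) \<partial>lborel) = (\<integral>q. (\<integral>\<omega>. F \<omega> q \<partial>lborel) \<partial>count_space UNIV)"
    by (rule Fubini_integral[OF int, symmetric])
qed

lemma theta_ser_fourier_coeff:
  assumes P: "P > 0"
  shows "integral {0..pi} (\<lambda>\<omega>. theta_ser P 0 (of_real \<omega>) * fourier_exp (- j) \<omega>) = of_real (pi * gauss_coeff P j)"
proof -
  let ?F = "\<lambda>\<omega> p. indicator {0..pi} \<omega> *\<^sub>R (of_real (gauss_coeff P p) * fourier_exp p \<omega> * fourier_exp (- j) \<omega>)"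
  have cont: "continuous_on UNIV (\<lambda>\<omega>. theta_ser P 0 (of_real \<omega>))"
  proof -
    have "continuous_on UNIV (theta_ser P 0)"
      using theta_ser_deriv[OF P, of 0] DERIV_isCont by (metis continuous_at_imp_continuous_on zero_le)
    then show ?thesis by (rule continuous_on_compose2) (auto intro!: continuous_intros)
  qed
  have cont2: "continuous_on {0..pi} (\<lambda>\<omega>. theta_ser P 0 (of_real \<omega>) * fourier_exp (- j) \<omega>)"
    by (intro continuous_on_mult continuous_on_subset[OF cont] fourier_exp_continuous) auto
  have le: "norm (?F \<omega> p) \<le> indicator {0..pi} \<omega> * ((8 * exp ((2 * 0 + 2)\<^sup>2 * P\<^sup>2 / 4)) * exp (- (1 * \<bar>of_int p\<bar>)))" for \<omega> p
  proof -
    have "norm (of_real (gauss_coeff P p) * fourier_exp p \<omega>) \<le> 8 * exp ((2 * 0 + 2)\<^sup>2 * P\<^sup>2 / 4) * exp (- (1 * \<bar>of_int p\<bar>))"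
      using theta_ser_term_bound[OF P, of 0 "of_real \<omega>" 0 p] by (simp add: fourier_exp_def)
    then show ?thesis by (auto simp: norm_mult indicator_def)
  qed
  have m: "(\<lambda>\<omega>. ?F \<omega> p) \<in> borel_measurable borel" for p by measurable
  have "integral {0..pi} (\<lambda>\<omega>. theta_ser P 0 (of_real \<omega>) * fourier_exp (- j) \<omega>) = (\<integral>\<omega>. (\<integral>p. ?F \<omega> p \<partial>count_space UNIV) \<partial>lborel)"
    unfolding lebesgue_eq_HK_interval(2)[OF cont2, symmetric] unfolding set_lebesgue_integral_def theta_ser_real_eq
    by (intro Bochner_Integration.integral_cong) auto
  also have "\<dots> = (\<integral>p. (\<integral>\<omega>. ?F \<omega> p \<partial>lborel) \<partial>count_space UNIV)"
    by (rule integral_swap_int(2)[OF m le])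
  also have "(\<lambda>p. \<integral>\<omega>. ?F \<omega> p \<partial>lborel) = (\<lambda>p. if p = j then of_real (pi * gauss_coeff P j) else 0)"
  proof
    fix p
    have "(\<integral>\<omega>. ?F \<omega> p \<partial>lborel) = integral {0..pi} (\<lambda>\<omega>. of_real (gauss_coeff P p) * fourier_exp p \<omega> * fourier_exp (- j) \<omega>)"
      unfolding set_lebesgue_integral_def[symmetric]
      by (intro lebesgue_eq_HK_interval(2) continuous_intros fourier_exp_continuous)
    also have "\<dots> = of_real (gauss_coeff P p) * integral {0..pi} (\<lambda>\<omega>. fourier_exp p \<omega> * fourier_exp (- j) \<omega>)"
      by (simp add: mult.assoc)
    finally show "(\<integral>\<omega>. ?F \<omega> p \<partial>lborel) = (if p = j then of_real (pi * gauss_coeff P j) else 0)"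
      unfolding fourier_exp_orthogonal by simp
  qed
  also have "(\<integral>p. (if p = j then of_real (pi * gauss_coeff P j) else 0) \<partial>count_space UNIV) = complex_of_real (pi * gauss_coeff P j)"
  proof (rule LIMSEQ_unique[OF integral_int_eq_lim])
    show "integrable (count_space UNIV) (\<lambda>p. if p = j then complex_of_real (pi * gauss_coeff P j) else 0)"
      unfolding \<open>(\<lambda>p. \<integral>\<omega>. ?F \<omega> p \<partial>lborel) = _\<close>[symmetric] by (rule integral_swap_int(1)[OF m le])
    show "(\<lambda>n. \<Sum>q\<in>{- int n..<int n}. if q = j then complex_of_real (pi * gauss_coeff P j) else 0) \<longlonglongrightarrow> of_real (pi * gauss_coeff P j)"
    proof (rule tendsto_eventually)
      show "\<forall>\<^sub>F n in sequentially. (\<Sum>q\<in>{- int n..<int n}. if q = j then complex_of_real (pi * gauss_coeff P j) else 0) = of_real (pi * gauss_coeff P j)"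
        using eventually_gt_at_top[of "nat \<bar>j\<bar>"] by eventually_elim (auto simp: sum.delta)
    qed
  qed
  finally show ?thesis .
qed

lemma theta_term_bound:
  assumes "P > 0" "\<bar>\<omega>\<bar> \<le> pi"
  shows "exp (- (P * (\<omega> + pi * of_int q))\<^sup>2) \<le> exp (1\<^sup>2 * (1 / P)\<^sup>2 / 4 + pi) * exp (- (1 * \<bar>of_int q\<bar>))"
proof -
  define y where "y = \<omega> + pi * of_int q"
  have "exp (- (P * y)\<^sup>2) = exp (- (y / (1 / P))\<^sup>2)" by (simp add: mult.commute)
  also have "\<dots> \<le> exp (1\<^sup>2 * (1 / P)\<^sup>2 / 4) * exp (- (1 * \<bar>y\<bar>))" using assms by (intro gaussian_exp_bound) auto
  also have "\<dots> \<le> exp (1\<^sup>2 * (1 / P)\<^sup>2 / 4) * exp (pi + - (1 * \<bar>of_int q\<bar>))"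
  proof (intro mult_left_mono)
    have "\<bar>pi * of_int q\<bar> \<le> \<bar>y\<bar> + \<bar>\<omega>\<bar>" unfolding y_def by linarith
    moreover have "1 * \<bar>real_of_int q\<bar> \<le> pi * \<bar>of_int q\<bar>" using pi_gt3 by (intro mult_right_mono) auto
    ultimately have "\<bar>real_of_int q\<bar> \<le> \<bar>y\<bar> + pi" using assms(2) by (simp add: abs_mult)
    then show "exp (- (1 * \<bar>y\<bar>)) \<le> exp (pi + - (1 * \<bar>of_int q\<bar>))" by simp
  qed auto
  also have "\<dots> = exp (1\<^sup>2 * (1 / P)\<^sup>2 / 4 + pi) * exp (- (1 * \<bar>of_int q\<bar>))" unfolding exp_add by (simp only: mult.assoc)
  finally show ?thesis unfolding y_def .
qed

lemma theta_term_integrable: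
  assumes "P > 0" "\<bar>\<omega>\<bar> \<le> pi"
  shows "integrable (count_space UNIV) (\<lambda>q::int. exp (- (P * (\<omega> + pi * of_int q))\<^sup>2))"
proof (rule Bochner_Integration.integrable_bound)
  show "integrable (count_space UNIV) (\<lambda>q::int. exp (1\<^sup>2 * (1 / P)\<^sup>2 / 4 + pi) * exp (- (1 * \<bar>of_int q\<bar>)))"
    by (intro integrable_mult_right integrable_int_exp) auto
qed (use theta_term_bound[OF assms] in auto)

lemma theta_fun_eq_integral:
  assumes "P > 0" "\<bar>\<omega>\<bar> \<le> pi"
  shows "theta_fun P \<omega> = sqrt pi * P * (\<integral>q. exp (- (P * (\<omega> + pi * of_int q))\<^sup>2) \<partial>count_space (UNIV :: int set))"
proof -
  have "Infinite_Set_Sum.abs_summable_on (\<lambda>q::int. exp (- (P * (\<omega> + pi * of_int q))\<^sup>2)) UNIV"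
    using theta_term_integrable[OF assms] by (simp add: Infinite_Set_Sum.abs_summable_on_def)
  from infsetsum_infsum[OF this] show ?thesis
    unfolding theta_fun_def by (simp add: infsetsum_def)
qed

lemma theta_fun_continuous:
  assumes P: "P > 0"
  shows "continuous_on {0..pi} (theta_fun P)"
proof -
  have "continuous_on {0..pi} (\<lambda>\<omega>. sqrt pi * P * (\<integral>q. exp (- (P * (\<omega> + pi * of_int q))\<^sup>2) \<partial>count_space (UNIV :: int set)))"
    unfolding continuous_on_sequentially comp_def
  proof (intro allI ballI impI tendsto_mult tendsto_const)
    fix X \<omega> assume "\<omega> \<in> {0..pi}" and X: "(\<forall>n::nat. X n \<in> {0..pi}) \<and> X \<longlonglongrightarrow> \<omega>"
    show "(\<lambda>n. \<integral>q. exp (- (P * (X n + pi * of_int q))\<^sup>2) \<partial>count_space (UNIV :: int set)) \<longlonglongrightarrow> (\<integral>q. exp (- (P * (\<omega> + pi * of_int q))\<^sup>2) \<partial>count_space (UNIV :: int set))"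
    proof (rule integral_dominated_convergence)
      show "integrable (count_space UNIV) (\<lambda>q::int. exp (1\<^sup>2 * (1 / P)\<^sup>2 / 4 + pi) * exp (- (1 * \<bar>of_int q\<bar>)))"
        by (intro integrable_mult_right integrable_int_exp) auto
      show "AE q in count_space (UNIV :: int set). (\<lambda>n. exp (- (P * (X n + pi * of_int q))\<^sup>2)) \<longlonglongrightarrow> exp (- (P * (\<omega> + pi * of_int q))\<^sup>2)"
        using X by (intro AE_I2 tendsto_intros) auto
      show "AE q in count_space (UNIV :: int set). norm (exp (- (P * (X n + pi * of_int q))\<^sup>2)) \<le> exp (1\<^sup>2 * (1 / P)\<^sup>2 / 4 + pi) * exp (- (1 * \<bar>of_int q\<bar>))" for n
        using theta_term_bound[OF P, of "X n"] X by (intro AE_I2) auto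
    qed auto
  qed
  then show ?thesis
    by (rule continuous_on_eq) (auto simp: theta_fun_eq_integral[OF P])
qed

text \<open>
  Unfolding: the translates of \<open>[0, \<pi>]\<close> by \<open>\<pi> q\<close> fill the line, and \<open>fourier_exp j\<close> is \<open>\<pi>\<close>-periodic. With a
  primitive \<open>G\<close> of the resulting entire integrand the sum over \<open>q\<close> telescopes to the Fourier integral of
  a single Gaussian.
\<close>

lemma theta_fun_fourier_coeff:
  assumes P: "P > 0"
  shows "integral {0..pi} (\<lambda>\<omega>. of_real (theta_fun P \<omega>) * fourier_exp j \<omega>) = of_real (pi * gauss_coeff P j)"
proof -
  define f where "f = (\<lambda>w::complex. exp (- (w / of_real (1 / P))\<^sup>2 - 2 * \<i> * of_real (of_int j) * w))"
  have fr: "f (of_real x) = gauss_osc (1 / P) (of_int j) x" for x by (simp add: f_def gauss_osc_def)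
  have hol: "f holomorphic_on UNIV" unfolding f_def using P by (intro holomorphic_intros) auto
  obtain G where G: "\<And>w. (G has_field_derivative f w) (at w)"
    using holomorphic_convex_primitive'[OF convex_UNIV open_UNIV hol] by auto
  let ?b = "\<lambda>\<omega> (q::int). exp (- (P * (\<omega> + pi * of_int q))\<^sup>2)"
  let ?F = "\<lambda>\<omega> q. indicator {0..pi} \<omega> *\<^sub>R (of_real (?b \<omega> q) * fourier_exp j \<omega>)"
  define H where "H = (\<lambda>q::int. G (of_real (pi * of_int q)))"
  have bf: "of_real (?b \<omega> q) * fourier_exp j \<omega> = f (of_real \<omega> + of_real (pi * of_int q))" for \<omega> q
  proof -
    have per: "exp (2 * \<i> * of_int j * of_real (pi * of_int q)) = 1"
    proof -
      have "2 * \<i> * of_int j * of_real (pi * of_int q) = \<i> * (of_int (j * q) * (of_real pi * 2))" by simp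
      then show ?thesis by (simp only: exp_2pi_1_int)
    qed
    have "of_real (?b \<omega> q) * fourier_exp j \<omega> = exp (2 * \<i> * of_int j * of_real (pi * of_int q)) * f (of_real \<omega> + of_real (pi * of_int q))"
      unfolding f_def fourier_exp_def exp_of_real[symmetric] mult_exp_exp using P
      by (intro arg_cong[where f = exp]) (simp add: algebra_simps power_mult_distrib)
    then show ?thesis unfolding per by simp
  qed
  have Fint: "(\<integral>\<omega>. ?F \<omega> q \<partial>lborel) = H (q + 1) - H q" for q
  proof -
    have "(\<integral>\<omega>. ?F \<omega> q \<partial>lborel) = (LINT \<omega>:{0..pi}|lborel. f (of_real \<omega> + of_real (pi * of_int q)))"
      unfolding bf set_lebesgue_integral_def ..
    also have "\<dots> = G (of_real pi + of_real (pi * of_int q)) - G (of_real 0 + of_real (pi * of_int q))"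
      by (rule integral_horizontal[OF G]) simp
    finally show ?thesis by (simp add: H_def algebra_simps)
  qed
  have le: "norm (?F \<omega> q) \<le> indicator {0..pi} \<omega> * (exp (1\<^sup>2 * (1 / P)\<^sup>2 / 4 + pi) * exp (- (1 * \<bar>of_int q\<bar>)))" for \<omega> q
    using theta_term_bound[OF P, of \<omega> q] by (auto simp: indicator_def norm_mult)
  have m: "(\<lambda>\<omega>. ?F \<omega> q) \<in> borel_measurable borel" for q by measurable
  have tele: "(\<Sum>q\<in>{- int n..<int n}. H (q + 1) - H q) = H (int n) - H (- int n)" for n
  proof (induction n)
    case (Suc n)
    have "{- int (Suc n)..<int (Suc n)} = insert (- int n - 1) (insert (int n) {- int n..<int n})" by auto
    then have "(\<Sum>q\<in>{- int (Suc n)..<int (Suc n)}. H (q + 1) - H q) = (H (- int n - 1 + 1) - H (- int n - 1)) + ((H (int n + 1) - H (int n)) + (H (int n) - H (- int n)))"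
      using Suc by simp
    also have "\<dots> = H (int n + 1) - H (- int n - 1)" by simp
    also have "int n + 1 = int (Suc n)" by simp
    also have "- int n - 1 = - int (Suc n)" by simp
    finally show ?case .
  qed simp
  have gi: "integrable lborel (gauss_osc (1 / P) (of_int j))"
    using gauss_osc_poly_integrable[of "1 / P" 0 "of_int j"] P by simp
  have HL: "H (int n) - H (- int n) = (LINT x:{- (pi * real n)..pi * real n}|lborel. gauss_osc (1 / P) (of_int j) x)" for n
    using integral_horizontal[OF G, of "- (pi * real n)" "pi * real n" 0] by (simp add: H_def fr)
  have "(\<integral>q. H (q + 1) - H q \<partial>count_space UNIV) = (\<integral>x. gauss_osc (1 / P) (of_int j) x \<partial>lborel)"
  proof (rule LIMSEQ_unique[OF integral_int_eq_lim])
    show "integrable (count_space UNIV) (\<lambda>q. H (q + 1) - H q)"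
      unfolding Fint[symmetric] by (rule integral_swap_int(1)[OF m le])
    show "(\<lambda>n. \<Sum>q\<in>{- int n..<int n}. H (q + 1) - H q) \<longlonglongrightarrow> (\<integral>x. gauss_osc (1 / P) (of_int j) x \<partial>lborel)"
      unfolding tele HL using pi_gt3 by (intro tendsto_integral_scaled_exhaustion gi) simp
  qed
  also have "\<dots> = of_real (k_fun (1 / P) (of_int j))" using P by (intro k_fun_eq_integral) simp
  finally have sumH: "(\<integral>q. H (q + 1) - H q \<partial>count_space UNIV) = of_real (k_fun (1 / P) (of_int j))" .
  have cont2: "continuous_on {0..pi} (\<lambda>\<omega>. of_real (theta_fun P \<omega>) * fourier_exp j \<omega>)"
    by (intro continuous_on_mult continuous_on_of_real theta_fun_continuous[OF P] fourier_exp_continuous)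
  have "integral {0..pi} (\<lambda>\<omega>. of_real (theta_fun P \<omega>) * fourier_exp j \<omega>) = (\<integral>\<omega>. of_real (sqrt pi * P) * (\<integral>q. ?F \<omega> q \<partial>count_space UNIV) \<partial>lborel)"
    unfolding lebesgue_eq_HK_interval(2)[OF cont2, symmetric] set_lebesgue_integral_def
  proof (rule Bochner_Integration.integral_cong[OF refl])
    fix \<omega> :: real
    show "indicator {0..pi} \<omega> *\<^sub>R (of_real (theta_fun P \<omega>) * fourier_exp j \<omega>) = of_real (sqrt pi * P) * (\<integral>q. ?F \<omega> q \<partial>count_space UNIV)"
    proof (cases "\<omega> \<in> {0..pi}")
      case True
      then show ?thesis using theta_fun_eq_integral[OF P, of \<omega>] by simp
    qed simp
  qed
  also have "\<dots> = of_real (sqrt pi * P) * (\<integral>\<omega>. (\<integral>q. ?F \<omega> q \<partial>count_space UNIV) \<partial>lborel)"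
    by (rule Bochner_Integration.integral_mult_right_zero)
  also have "(\<integral>\<omega>. (\<integral>q. ?F \<omega> q \<partial>count_space UNIV) \<partial>lborel) = (\<integral>q. (\<integral>\<omega>. ?F \<omega> q \<partial>lborel) \<partial>count_space UNIV)"
    by (rule integral_swap_int(2)[OF m le])
  also have "\<dots> = of_real (k_fun (1 / P) (of_int j))" unfolding Fint by (rule sumH)
  also have "of_real (sqrt pi * P) * complex_of_real (k_fun (1 / P) (of_int j)) = of_real (pi * gauss_coeff P j)"
  proof -
    have "sqrt pi * P * k_fun (1 / P) (of_int j) = (sqrt pi * sqrt pi) * exp (- (of_int j / P)\<^sup>2)"
      using P by (simp add: k_fun_def)
    then have "sqrt pi * P * k_fun (1 / P) (of_int j) = pi * gauss_coeff P j" by (simp add: gauss_coeff_def)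
    then show ?thesis unfolding of_real_mult[symmetric] by (rule arg_cong)
  qed
  finally show ?thesis .
qed

text \<open>
  Both sides are continuous on \<open>[0, \<pi>]\<close> with the same Fourier coefficients.
\<close>

theorem theta_fun_poisson:
  assumes P: "P > 0" and w: "0 < \<omega>" "\<omega> < pi"
  shows "of_real (theta_fun P \<omega>) = theta_ser P 0 (of_real \<omega>)"
proof -
  have c1: "continuous_on {0..pi} (\<lambda>\<omega>. theta_ser P 0 (of_real \<omega>))"
  proof -
    have "continuous_on UNIV (theta_ser P 0)"
      using theta_ser_deriv[OF P, of 0] DERIV_isCont by (metis continuous_at_imp_continuous_on zero_le)
    then show ?thesis by (rule continuous_on_compose2) (auto intro!: continuous_intros)
  qed
  have c2: "continuous_on {0..pi} (\<lambda>\<omega>. complex_of_real (theta_fun P \<omega>))"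
    by (intro continuous_on_of_real theta_fun_continuous[OF P])
  have "of_real (theta_fun P \<omega>) - theta_ser P 0 (of_real \<omega>) = 0"
  proof (rule fourier_coeffs_zero[OF _ w])
    show "continuous_on {0..pi} (\<lambda>\<omega>. of_real (theta_fun P \<omega>) - theta_ser P 0 (of_real \<omega>))"
      by (intro continuous_on_diff c1 c2)
    fix j
    have i1: "(\<lambda>\<omega>. of_real (theta_fun P \<omega>) * fourier_exp j \<omega>) integrable_on {0..pi}"
      "(\<lambda>\<omega>. theta_ser P 0 (of_real \<omega>) * fourier_exp j \<omega>) integrable_on {0..pi}"
      by (intro integrable_continuous_real continuous_on_mult c1 c2 fourier_exp_continuous)+
    have "integral {0..pi} (\<lambda>\<omega>. (of_real (theta_fun P \<omega>) - theta_ser P 0 (of_real \<omega>)) * fourier_exp j \<omega>)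
      = integral {0..pi} (\<lambda>\<omega>. of_real (theta_fun P \<omega>) * fourier_exp j \<omega>) - integral {0..pi} (\<lambda>\<omega>. theta_ser P 0 (of_real \<omega>) * fourier_exp j \<omega>)"
      unfolding left_diff_distrib by (rule Henstock_Kurzweil_Integration.integral_diff[OF i1])
    also have "\<dots> = 0"
      using theta_fun_fourier_coeff[OF P, of j] theta_ser_fourier_coeff[OF P, of "- j"] by (simp add: gauss_coeff_def)
    finally show "integral {0..pi} (\<lambda>\<omega>. (of_real (theta_fun P \<omega>) - theta_ser P 0 (of_real \<omega>)) * fourier_exp j \<omega>) = 0" .
  qed
  then show ?thesis by simp
qed

lemma deriv_of_real_eq:
  fixes f :: "real \<Rightarrow> real" and F F' :: "complex \<Rightarrow> complex"
  assumes I: "open I" "x \<in> I" and eq: "\<And>y. y \<in> I \<Longrightarrow> of_real (f y) = F (of_real y)"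
    and F: "(F has_field_derivative F' (of_real x)) (at (of_real x))"
  shows "of_real (deriv f x) = F' (of_real x)"
proof -
  have "((\<lambda>y. F (of_real y)) has_vector_derivative F' (of_real x)) (at x)"
    by (rule has_vector_derivative_real_field[OF F])
  then have v: "((\<lambda>y. complex_of_real (f y)) has_vector_derivative F' (of_real x)) (at x)"
    by (rule has_vector_derivative_transform_within_open[OF _ I]) (simp add: eq)
  have "((\<lambda>y. Re (complex_of_real (f y))) has_vector_derivative Re (F' (of_real x))) (at x)"
    by (rule bounded_linear.has_vector_derivative[OF bounded_linear_Re v])
  then have r: "(f has_real_derivative Re (F' (of_real x))) (at x)" by (simp add: has_real_derivative_iff_has_vector_derivative)
  have "((\<lambda>y. complex_of_real (f y)) has_vector_derivative of_real (Re (F' (of_real x)))) (at x)"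
    by (rule has_vector_derivative_of_real[OF r])
  then have "of_real (Re (F' (of_real x))) = F' (of_real x)" using v vector_derivative_unique_at by blast
  then show ?thesis using DERIV_imp_deriv[OF r] by simp
qed

text \<open>
  Differentiation requires the identity on an open set, here the open interval \<open>(0, \<pi>)\<close>.
\<close>

lemma theta_fun_deriv2:
  assumes P: "P > 0" and w: "0 < \<omega>" "\<omega> < pi"
  shows "of_real (deriv (deriv (theta_fun P)) \<omega>) = theta_ser P 2 (of_real \<omega>)"
proof -
  have o: "open {0<..<pi}" by simp
  have d1: "of_real (deriv (theta_fun P) y) = theta_ser P 1 (of_real y)" if "y \<in> {0<..<pi}" for y
    by (rule deriv_of_real_eq[OF o that, where F = "theta_ser P 0" and F' = "theta_ser P 1"]) (use theta_fun_poisson[OF P] theta_ser_deriv[OF P, of 0] in auto)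
  have "of_real (deriv (deriv (theta_fun P)) \<omega>) = theta_ser P 2 (of_real \<omega>)"
    by (rule deriv_of_real_eq[OF o, where F = "theta_ser P 1" and F' = "theta_ser P 2"]) (use w d1 theta_ser_deriv[OF P, of 1] in \<open>auto simp: numeral_2_eq_2\<close>)
  then show ?thesis .
qed

section \<open>Integration against the spectral weight\<close>

lemma (in pair_sigma_finite) product_integral_complex:
  fixes f :: "'a \<Rightarrow> complex" and g :: "'b \<Rightarrow> complex"
  assumes f: "integrable M1 f" and g: "integrable M2 g"
  shows "integrable (M1 \<Otimes>\<^sub>M M2) (\<lambda>x. f (fst x) * g (snd x))"
    and "(\<integral>x. f (fst x) * g (snd x) \<partial>(M1 \<Otimes>\<^sub>M M2)) = (\<integral>x. f x \<partial>M1) * (\<integral>y. g y \<partial>M2)"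
proof -
  have [measurable]: "f \<in> borel_measurable M1" "g \<in> borel_measurable M2" using f g by auto
  show int: "integrable (M1 \<Otimes>\<^sub>M M2) (\<lambda>x. f (fst x) * g (snd x))"
  proof (rule Bochner_Integration.integrable_bound)
    show "integrable (M1 \<Otimes>\<^sub>M M2) (\<lambda>x. norm (f (fst x)) * norm (g (snd x)))"
      using f g by (intro integrable_product) auto
    show "(\<lambda>x. f (fst x) * g (snd x)) \<in> borel_measurable (M1 \<Otimes>\<^sub>M M2)" by measurable
  qed (auto simp: norm_mult)
  show "(\<integral>x. f (fst x) * g (snd x) \<partial>(M1 \<Otimes>\<^sub>M M2)) = (\<integral>x. f x \<partial>M1) * (\<integral>y. g y \<partial>M2)"
    using integral_fst'[OF int] by simp
qed

definition spectral_weight :: "real \<Rightarrow> real \<Rightarrow> real \<times> int \<Rightarrow> real" where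
  "spectral_weight K P x = weight_h K P (fst x) (snd x) * ((fst x)\<^sup>2 + (of_int (snd x))\<^sup>2)"

lemma weight_h_eq: "weight_h K P \<kappa> p = exp (- (\<kappa> / K)\<^sup>2) * gauss_coeff P p"
  by (simp add: weight_h_def gauss_coeff_def flip: exp_add)

lemma spectral_weight_nonneg: "spectral_weight K P x \<ge> 0"
  by (simp add: spectral_weight_def weight_h_def)

lemma one_plus_square_le_exp: "1 + x\<^sup>2 \<le> exp (2 * \<bar>x :: real\<bar>)"
proof -
  have "1 + 2 * \<bar>x\<bar> + (2 * \<bar>x\<bar>)\<^sup>2 / 2 \<le> exp (2 * \<bar>x\<bar>)" by (rule exp_lower_Taylor_quadratic) simp
  then have "1 + 2 * \<bar>x\<bar> + 2 * x\<^sup>2 \<le> exp (2 * \<bar>x\<bar>)" by (simp add: power_mult_distrib)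
  then show ?thesis using zero_le_power2[of x] abs_ge_zero[of x] by linarith
qed

text \<open>
  The weight absorbs the factor \<open>1 + 2 \<bar>p\<bar>\<close> by which the angular coefficients may grow. Gaussians beat every
  exponential, and the exponents \<open>3\<close> and \<open>5\<close> leave one unit after \<open>\<kappa>\<^sup>2 + p\<^sup>2\<close> and \<open>1 + 2 \<bar>p\<bar>\<close> have been paid for.
\<close>

lemma spectral_weight_bound:
  assumes "K > 0" "P > 0"
  obtains D where "D \<ge> 0" "\<And>x. spectral_weight K P x * (1 + 2 * \<bar>of_int (snd x)\<bar>) \<le> D * (exp (- (1 * \<bar>fst x\<bar>)) * exp (- (1 * \<bar>of_int (snd x)\<bar>)))"
proof -
  define D1 where "D1 = exp (3\<^sup>2 * K\<^sup>2 / 4)"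
  define D2 where "D2 = exp (5\<^sup>2 * P\<^sup>2 / 4)"
  show ?thesis
  proof (rule that[of "D1 * D2"])
    show "D1 * D2 \<ge> 0" by (simp add: D1_def D2_def)
    fix x :: "real \<times> int"
    define \<kappa> where "\<kappa> = fst x"
    define q where "q = real_of_int (snd x)"
    have a: "exp (- (\<kappa> / K)\<^sup>2) \<le> D1 * exp (- (3 * \<bar>\<kappa>\<bar>))" unfolding D1_def by (rule gaussian_exp_bound[OF assms(1)])
    have b: "gauss_coeff P (snd x) \<le> D2 * exp (- (5 * \<bar>q\<bar>))" unfolding D2_def gauss_coeff_def q_def by (rule gaussian_exp_bound[OF assms(2)])
    have c: "\<kappa>\<^sup>2 + q\<^sup>2 \<le> exp (2 * \<bar>\<kappa>\<bar>) * exp (2 * \<bar>q\<bar>)"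
    proof -
      have "\<kappa>\<^sup>2 + q\<^sup>2 \<le> (1 + \<kappa>\<^sup>2) * (1 + q\<^sup>2)" by (simp add: algebra_simps)
      also have "\<dots> \<le> exp (2 * \<bar>\<kappa>\<bar>) * exp (2 * \<bar>q\<bar>)" by (intro mult_mono one_plus_square_le_exp) auto
      finally show ?thesis .
    qed
    have d: "1 + 2 * \<bar>q\<bar> \<le> exp (2 * \<bar>q\<bar>)" by (rule exp_ge_add_one_self)
    have "spectral_weight K P x * (1 + 2 * \<bar>q\<bar>) = (exp (- (\<kappa> / K)\<^sup>2) * gauss_coeff P (snd x)) * (\<kappa>\<^sup>2 + q\<^sup>2) * (1 + 2 * \<bar>q\<bar>)"
      by (simp add: spectral_weight_def weight_h_eq \<kappa>_def q_def)
    also have "\<dots> \<le> ((D1 * exp (- (3 * \<bar>\<kappa>\<bar>))) * (D2 * exp (- (5 * \<bar>q\<bar>)))) * (exp (2 * \<bar>\<kappa>\<bar>) * exp (2 * \<bar>q\<bar>)) * exp (2 * \<bar>q\<bar>)"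
      by (intro mult_mono a b c d) (auto simp: D1_def D2_def gauss_coeff_def)
    also have "\<dots> = D1 * D2 * ((exp (- (3 * \<bar>\<kappa>\<bar>)) * exp (2 * \<bar>\<kappa>\<bar>)) * (exp (- (5 * \<bar>q\<bar>)) * exp (2 * \<bar>q\<bar>) * exp (2 * \<bar>q\<bar>)))"
      by (simp only: mult_ac)
    also have "exp (- (3 * \<bar>\<kappa>\<bar>)) * exp (2 * \<bar>\<kappa>\<bar>) = exp (- (1 * \<bar>\<kappa>\<bar>))" unfolding exp_add[symmetric] by simp
    also have "exp (- (5 * \<bar>q\<bar>)) * exp (2 * \<bar>q\<bar>) * exp (2 * \<bar>q\<bar>) = exp (- (1 * \<bar>q\<bar>))" unfolding exp_add[symmetric] by simp
    finally show "spectral_weight K P x * (1 + 2 * \<bar>of_int (snd x)\<bar>) \<le> D1 * D2 * (exp (- (1 * \<bar>fst x\<bar>)) * exp (- (1 * \<bar>of_int (snd x)\<bar>)))"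
      unfolding \<kappa>_def q_def .
  qed
qed

interpretation spec: pair_sigma_finite lborel "count_space (UNIV :: int set)"
  by (rule pair_sigma_finite_lborel_int)

lemma mu_A_sigma_finite: "sigma_finite_measure mu_A"
  unfolding mu_A_def by (rule spec.sigma_finite_measure_axioms)

interpretation spec_r: pair_sigma_finite mu_A lborel
  by (intro pair_sigma_finite.intro mu_A_sigma_finite lborel.sigma_finite_measure_axioms)

lemma exp_weight_integrable:
  "integrable mu_A (\<lambda>x. exp (- (1 * \<bar>fst x\<bar>)) * exp (- (1 * \<bar>of_int (snd x)\<bar>)))"
  unfolding mu_A_def by (intro spec.integrable_product integrable_exp_neg_abs integrable_int_exp) auto

lemma measurable_mu_A_r:
  fixes f :: "int \<Rightarrow> real \<times> real \<Rightarrow> complex"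
  assumes "\<And>p. f p \<in> borel_measurable (borel \<Otimes>\<^sub>M borel)"
  shows "(\<lambda>x. f (snd (fst x)) (fst (fst x), snd x)) \<in> borel_measurable (mu_A \<Otimes>\<^sub>M lborel)"
proof (rule measurable_compose_countable'[where f = "\<lambda>p x. f p (fst (fst x), snd x)" and g = "\<lambda>x. snd (fst x)" and I = UNIV])
  show "(\<lambda>x. f p (fst (fst x), snd x)) \<in> borel_measurable (mu_A \<Otimes>\<^sub>M lborel)" for p
    using assms[of p] unfolding mu_A_def by measurable
  show "(\<lambda>x. snd (fst x)) \<in> mu_A \<Otimes>\<^sub>M lborel \<rightarrow>\<^sub>M count_space UNIV"
    unfolding mu_A_def by measurable
qed auto

text \<open>
  The common criterion for both changes of the order of integration: the second variable of \<open>y\<close> is \<open>r\<close> in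
  the first one and \<open>\<omega>\<close> in the second one.
\<close>

lemma spectral_integrable:
  fixes f :: "int \<Rightarrow> real \<times> real \<Rightarrow> complex" and g :: "real \<Rightarrow> real"
  assumes KP: "K > 0" "P > 0" and C: "C \<ge> 0" and g: "integrable lborel g"
    and m: "\<And>p. f p \<in> borel_measurable (borel \<Otimes>\<^sub>M borel)"
    and le: "\<And>p y. norm (f p y) \<le> C * (1 + 2 * \<bar>of_int p\<bar>) * g (snd y)"
  shows "integrable (mu_A \<Otimes>\<^sub>M lborel) (\<lambda>x. of_real (spectral_weight K P (fst x)) * f (snd (fst x)) (fst (fst x), snd x))"
proof -
  obtain D where D: "D \<ge> 0" "\<And>x. spectral_weight K P x * (1 + 2 * \<bar>of_int (snd x)\<bar>) \<le> D * (exp (- (1 * \<bar>fst x\<bar>)) * exp (- (1 * \<bar>of_int (snd x)\<bar>)))"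
    using spectral_weight_bound[OF KP] by blast
  show ?thesis
  proof (rule Bochner_Integration.integrable_bound)
    show "integrable (mu_A \<Otimes>\<^sub>M lborel) (\<lambda>x. (C * D * (exp (- (1 * \<bar>fst (fst x)\<bar>)) * exp (- (1 * \<bar>of_int (snd (fst x))\<bar>)))) * \<bar>g (snd x)\<bar>)"
      by (rule spec_r.integrable_product[OF integrable_mult_right[OF exp_weight_integrable] integrable_abs[OF g]])
    have "(\<lambda>x. (\<lambda>p y. of_real (spectral_weight K P (fst y, p)) * f p y) (snd (fst x)) (fst (fst x), snd x)) \<in> borel_measurable (mu_A \<Otimes>\<^sub>M lborel)"
    proof (rule measurable_mu_A_r)
      fix p
      have [measurable]: "f p \<in> borel_measurable (borel \<Otimes>\<^sub>M borel)" by (rule m)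
      show "(\<lambda>y. of_real (spectral_weight K P (fst y, p)) * f p y) \<in> borel_measurable (borel \<Otimes>\<^sub>M borel)"
        unfolding spectral_weight_def weight_h_def fst_conv snd_conv by measurable
    qed
    then show "(\<lambda>x. of_real (spectral_weight K P (fst x)) * f (snd (fst x)) (fst (fst x), snd x)) \<in> borel_measurable (mu_A \<Otimes>\<^sub>M lborel)"
      by simp
    show "AE x in mu_A \<Otimes>\<^sub>M lborel. norm (of_real (spectral_weight K P (fst x)) * f (snd (fst x)) (fst (fst x), snd x))
       \<le> norm ((C * D * (exp (- (1 * \<bar>fst (fst x)\<bar>)) * exp (- (1 * \<bar>of_int (snd (fst x))\<bar>)))) * \<bar>g (snd x)\<bar>)"
    proof (rule AE_I2)
      fix x :: "(real \<times> int) \<times> real"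
      let ?s = "spectral_weight K P (fst x)" and ?q = "1 + 2 * \<bar>real_of_int (snd (fst x))\<bar>"
      have "norm (of_real ?s * f (snd (fst x)) (fst (fst x), snd x)) \<le> ?s * (C * ?q * \<bar>g (snd x)\<bar>)"
      proof -
        have "norm (f (snd (fst x)) (fst (fst x), snd x)) \<le> C * ?q * \<bar>g (snd x)\<bar>"
        proof -
          have "norm (f (snd (fst x)) (fst (fst x), snd x)) \<le> C * ?q * g (snd x)"
            using le[of "snd (fst x)" "(fst (fst x), snd x)"] by simp
          also have "\<dots> \<le> C * ?q * \<bar>g (snd x)\<bar>" using C by (intro mult_left_mono) auto
          finally show ?thesis .
        qed
        then show ?thesis unfolding norm_mult norm_of_real using spectral_weight_nonneg[of K P "fst x"]
          by (intro mult_mono) auto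
      qed
      also have "\<dots> = C * (?s * ?q) * \<bar>g (snd x)\<bar>" by (simp only: mult_ac)
      also have "\<dots> \<le> C * (D * (exp (- (1 * \<bar>fst (fst x)\<bar>)) * exp (- (1 * \<bar>of_int (snd (fst x))\<bar>)))) * \<bar>g (snd x)\<bar>"
        using D(2)[of "fst x"] C by (intro mult_right_mono mult_left_mono) auto
      also have "\<dots> \<le> norm ((C * D * (exp (- (1 * \<bar>fst (fst x)\<bar>)) * exp (- (1 * \<bar>of_int (snd (fst x))\<bar>)))) * \<bar>g (snd x)\<bar>)"
        unfolding real_norm_def by (simp only: mult.assoc abs_ge_self)
      finally show "norm (of_real ?s * f (snd (fst x)) (fst (fst x), snd x))
       \<le> norm ((C * D * (exp (- (1 * \<bar>fst (fst x)\<bar>)) * exp (- (1 * \<bar>of_int (snd (fst x))\<bar>)))) * \<bar>g (snd x)\<bar>)" .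
    qed
  qed
qed

text \<open>
  The integral factorizes into a sum of two products, since \<open>\<kappa>\<^sup>2 + p\<^sup>2\<close> is a sum. The factors \<open>\<kappa>\<^sup>2\<close> and \<open>p\<^sup>2\<close> produce
  \<open>- k'' / 4\<close> and \<open>- \<theta>'' / 4\<close>, and the outer factor \<open>4\<close> of the kernel cancels the denominators.
\<close>

lemma spectral_integral:
  assumes K: "K > 0" and P: "P > 0" and w: "0 < \<omega>" "\<omega> < pi"
  shows "4 * (\<integral>x. of_real (spectral_weight K P x) * (exp (- 2 * (\<i> * of_real (fst x)) * of_real r) * fourier_exp (snd x) \<omega>) \<partial>mu_A)
    = - of_real (deriv (deriv (k_fun K)) r * theta_fun P \<omega> + k_fun K r * deriv (deriv (theta_fun P)) \<omega>)"
proof -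
  have gK: "of_real (exp (- (\<kappa> / K)\<^sup>2)) * exp (- 2 * (\<i> * of_real \<kappa>) * of_real r) = gauss_osc K r \<kappa>" for \<kappa>
    unfolding gauss_osc_def exp_of_real[symmetric] mult_exp_exp by (rule arg_cong[where f = exp]) (simp add: algebra_simps)
  let ?b = "\<lambda>p. of_real (gauss_coeff P p) * fourier_exp p \<omega>"
  let ?b2 = "\<lambda>p. of_real (gauss_coeff P p) * ((- (2 * \<i> * of_int p)) ^ 2 * exp (- (2 * \<i> * of_int p * of_real \<omega>)))"
  let ?a = "\<lambda>\<kappa>. gauss_osc K r \<kappa>"
  let ?a2 = "\<lambda>\<kappa>. of_real \<kappa> ^ 2 * gauss_osc K r \<kappa>"
  have eq: "of_real (spectral_weight K P x) * (exp (- 2 * (\<i> * of_real (fst x)) * of_real r) * fourier_exp (snd x) \<omega>)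
     = ?a2 (fst x) * ?b (snd x) + ?a (fst x) * (- (1 / 4) * ?b2 (snd x))" for x
  proof -
    have "of_real (spectral_weight K P x) * (exp (- 2 * (\<i> * of_real (fst x)) * of_real r) * fourier_exp (snd x) \<omega>)
      = (of_real (exp (- (fst x / K)\<^sup>2)) * exp (- 2 * (\<i> * of_real (fst x)) * of_real r)) * ?b (snd x) * (of_real (fst x) ^ 2 + of_int (snd x) ^ 2)"
      unfolding spectral_weight_def weight_h_eq by simp
    also have "\<dots> = ?a2 (fst x) * ?b (snd x) + ?a (fst x) * (- (1 / 4) * ?b2 (snd x))"
      unfolding gK by (simp add: fourier_exp_def power_mult_distrib algebra_simps)
    finally show ?thesis .
  qed
  have ia: "integrable lborel ?a" using gauss_osc_poly_integrable[OF K, of 0 r] by simp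
  have ia2: "integrable lborel ?a2" by (rule gauss_osc_poly_integrable[OF K]) simp
  have ib: "integrable (count_space UNIV) ?b" using theta_ser_term_integrable[OF P, of 0 "of_real \<omega>"] by (simp add: fourier_exp_def)
  have ib2: "integrable (count_space UNIV) (\<lambda>p. - (1 / 4) * ?b2 p)"
    by (intro integrable_mult_right theta_ser_term_integrable[OF P]) simp
  have "(\<integral>x. of_real (spectral_weight K P x) * (exp (- 2 * (\<i> * of_real (fst x)) * of_real r) * fourier_exp (snd x) \<omega>) \<partial>mu_A)
     = (\<integral>\<kappa>. ?a2 \<kappa> \<partial>lborel) * (\<integral>p. ?b p \<partial>count_space UNIV) + (\<integral>\<kappa>. ?a \<kappa> \<partial>lborel) * (\<integral>p. - (1 / 4) * ?b2 p \<partial>count_space UNIV)"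
    unfolding eq mu_A_def
    by (subst Bochner_Integration.integral_add[OF spec.product_integral_complex(1)[OF ia2 ib] spec.product_integral_complex(1)[OF ia ib2]])
      (simp only: spec.product_integral_complex(2)[OF ia2 ib] spec.product_integral_complex(2)[OF ia ib2])
  also have "(\<integral>p. - (1 / 4) * ?b2 p \<partial>count_space UNIV) = - (1 / 4) * theta_ser P 2 (of_real \<omega>)"
    unfolding theta_ser_def by (rule Bochner_Integration.integral_mult_right_zero)
  finally have main: "(\<integral>x. of_real (spectral_weight K P x) * (exp (- 2 * (\<i> * of_real (fst x)) * of_real r) * fourier_exp (snd x) \<omega>) \<partial>mu_A)
     = (- of_real (deriv (deriv (k_fun K)) r) / 4) * of_real (theta_fun P \<omega>) + of_real (k_fun K r) * (- (1 / 4) * of_real (deriv (deriv (theta_fun P)) \<omega>))"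
    unfolding theta_ser_real_eq[symmetric] theta_fun_poisson[OF P w, symmetric] theta_fun_deriv2[OF P w, symmetric]
      k_fun_eq_integral[OF K] k_fun_deriv2_eq_integral[OF K] .
  show ?thesis unfolding main by (simp add: algebra_simps)
qed

section \<open>The two sides of the transform formula\<close>

definition transform_kernel :: "int \<Rightarrow> complex \<Rightarrow> real \<times> real \<Rightarrow> complex" where
  "transform_kernel p z y = 4 * exp (- 2 * (\<i> * of_real (fst y)) * of_real (snd y)) * angular_coeff p z (snd y)"

definition transform_integrand :: "real \<Rightarrow> real \<Rightarrow> complex \<Rightarrow> (real \<times> int) \<times> real \<Rightarrow> complex" where
  "transform_integrand K P z x = of_real (spectral_weight K P (fst x)) * transform_kernel (snd (fst x)) z (fst (fst x), snd x)"

lemma transform_integrand_integrable: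
  assumes KP: "K > 0" "P > 0" and z: "z \<noteq> 0"
  shows "integrable (mu_A \<Otimes>\<^sub>M lborel) (transform_integrand K P z)"
proof -
  obtain C where C: "C \<ge> 0" "\<And>p r. norm (angular_coeff p z r) \<le> C * (1 + 2 * \<bar>of_int p\<bar>) * exp (- (1 / 2 * \<bar>r\<bar>))"
    using angular_coeff_decay[OF z] by blast
  show ?thesis
    unfolding transform_integrand_def[abs_def]
  proof (rule spectral_integrable[OF KP])
    show "4 * C \<ge> 0" using C by simp
    show "integrable lborel (\<lambda>r::real. exp (- (1 / 2 * \<bar>r\<bar>)))" by (rule integrable_exp_neg_abs) simp
    show "transform_kernel p z \<in> borel_measurable (borel \<Otimes>\<^sub>M borel)" for p
      unfolding transform_kernel_def[abs_def] by measurable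
    show "norm (transform_kernel p z y) \<le> 4 * C * (1 + 2 * \<bar>of_int p\<bar>) * exp (- (1 / 2 * \<bar>snd y\<bar>))" for p y
      using C(2)[of p "snd y"] by (simp add: transform_kernel_def norm_mult mult.assoc)
  qed
qed

lemma H_integrand_eq:
  assumes "z \<noteq> 0" "fst x \<noteq> 0"
  shows "(\<integral>r. transform_integrand K P z (x, r) \<partial>lborel) = H_integrand K P z x"
proof -
  have "(\<integral>r. transform_integrand K P z (x, r) \<partial>lborel) =
     (\<integral>r. (of_real (spectral_weight K P x) * 4) * (exp (- 2 * (\<i> * of_real (fst x)) * of_real r) * angular_coeff (snd x) z r) \<partial>lborel)"
    by (simp add: transform_integrand_def transform_kernel_def mult.assoc)
  also have "\<dots> = (of_real (spectral_weight K P x) * 4) * (\<integral>r. exp (- 2 * (\<i> * of_real (fst x)) * of_real r) * angular_coeff (snd x) z r \<partial>lborel)"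
    by (rule Bochner_Integration.integral_mult_right_zero)
  also have "\<dots> = of_real (spectral_weight K P x) * bold_J (\<i> * of_real (fst x)) (snd x) z"
    unfolding bold_J_integral[OF assms(2,1)] by simp
  also have "\<dots> = H_integrand K P z x"
    by (simp add: H_integrand_def spectral_weight_def split_beta' mult_ac)
  finally show ?thesis .
qed

text \<open>
  The value of the kernel at \<open>\<kappa> = 0\<close> is a limit that need not be computed: it affects a null set, and measurability
  of \<open>H_integrand\<close> follows from that of the integral representation for each \<open>p\<close> separately.
\<close>

lemma H_integrand_AE:
  assumes KP: "K > 0" "P > 0" and z: "z \<noteq> 0"
  shows "H_integrand K P z \<in> borel_measurable mu_A"
    and "AE x in mu_A. (\<integral>r. transform_integrand K P z (x, r) \<partial>lborel) = H_integrand K P z x"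
proof -
  have int: "integrable mu_A (\<lambda>x. \<integral>r. transform_integrand K P z (x, r) \<partial>lborel)"
    by (rule spec_r.integrable_fst'[OF transform_integrand_integrable[OF KP z]])
  then have m: "(\<lambda>x. \<integral>r. transform_integrand K P z (x, r) \<partial>lborel) \<in> borel_measurable (lborel \<Otimes>\<^sub>M count_space UNIV)"
    unfolding mu_A_def by auto
  have mp: "(\<lambda>\<kappa>. H_integrand K P z (\<kappa>, p)) \<in> borel_measurable lborel" for p
  proof (rule measurable_discrete_difference[where X = "{0}"])
    show "(\<lambda>\<kappa>. \<integral>r. transform_integrand K P z ((\<kappa>, p), r) \<partial>lborel) \<in> borel_measurable lborel"
      by (rule measurable_compose[OF _ m]) measurable
    show "(\<integral>r. transform_integrand K P z ((\<kappa>, p), r) \<partial>lborel) = H_integrand K P z (\<kappa>, p)"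
      if "\<kappa> \<in> space lborel" "\<kappa> \<notin> {0}" for \<kappa>
      using that by (intro H_integrand_eq[OF z]) auto
  qed auto
  have "(\<lambda>x. H_integrand K P z (fst x, snd x)) \<in> borel_measurable (lborel \<Otimes>\<^sub>M count_space UNIV)"
    by (rule measurable_pair_int[OF mp])
  then show "H_integrand K P z \<in> borel_measurable mu_A" unfolding mu_A_def by simp
  have "AE x in lborel \<Otimes>\<^sub>M count_space (UNIV :: int set). fst x \<noteq> (0 :: real)"
  proof (rule spec.AE_pair_measure)
    show "{x \<in> space (lborel \<Otimes>\<^sub>M count_space (UNIV :: int set)). fst x \<noteq> (0 :: real)} \<in> sets (lborel \<Otimes>\<^sub>M count_space UNIV)"
      by measurable
    show "AE \<kappa> in lborel. AE p in count_space (UNIV :: int set). fst (\<kappa>, p) \<noteq> (0 :: real)"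
      using AE_lborel_singleton[of 0] by eventually_elim simp
  qed
  then show "AE x in mu_A. (\<integral>r. transform_integrand K P z (x, r) \<partial>lborel) = H_integrand K P z x"
    unfolding mu_A_def by eventually_elim (rule H_integrand_eq[OF z])
qed

text \<open>
  For fixed \<open>r\<close> the angular coefficient is written out as an integral over \<open>\<omega>\<close> and the integration over
  \<open>(\<kappa>, p)\<close> is done first. The endpoint \<open>\<omega> = 0\<close> is excluded, as \<open>spectral_integral\<close> holds on the open interval.
\<close>

lemma transform_inner:
  assumes KP: "K > 0" "P > 0"
  shows "(\<integral>x. transform_integrand K P z (x, r) \<partial>mu_A) = (\<integral>\<omega>. indicator {0..<pi} \<omega> *\<^sub>R (- of_real (dual_integrand K P z (r, \<omega>))) \<partial>lborel)"
proof -
  define c where "c = (\<lambda>\<omega>. complex_of_real (cos (2 * Re (z * trh r \<omega>))))"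
  have cm [measurable]: "c \<in> borel_measurable borel"
    unfolding c_def trh_def by (intro borel_measurable_continuous_onI continuous_intros)
  define f where "f = (\<lambda>p y. 4 * exp (- 2 * (\<i> * of_real (fst y)) * of_real r) * (indicator {0..<pi} (snd y) *\<^sub>R (c (snd y) * fourier_exp p (snd y))))"
  define G where "G = (\<lambda>x. of_real (spectral_weight K P (fst x)) * f (snd (fst x)) (fst (fst x), snd x))"
  have cn: "norm (c \<omega>) \<le> 1" for \<omega> by (simp add: c_def)
  have int: "integrable (mu_A \<Otimes>\<^sub>M lborel) G"
    unfolding G_def
  proof (rule spectral_integrable[OF KP])
    show "integrable lborel (indicator {0..<pi} :: real \<Rightarrow> real)" by (rule integrable_real_indicator) auto
    show "f p \<in> borel_measurable (borel \<Otimes>\<^sub>M borel)" for p unfolding f_def by measurable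
    show "norm (f p y) \<le> 4 * (1 + 2 * \<bar>of_int p\<bar>) * indicator {0..<pi} (snd y)" for p y
      using cn[of "snd y"] by (auto simp: f_def norm_mult indicator_def)
  qed simp
  have "(\<integral>x. transform_integrand K P z (x, r) \<partial>mu_A) = (\<integral>x. (\<integral>\<omega>. G (x, \<omega>) \<partial>lborel) \<partial>mu_A)"
  proof (rule Bochner_Integration.integral_cong[OF refl])
    fix x :: "real \<times> int"
    have "(\<integral>\<omega>. G (x, \<omega>) \<partial>lborel) = (\<integral>\<omega>. (of_real (spectral_weight K P x) * (4 * exp (- 2 * (\<i> * of_real (fst x)) * of_real r))) * (indicator {0..<pi} \<omega> *\<^sub>R (c \<omega> * fourier_exp (snd x) \<omega>)) \<partial>lborel)"
      by (simp add: G_def f_def mult.assoc)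
    also have "\<dots> = (of_real (spectral_weight K P x) * (4 * exp (- 2 * (\<i> * of_real (fst x)) * of_real r))) * (\<integral>\<omega>. indicator {0..<pi} \<omega> *\<^sub>R (c \<omega> * fourier_exp (snd x) \<omega>) \<partial>lborel)"
      by (rule Bochner_Integration.integral_mult_right_zero)
    also have "(\<integral>\<omega>. indicator {0..<pi} \<omega> *\<^sub>R (c \<omega> * fourier_exp (snd x) \<omega>) \<partial>lborel) = angular_coeff (snd x) z r"
      unfolding angular_coeff_def set_lebesgue_integral_def c_def fourier_exp_def ..
    finally show "transform_integrand K P z (x, r) = (\<integral>\<omega>. G (x, \<omega>) \<partial>lborel)"
      unfolding transform_integrand_def transform_kernel_def by (simp add: mult.assoc)
  qed
  also have "\<dots> = (\<integral>\<omega>. (\<integral>x. G (x, \<omega>) \<partial>mu_A) \<partial>lborel)"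
    by (rule spec_r.Fubini_integral[symmetric]) (use int in \<open>simp add: split_beta'\<close>)
  also have "\<dots> = (\<integral>\<omega>. indicator {0..<pi} \<omega> *\<^sub>R (- of_real (dual_integrand K P z (r, \<omega>))) \<partial>lborel)"
  proof (rule Bochner_Integration.integral_cong_AE)
    show "(\<lambda>\<omega>. \<integral>x. G (x, \<omega>) \<partial>mu_A) \<in> borel_measurable lborel"
      using spec_r.integrable_snd[of "\<lambda>x \<omega>. G (x, \<omega>)"] int by (auto simp: split_beta')
    have Gi: "(\<integral>x. G (x, \<omega>) \<partial>mu_A) = indicator {0..<pi} \<omega> *\<^sub>R (- of_real (dual_integrand K P z (r, \<omega>)))" if "\<omega> \<noteq> 0" for \<omega>
    proof (cases "\<omega> \<in> {0..<pi}")
      case True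
      then have w: "0 < \<omega>" "\<omega> < pi" using that by auto
      have "(\<integral>x. G (x, \<omega>) \<partial>mu_A) = (\<integral>x. (c \<omega> * 4) * (of_real (spectral_weight K P x) * (exp (- 2 * (\<i> * of_real (fst x)) * of_real r) * fourier_exp (snd x) \<omega>)) \<partial>mu_A)"
        using True by (intro Bochner_Integration.integral_cong[OF refl]) (simp add: G_def f_def mult_ac)
      also have "\<dots> = (c \<omega> * 4) * (\<integral>x. of_real (spectral_weight K P x) * (exp (- 2 * (\<i> * of_real (fst x)) * of_real r) * fourier_exp (snd x) \<omega>) \<partial>mu_A)"
        by (rule Bochner_Integration.integral_mult_right_zero)
      also have "\<dots> = c \<omega> * (- of_real (deriv (deriv (k_fun K)) r * theta_fun P \<omega> + k_fun K r * deriv (deriv (theta_fun P)) \<omega>))"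
        unfolding mult.assoc[of "c \<omega>"] spectral_integral[OF KP w] ..
      also have "\<dots> = - of_real (dual_integrand K P z (r, \<omega>))"
        unfolding dual_integrand_def c_def prod.case of_real_mult mult_minus_right ..
      finally show ?thesis using True by simp
    next
      case False
      then show ?thesis by (simp add: G_def f_def)
    qed
    then show ae: "AE \<omega> in lborel. (\<integral>x. G (x, \<omega>) \<partial>mu_A) = indicator {0..<pi} \<omega> *\<^sub>R (- of_real (dual_integrand K P z (r, \<omega>)))"
      using AE_lborel_singleton[of 0] by (rule_tac AE_mp) (auto intro!: AE_I2)
    show "(\<lambda>\<omega>. indicator {0..<pi} \<omega> *\<^sub>R (- complex_of_real (dual_integrand K P z (r, \<omega>)))) \<in> borel_measurable lborel"
    proof (rule measurable_discrete_difference[where X = "{0}"])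
      show "(\<lambda>\<omega>. \<integral>x. G (x, \<omega>) \<partial>mu_A) \<in> borel_measurable lborel" by fact
    qed (use Gi in auto)
  qed
  finally show ?thesis .
qed

lemma theta_ser_bounded:
  assumes "P > 0" "j \<le> 2"
  obtains B where "\<And>\<omega>. norm (theta_ser P j (of_real \<omega>)) \<le> B"
proof -
  define B where "B = (\<integral>p. 8 * exp ((2 * 0 + 2)\<^sup>2 * P\<^sup>2 / 4) * exp (- (1 * \<bar>of_int p\<bar>)) \<partial>count_space (UNIV :: int set))"
  show ?thesis
  proof (rule that)
    fix \<omega> :: real
    let ?t = "\<lambda>p::int. of_real (gauss_coeff P p) * ((- (2 * \<i> * of_int p)) ^ j * exp (- (2 * \<i> * of_int p * of_real \<omega>)))"
    have "norm (theta_ser P j (of_real \<omega>)) \<le> (\<integral>p. norm (?t p) \<partial>count_space UNIV)"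
      unfolding theta_ser_def by (rule integral_norm_bound)
    also have "\<dots> \<le> B" unfolding B_def
    proof (rule integral_mono)
      show "integrable (count_space UNIV) (\<lambda>p. norm (?t p))"
        by (intro integrable_norm theta_ser_term_integrable assms)
      show "integrable (count_space UNIV) (\<lambda>p::int. 8 * exp ((2 * 0 + 2)\<^sup>2 * P\<^sup>2 / 4) * exp (- (1 * \<bar>of_int p\<bar>)) :: real)"
        by (intro integrable_mult_right integrable_int_exp) simp
      show "norm (?t p) \<le> 8 * exp ((2 * 0 + 2)\<^sup>2 * P\<^sup>2 / 4) * exp (- (1 * \<bar>of_int p\<bar>))" for p
        by (rule theta_ser_term_bound[OF assms]) simp
    qed
    finally show "norm (theta_ser P j (of_real \<omega>)) \<le> B" .
  qed
qed

lemma k_fun_integrable: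
  assumes K: "K > 0"
  shows "integrable lborel (k_fun K)" "integrable lborel (deriv (deriv (k_fun K)))"
proof -
  have k: "k_fun K r = sqrt pi * K * exp (- (r / (1 / K))\<^sup>2)" for r by (simp add: k_fun_def mult.commute)
  have b: "norm (of_real r ^ j * gauss_osc (1 / K) 0 r) = \<bar>r\<bar> ^ j * exp (- (r / (1 / K))\<^sup>2)" for r j
    by (simp only: norm_mult norm_power norm_of_real norm_gauss_osc)
  have i: "integrable lborel (\<lambda>r. \<bar>r\<bar> ^ j * exp (- (r / (1 / K))\<^sup>2))" if "j \<le> 2" for j
    using integrable_norm[OF gauss_osc_poly_integrable[of "1 / K" j 0]] K that unfolding b by simp
  show 1: "integrable lborel (k_fun K)"
    unfolding k[abs_def] using i[of 0] by (intro integrable_mult_right) simp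
  have k2: "deriv (deriv (k_fun K)) = (\<lambda>r. (sqrt pi * K * 4 * K ^ 4) * (\<bar>r\<bar> ^ 2 * exp (- (r / (1 / K))\<^sup>2)) - 2 * K\<^sup>2 * k_fun K r)"
    by (rule ext, unfold deriv2_k_fun[OF K] k) (simp add: algebra_simps)
  show "integrable lborel (deriv (deriv (k_fun K)))"
    unfolding k2 by (intro Bochner_Integration.integrable_diff integrable_mult_right i 1) simp
qed

text \<open>
  On \<open>(0, \<pi>)\<close> the theta function and its second derivative agree with the series \<open>theta_ser\<close>, which is
  continuous and bounded on the whole real line; this supplies both measurability and the majorant.
\<close>

lemma dual_integrand_integrable:
  assumes K: "K > 0" and P: "P > 0"
  shows "integrable mu_A_hat (dual_integrand K P z)"
proof -
  define N where "N = restrict_space lborel {0..<pi :: real}"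
  have spN: "space N = {0..<pi}" by (simp add: N_def space_restrict_space)
  have idN: "(\<lambda>x. x) \<in> N \<rightarrow>\<^sub>M borel" unfolding N_def by (rule measurable_restrict_space1) simp
  have sing: "{0} \<in> sets N"
    unfolding N_def sets_restrict_space by (rule image_eqI[of _ _ "{0}"]) (auto)
  interpret N: finite_measure N
    by (rule finite_measureI) (simp add: spN, simp add: N_def emeasure_restrict_space)
  interpret pair_sigma_finite lborel N
    by (intro pair_sigma_finite.intro lborel.sigma_finite_measure_axioms N.sigma_finite_measure_axioms)
  define th where "th = (\<lambda>j \<omega>. Re (theta_ser P j (of_real \<omega>)))"
  have td1: "(theta_ser P 1 has_field_derivative theta_ser P 2 w) (at w)" for w
    using theta_ser_deriv[OF P, of 1 w] by (simp add: numeral_2_eq_2)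
  have tc: "continuous_on UNIV (theta_ser P j)" if "j \<in> {0, 2}" for j
  proof (cases "j = 0")
    case True
    have "isCont (theta_ser P 0) w" for w by (rule DERIV_isCont[OF theta_ser_deriv[OF P]]) simp
    then show ?thesis unfolding True by (intro continuous_at_imp_continuous_on ballI)
  next
    case False
    then have j: "j = 2" using that by auto
    have "theta_ser P 1 holomorphic_on UNIV"
      by (rule holomorphic_on_open[THEN iffD2, OF open_UNIV]) (use td1 in blast)
    then have "deriv (theta_ser P 1) holomorphic_on UNIV" by (rule holomorphic_deriv[OF _ open_UNIV])
    moreover have "deriv (theta_ser P 1) = theta_ser P 2" by (rule ext) (rule DERIV_imp_deriv[OF td1])
    ultimately show ?thesis unfolding j by (simp only: holomorphic_on_imp_continuous_on)
  qed
  have thc: "th j \<in> borel_measurable borel" if "j \<in> {0, 2}" for j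
  proof -
    have "continuous_on UNIV (\<lambda>\<omega>. theta_ser P j (of_real \<omega>))"
      by (rule continuous_on_compose2[OF tc[OF that]]) (auto intro!: continuous_intros)
    then have "continuous_on UNIV (th j)" unfolding th_def by (rule continuous_on_Re)
    then show ?thesis by (rule borel_measurable_continuous_onI)
  qed
  have e0: "th 0 \<omega> = theta_fun P \<omega>" "th 2 \<omega> = deriv (deriv (theta_fun P)) \<omega>" if "\<omega> \<in> space N" "\<omega> \<notin> {0}" for \<omega>
  proof -
    have w: "0 < \<omega>" "\<omega> < pi" using that by (auto simp: spN)
    show "th 0 \<omega> = theta_fun P \<omega>" "th 2 \<omega> = deriv (deriv (theta_fun P)) \<omega>"
      unfolding th_def theta_fun_poisson[OF P w, symmetric] theta_fun_deriv2[OF P w, symmetric] by simp_all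
  qed
  have [measurable]: "theta_fun P \<in> borel_measurable N"
  proof (rule measurable_discrete_difference[where X = "{0}"])
    show "th 0 \<in> borel_measurable N" by (rule measurable_compose[OF idN thc]) simp
  qed (use sing e0 in auto)
  have [measurable]: "deriv (deriv (theta_fun P)) \<in> borel_measurable N"
  proof (rule measurable_discrete_difference[where X = "{0}"])
    show "th 2 \<in> borel_measurable N" by (rule measurable_compose[OF idN thc]) simp
  qed (use sing e0 in auto)
  obtain B0 where B0: "\<And>\<omega>. norm (theta_ser P 0 (of_real \<omega>)) \<le> B0" using theta_ser_bounded[OF P, of 0] by auto
  obtain B2 where B2: "\<And>\<omega>. norm (theta_ser P 2 (of_real \<omega>)) \<le> B2" using theta_ser_bounded[OF P, of 2] by auto
  have B: "B0 \<ge> 0" "B2 \<ge> 0" using order_trans[OF norm_ge_zero B0] order_trans[OF norm_ge_zero B2] by auto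
  have km [measurable]: "k_fun K \<in> borel_measurable borel" "deriv (deriv (k_fun K)) \<in> borel_measurable borel"
    using k_fun_integrable[OF K] by auto
  have [measurable]: "(cosh :: real \<Rightarrow> real) \<in> borel_measurable borel" "(sinh :: real \<Rightarrow> real) \<in> borel_measurable borel"
    by (intro borel_measurable_continuous_onI continuous_intros)+
  have cN: "cos \<in> borel_measurable N" "sin \<in> borel_measurable N"
    by (rule measurable_compose[OF idN]; measurable)+
  note [measurable] = cN
  have dual: "dual_integrand K P z x = cos (2 * (Re z * (cosh (fst x) * cos (snd x)) - Im z * (sinh (fst x) * sin (snd x)))) *
     (deriv (deriv (k_fun K)) (fst x) * theta_fun P (snd x) + k_fun K (fst x) * deriv (deriv (theta_fun P)) (snd x))" for x
    by (simp add: dual_integrand_def trh_def split_beta')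
  have "integrable (lborel \<Otimes>\<^sub>M N) (dual_integrand K P z)"
  proof (rule Bochner_Integration.integrable_bound)
    have "integrable (lborel \<Otimes>\<^sub>M N) (\<lambda>x. (\<bar>deriv (deriv (k_fun K)) (fst x)\<bar> * B0 + \<bar>k_fun K (fst x)\<bar> * B2) * 1)"
    proof (rule integrable_product)
      show "integrable lborel (\<lambda>r. \<bar>deriv (deriv (k_fun K)) r\<bar> * B0 + \<bar>k_fun K r\<bar> * B2)"
        using k_fun_integrable[OF K] by (intro Bochner_Integration.integrable_add integrable_mult_left integrable_abs)
      show "integrable N (\<lambda>_. 1::real)" by simp
    qed
    then show "integrable (lborel \<Otimes>\<^sub>M N) (\<lambda>x. \<bar>deriv (deriv (k_fun K)) (fst x)\<bar> * B0 + \<bar>k_fun K (fst x)\<bar> * B2)" by simp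
    show "dual_integrand K P z \<in> borel_measurable (lborel \<Otimes>\<^sub>M N)"
      unfolding dual[abs_def] by measurable
    have "AE x in lborel \<Otimes>\<^sub>M N. snd x \<noteq> 0"
    proof (rule AE_pair_measure)
      show "{x \<in> space (lborel \<Otimes>\<^sub>M N). snd x \<noteq> 0} \<in> sets (lborel \<Otimes>\<^sub>M N)"
      proof -
        have "{x \<in> space (lborel \<Otimes>\<^sub>M N). snd x \<noteq> 0} = UNIV \<times> (space N - {0})" by (auto simp: space_pair_measure)
        also have "\<dots> \<in> sets (lborel \<Otimes>\<^sub>M N)"
          by (rule pair_measureI[OF _ sets.Diff[OF sets.top sing]]) simp
        finally show ?thesis .
      qed
      have "AE \<omega> in N. \<omega> \<noteq> 0"
        unfolding N_def by (subst AE_restrict_space_iff) (use AE_lborel_singleton[of 0] in auto)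
      then show "AE r in lborel. AE \<omega> in N. snd (r, \<omega>) \<noteq> 0" by simp
    qed
    then show "AE x in lborel \<Otimes>\<^sub>M N. norm (dual_integrand K P z x) \<le> norm (\<bar>deriv (deriv (k_fun K)) (fst x)\<bar> * B0 + \<bar>k_fun K (fst x)\<bar> * B2)"
    proof (rule AE_mp, intro AE_I2 impI)
      fix x :: "real \<times> real" assume x: "x \<in> space (lborel \<Otimes>\<^sub>M N)" "snd x \<noteq> 0"
      then have s: "snd x \<in> space N" "snd x \<notin> {0}" by (auto simp: space_pair_measure)
      have t: "\<bar>theta_fun P (snd x)\<bar> \<le> B0" "\<bar>deriv (deriv (theta_fun P)) (snd x)\<bar> \<le> B2"
        unfolding e0[OF s, symmetric] th_def using order_trans[OF abs_Re_le_cmod B0] order_trans[OF abs_Re_le_cmod B2] by auto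
      have "norm (dual_integrand K P z x) \<le> 1 * \<bar>deriv (deriv (k_fun K)) (fst x) * theta_fun P (snd x) + k_fun K (fst x) * deriv (deriv (theta_fun P)) (snd x)\<bar>"
        unfolding dual real_norm_def abs_mult[of "cos _"] by (intro mult_right_mono) auto
      also have "\<dots> \<le> \<bar>deriv (deriv (k_fun K)) (fst x)\<bar> * \<bar>theta_fun P (snd x)\<bar> + \<bar>k_fun K (fst x)\<bar> * \<bar>deriv (deriv (theta_fun P)) (snd x)\<bar>"
        unfolding abs_mult[symmetric] by simp
      also have "\<dots> \<le> \<bar>deriv (deriv (k_fun K)) (fst x)\<bar> * B0 + \<bar>k_fun K (fst x)\<bar> * B2"
        using t by (intro add_mono mult_left_mono) auto
      finally show "norm (dual_integrand K P z x) \<le> norm (\<bar>deriv (deriv (k_fun K)) (fst x)\<bar> * B0 + \<bar>k_fun K (fst x)\<bar> * B2)"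
        using B by simp
    qed
  qed
  then show ?thesis by (simp add: mu_A_hat_def N_def)
qed

theorem lemma5:
  fixes K P :: real and z :: complex
  assumes "K \<ge> 1 / 2" and "P \<ge> 1 / 2" and "z \<noteq> 0"
  shows "integrable mu_A (H_integrand K P z)
    \<and> integrable mu_A_hat (dual_integrand K P z)
    \<and> H_transform K P z = - of_real (integral\<^sup>L mu_A_hat (dual_integrand K P z))"
proof (intro conjI)
  have KP: "K > 0" "P > 0" using assms by auto
  note T = transform_integrand_integrable[OF KP assms(3)]
  have Ti: "integrable mu_A (\<lambda>x. \<integral>r. transform_integrand K P z (x, r) \<partial>lborel)"
    by (rule spec_r.integrable_fst'[OF T])
  note H = H_integrand_AE[OF KP assms(3)]
  show "integrable mu_A (H_integrand K P z)"
    using integrable_cong_AE[OF borel_measurable_integrable[OF Ti] H] Ti by simp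
  show D: "integrable mu_A_hat (dual_integrand K P z)" by (rule dual_integrand_integrable[OF KP])
  have D': "integrable mu_A_hat (\<lambda>x. complex_of_real (dual_integrand K P z x))" using D by simp
  interpret N: sigma_finite_measure "restrict_space lborel {0..<pi :: real}"
    by (rule sigma_finite_measure_restrict_space[OF lborel.sigma_finite_measure_axioms]) simp
  interpret R: pair_sigma_finite lborel "restrict_space lborel {0..<pi :: real}"
    by (intro pair_sigma_finite.intro lborel.sigma_finite_measure_axioms N.sigma_finite_measure_axioms)
  \<comment> \<open>first exchange: \<open>(\<kappa>, p)\<close> against \<open>r\<close>; the second one is \<open>transform_inner\<close>\<close>
  have "H_transform K P z = (\<integral>x. (\<integral>r. transform_integrand K P z (x, r) \<partial>lborel) \<partial>mu_A)"
    unfolding H_transform_def by (rule integral_cong_AE[OF borel_measurable_integrable[OF Ti] H, symmetric])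
  also have "\<dots> = (\<integral>r. (\<integral>x. transform_integrand K P z (x, r) \<partial>mu_A) \<partial>lborel)"
    by (rule spec_r.Fubini_integral[symmetric]) (use T in \<open>simp add: split_beta'\<close>)
  also have "\<dots> = (\<integral>r. - (\<integral>\<omega>. complex_of_real (dual_integrand K P z (r, \<omega>)) \<partial>restrict_space lborel {0..<pi}) \<partial>lborel)"
  proof (rule Bochner_Integration.integral_cong[OF refl])
    fix r :: real
    show "(\<integral>x. transform_integrand K P z (x, r) \<partial>mu_A) = - (\<integral>\<omega>. complex_of_real (dual_integrand K P z (r, \<omega>)) \<partial>restrict_space lborel {0..<pi})"
      unfolding transform_inner[OF KP] by (subst integral_restrict_space) auto
  qed
  also have "\<dots> = - (\<integral>x. complex_of_real (dual_integrand K P z x) \<partial>mu_A_hat)"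
    unfolding mu_A_hat_def R.integral_fst'[OF D'[unfolded mu_A_hat_def], symmetric] by simp
  finally show "H_transform K P z = - of_real (integral\<^sup>L mu_A_hat (dual_integrand K P z))" by simp
qed

end
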